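(* Let $\Gamma$ be an infinite row-finite directed graph, $F:\Gamma_{Ar}\to\mathbb R$ a potential and $\beta\in\mathbb R$, and assume that there is a vertex $v_0\in\Gamma_V$ such that $0<\sum_{n=0}^\infty A(\beta)^n_{v_0,v}<\infty$ for all $v\in\Gamma_V$. Then for every end $E\in\mathcal E(\Gamma)$ there is an affine homeomorphism between $M^{v_0}_{\beta F}(E)$ and $M^{v_0}_{F_\beta}(\pi(E))$.
   Context: A countable directed graph $\Gamma$ consists of countable sets $\Gamma_V$ (vertices) and $\Gamma_{Ar}$ (arrows) with source and range maps $s,r:\Gamma_{Ar}\to\Gamma_V$ (multiple arrows and loops allowed); it is row-finite if $\#s^{-1}(v)<\infty$ for all $v$. $P(\Gamma)$ is the set of infinite paths $p=(p_i)_{i\ge1}\in(\Gamma_{Ar})^{\mathbb N}$, $r(p_i)=s(p_{i+1})$, with the topology inherited from the product of discrete spaces. $P_f(\Gamma)$ is the set of finite paths $\mu=a_1\cdots a_n$ (vertices are paths of length $0$), $s(\mu)=s(a_1)$, $r(\mu)=r(a_n)$; $Z(\mu)=\{x\in P(\Gamma):x_i=a_i,\ 1\le i\le n\}$, $Z(v)=\{p:s(p_1)=v\}$. The shift is $\sigma(p)_i=p_{i+1}$. $F$ is extended to finite paths by $F(a_1\cdots a_n)=\sum_iF(a_i)$, $F(v)=0$. $A(\beta)_{v,w}=\sum_{a\in s^{-1}(v)\cap r^{-1}(w)}e^{-\beta F(a)}$, with matrix powers $A(\beta)^n$, $A(\beta)^0$ the identity. For any digraph $\Lambda$ and $G:\Lambda_{Ar}\to\mathbb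 R$, an $e^{G}$-conformal measure on $P(\Lambda)$ is a non-zero Borel measure $m$ with $m(Z(v))<\infty$ for all vertices $v$ and $m(\sigma(B\cap Z(a)))=e^{G(a)}m(B\cap Z(a))$ for all arrows $a$ and Borel sets $B$. It is $v_0$-normalized if $m(Z(v_0))=1$. Sets of conformal measures carry the weakest topology making all maps $m\mapsto m(Z(\mu))$, $\mu$ a finite path, continuous. $\mathrm{Wan}(\Gamma)$ is the set of $p\in P(\Gamma)$ such that for each finite $H\subseteq\Gamma_V$ there is $N$ with $s(p_i)\notin H$ for all $i\ge N$. For $p,q\in\mathrm{Wan}(\Gamma)$ write $p\to q$ if for every finite $H\subseteq\Gamma_V$ and $N$ there are $n_1,n_2\ge N$ and a finite path from $s(p_{n_1})$ to $s(q_{n_2})$ none of whose vertices is in $H$; $p\sim q$ means $p\to q$ and $q\to p$. An end is a $\sim$-equivalence class in $\mathrm{Wan}(\Gamma)$, and $\mathcal E(\Gamma)$ is the set of ends. For $H\subseteq\Gamma_V$ let $\mathrm{Int}\,H=\{v\in H:r(s^{-1}(v))\subseteq H\}$ and write $H\sqsubset H'$ if $H\subseteq\mathrm{Int}\,H'$. Fix a sequence $\{v_0\}\sqsubset D_1\sqsubset D_2\sqsubset\cdots$ of finite subsets of $\Gamma_V$ with $\bigcup_nD_n=\Gamma_V$; $D_0=\{v_0\}$, $D_{-1}=\emptyset$. For $w\in D\subseteq\Gamma_V$ let $\Omega_D(w)=\{y\in\mathrm{Wan}(\Gamma):s(y_1)=w,\ s(y_i)\notin D\ \forall i\ge2\}$,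 $\partial D=\{w\in D:\Omega_D(w)\ne\emptyset\}$. For $v\in D$, $w\notin D$, $L_D(v,w)$ is the set of finite paths $a_1\cdots a_n$ from $v$ to $w$ with $r(a_i)\notin D$ for all $i$. $\mathrm{Br}(\Gamma)$ is the Bratteli diagram (viewed as a digraph) whose $n$'th level of vertices, $n=0,1,2,\dots$, is $\partial D_n$, with exactly one arrow from $v\in\partial D_n$ to $w\in\partial D_{n+1}$ when $L_{D_n}(v,w)\ne\emptyset$, and no other arrows; paths in $\mathrm{Br}(\Gamma)$ are regarded as sequences of vertices. For an arrow $a$ of $\mathrm{Br}(\Gamma)$ from $v\in\partial D_k$ to $w\in\partial D_{k+1}$, $F_\beta(a)=-\log\big(\sum_{\mu\in L_{D_k}(v,w)}e^{-\beta F(\mu)}\big)$. The map $\pi:\mathrm{Wan}(\Gamma)\to P(\mathrm{Br}(\Gamma))$: given $y\in\mathrm{Wan}(\Gamma)$ let $k\geq 0$ be the number such that $s(y_i)\notin D_{k-1}$ for all $i$ while $s(y_j)\in D_k$ for some $j$; then for $i\ge1$, $\pi(y)_i\in\partial D_{k+i-1}$ is the last vertex of $y$ lying in $D_{k+i-1}$, i.e. $\pi(y)_i=s(y_j)\in D_{k+i-1}$ where $s(y_l)\notin D_{k+i-1}$ for all $l>j$. For each end $E$, $\pi(E)$ is an end (a $\sim$-class) in $P(\mathrm{Br}(\Gamma))$. $M^{v_0}_{\beta F}(E)$ is the (possibly empty) set of $v_0$-normalized $e^{\beta F}$-conformal measures $m$ on $P(\Gamma)$ with $m(P(\Gamma)\setminus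 E)=0$. $M^{v_0}_{F_\beta}(\pi(E))$ is the (possibly empty) set of $v_0$-normalized $e^{F_\beta}$-conformal measures $m'$ on $P(\mathrm{Br}(\Gamma))$ with $m'(P(\mathrm{Br}(\Gamma))\setminus\pi(E))=0$. *)

theory Defs
  imports "HOL-Analysis.Analysis" "Graph_Theory.Arc_Walk"
begin

text \<open>
  Directed graphs are the records of the entry Graph-Theory: \<^const>\<open>tail\<close> is the source map,
  \<^const>\<open>head\<close> the range map, and finite paths are \<^const>\<open>pre_digraph.awalk\<close>s, which include
  the paths of length 0.  Infinite paths are indexed from 0, so that the arrow \<open>p i\<close> is the
  arrow number \<open>i + 1\<close> under the convention that paths start with arrow number 1.
\<close>

section \<open>Path spaces and conformal measures\<close>

definition row_finite :: "('v, 'e) pre_digraph \<Rightarrow> bool" where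
  "row_finite G \<longleftrightarrow> (\<forall>v\<in>verts G. finite (out_arcs G v))"

definition inf_paths :: "('v, 'e) pre_digraph \<Rightarrow> (nat \<Rightarrow> 'e) set" where
  "inf_paths G = {p. \<forall>i. p i \<in> arcs G \<and> head G (p i) = tail G (p (Suc i))}"

definition path_topology :: "('v, 'e) pre_digraph \<Rightarrow> (nat \<Rightarrow> 'e) topology" where
  "path_topology G =
     subtopology (product_topology (\<lambda>_. discrete_topology (arcs G)) UNIV) (inf_paths G)"

definition path_borel :: "('v, 'e) pre_digraph \<Rightarrow> (nat \<Rightarrow> 'e) measure" where
  "path_borel G = sigma (inf_paths G) {U. openin (path_topology G) U}"

definition shift :: "(nat \<Rightarrow> 'e) \<Rightarrow> nat \<Rightarrow> 'e" where
  "shift p = (\<lambda>i. p (Suc i))"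

text \<open>
  The cylinder of the finite path with initial vertex \<open>v\<close> and list of arrows \<open>\<mu>\<close>; the cylinder
  of a vertex \<open>v\<close> is \<open>cyl G v []\<close>.
\<close>
definition cyl :: "('v, 'e) pre_digraph \<Rightarrow> 'v \<Rightarrow> 'e list \<Rightarrow> (nat \<Rightarrow> 'e) set" where
  "cyl G v \<mu> = {p \<in> inf_paths G. tail G (p 0) = v \<and> (\<forall>i<length \<mu>. p i = \<mu> ! i)}"

text \<open>The \<open>e\<^sup>\<phi>\<close>-conformal measures on the path space.\<close>
definition conformal ::
    "('v, 'e) pre_digraph \<Rightarrow> ('e \<Rightarrow> real) \<Rightarrow> (nat \<Rightarrow> 'e) measure \<Rightarrow> bool" where
  "conformal G \<phi> m \<longleftrightarrow>
     sets m = sets (path_borel G) \<and>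
     emeasure m (inf_paths G) \<noteq> 0 \<and>
     (\<forall>v\<in>verts G. emeasure m (cyl G v []) < \<infinity>) \<and>
     (\<forall>a\<in>arcs G. \<forall>B\<in>sets m.
        emeasure m (shift ` (B \<inter> cyl G (tail G a) [a])) =
        ennreal (exp (\<phi> a)) * emeasure m (B \<inter> cyl G (tail G a) [a]))"

text \<open>
  The \<open>v\<close>-normalized \<open>e\<^sup>\<phi>\<close>-conformal measures concentrated on \<open>E\<close>.  Membership in
  \<^const>\<open>null_sets\<close> says that the complement of \<open>E\<close> is Borel and has measure 0.
\<close>
definition conformal_on ::
    "('v, 'e) pre_digraph \<Rightarrow> ('e \<Rightarrow> real) \<Rightarrow> 'v \<Rightarrow> (nat \<Rightarrow> 'e) set \<Rightarrow> (nat \<Rightarrow> 'e) measure set" where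
  "conformal_on G \<phi> v E =
     {m. conformal G \<phi> m \<and> emeasure m (cyl G v []) = 1 \<and> inf_paths G - E \<in> null_sets m}"

text \<open>
  The weakest topology on a set of measures making the evaluations at cylinders of finite paths
  continuous.  The real-valued \<^const>\<open>measure\<close> may be used because a conformal measure is finite
  on cylinders.
\<close>
definition cyl_topology ::
    "('v, 'e) pre_digraph \<Rightarrow> (nat \<Rightarrow> 'e) measure set \<Rightarrow> (nat \<Rightarrow> 'e) measure topology" where
  "cyl_topology G M =
     topology_generated_by
       {{m \<in> M. measure m (cyl G v \<mu>) \<in> U} | v \<mu> w U. pre_digraph.awalk G v \<mu> w \<and> open U}"

section \<open>Affine maps between sets of measures\<close>

definition mix_measure :: "real \<Rightarrow> 'a measure \<Rightarrow> 'a measure \<Rightarrow> 'a measure" where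
  "mix_measure t m n =
     measure_of (space m) (sets m)
       (\<lambda>B. ennreal t * emeasure m B + ennreal (1 - t) * emeasure n B)"

lemma sets_mix_measure [simp]: "sets (mix_measure t m n) = sets m"
  by (simp add: mix_measure_def)

lemma space_mix_measure [simp]: "space (mix_measure t m n) = space m"
  by (simp add: mix_measure_def)

lemma emeasure_mix_measure:
  assumes "sets n = sets m" "B \<in> sets m"
  shows "emeasure (mix_measure t m n) B =
    ennreal t * emeasure m B + ennreal (1 - t) * emeasure n B"
proof (rule emeasure_measure_of[OF mix_measure_def])
  let ?\<mu> = "\<lambda>B. ennreal t * emeasure m B + ennreal (1 - t) * emeasure n B"
  show "sets m \<subseteq> Pow (space m)" by (rule sets.space_closed)
  show "B \<in> sets (mix_measure t m n)" using assms by simp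
  show "positive (sets (mix_measure t m n)) ?\<mu>" by (simp add: positive_def)
  show "countably_additive (sets (mix_measure t m n)) ?\<mu>"
  proof (rule countably_additiveI)
    fix A :: "nat \<Rightarrow> 'a set"
    assume A: "range A \<subseteq> sets (mix_measure t m n)" "disjoint_family A"
      "\<Union>(range A) \<in> sets (mix_measure t m n)"
    have "(\<Sum>i. ?\<mu> (A i)) =
        (\<Sum>i. ennreal t * emeasure m (A i)) + (\<Sum>i. ennreal (1 - t) * emeasure n (A i))"
      by (rule suminf_add[symmetric]) simp_all
    also have "\<dots> = ?\<mu> (\<Union>(range A))"
      using A assms by (simp add: suminf_emeasure)
    finally show "(\<Sum>i. ?\<mu> (A i)) = ?\<mu> (\<Union>(range A))" .
  qed
qed

definition affine_on :: "'a measure set \<Rightarrow> ('a measure \<Rightarrow> 'b measure) \<Rightarrow> bool" where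
  "affine_on M \<Phi> \<longleftrightarrow>
     (\<forall>m\<in>M. \<forall>n\<in>M. \<forall>t\<in>{0..1}. \<Phi> (mix_measure t m n) = mix_measure t (\<Phi> m) (\<Phi> n))"

section \<open>Ends\<close>

definition wan :: "('v, 'e) pre_digraph \<Rightarrow> (nat \<Rightarrow> 'e) set" where
  "wan G = {p \<in> inf_paths G.
     \<forall>H. H \<subseteq> verts G \<and> finite H \<longrightarrow> (\<exists>N. \<forall>i\<ge>N. tail G (p i) \<notin> H)}"

definition leads_to :: "('v, 'e) pre_digraph \<Rightarrow> (nat \<Rightarrow> 'e) \<Rightarrow> (nat \<Rightarrow> 'e) \<Rightarrow> bool" where
  "leads_to G p q \<longleftrightarrow>
     (\<forall>H N. H \<subseteq> verts G \<and> finite H \<longrightarrow>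
        (\<exists>i\<ge>N. \<exists>j\<ge>N. \<exists>\<mu>.
           pre_digraph.awalk G (tail G (p i)) \<mu> (tail G (q j)) \<and>
           set (pre_digraph.awalk_verts G (tail G (p i)) \<mu>) \<inter> H = {}))"

definition ends :: "('v, 'e) pre_digraph \<Rightarrow> (nat \<Rightarrow> 'e) set set" where
  "ends G = wan G // {(p, q). p \<in> wan G \<and> q \<in> wan G \<and> leads_to G p q \<and> leads_to G q p}"

section \<open>Powers of the weighted adjacency matrix\<close>

definition adj :: "('v, 'e) pre_digraph \<Rightarrow> ('e \<Rightarrow> real) \<Rightarrow> real \<Rightarrow> 'v \<Rightarrow> 'v \<Rightarrow> real" where
  "adj G F \<beta> v w = (\<Sum>a \<in> out_arcs G v \<inter> in_arcs G w. exp (- \<beta> * F a))"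

text \<open>Over a row-finite graph only finitely many terms of the sum below are non-zero.\<close>
primrec adj_pow ::
    "('v, 'e) pre_digraph \<Rightarrow> ('e \<Rightarrow> real) \<Rightarrow> real \<Rightarrow> nat \<Rightarrow> 'v \<Rightarrow> 'v \<Rightarrow> real" where
  "adj_pow G F \<beta> 0 v w = (if v = w then 1 else 0)"
| "adj_pow G F \<beta> (Suc n) v w = (\<Sum>\<^sub>\<infinity>u\<in>verts G. adj G F \<beta> v u * adj_pow G F \<beta> n u w)"

section \<open>The Bratteli diagram of an exhaustion\<close>

definition interior_verts :: "('v, 'e) pre_digraph \<Rightarrow> 'v set \<Rightarrow> 'v set" where
  "interior_verts G H = {v \<in> H. head G ` out_arcs G v \<subseteq> H}"

definition exhaustion :: "('v, 'e) pre_digraph \<Rightarrow> 'v \<Rightarrow> (nat \<Rightarrow> 'v set) \<Rightarrow> bool" where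
  "exhaustion G v0 D \<longleftrightarrow>
     D 0 = {v0} \<and>
     (\<forall>n. finite (D n) \<and> D n \<subseteq> verts G) \<and>
     (\<forall>n. D n \<subseteq> interior_verts G (D (Suc n))) \<and>
     (\<Union>n. D n) = verts G"

definition exit_paths :: "('v, 'e) pre_digraph \<Rightarrow> 'v set \<Rightarrow> 'v \<Rightarrow> (nat \<Rightarrow> 'e) set" where
  "exit_paths G D w = {y \<in> wan G. tail G (y 0) = w \<and> (\<forall>i\<ge>1. tail G (y i) \<notin> D)}"

definition exit_verts :: "('v, 'e) pre_digraph \<Rightarrow> 'v set \<Rightarrow> 'v set" where
  "exit_verts G D = {w \<in> D. exit_paths G D w \<noteq> {}}"

definition link_paths :: "('v, 'e) pre_digraph \<Rightarrow> 'v set \<Rightarrow> 'v \<Rightarrow> 'v \<Rightarrow> 'e list set" where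
  "link_paths G D v w =
     {\<mu>. v \<in> D \<and> w \<notin> D \<and> pre_digraph.awalk G v \<mu> w \<and> (\<forall>a\<in>set \<mu>. head G a \<notin> D)}"

text \<open>
  A vertex of level \<open>n\<close> is a pair \<open>(n, w)\<close>, which keeps the levels disjoint; since there is at
  most one arrow between two vertices, an arrow is the pair of its source and its range.
\<close>
definition bratteli ::
    "('v, 'e) pre_digraph \<Rightarrow> (nat \<Rightarrow> 'v set) \<Rightarrow>
     (nat \<times> 'v, (nat \<times> 'v) \<times> (nat \<times> 'v)) pre_digraph" where
  "bratteli G D =
     \<lparr> verts = {(n, w) | n w. w \<in> exit_verts G (D n)},
       arcs = {((n, v), (Suc n, w)) | n v w.
         v \<in> exit_verts G (D n) \<and> w \<in> exit_verts G (D (Suc n)) \<and> link_paths G (D n) v w \<noteq> {}},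
       tail = fst,
       head = snd \<rparr>"

definition bratteli_potential ::
    "('v, 'e) pre_digraph \<Rightarrow> ('e \<Rightarrow> real) \<Rightarrow> real \<Rightarrow> (nat \<Rightarrow> 'v set) \<Rightarrow>
     (nat \<times> 'v) \<times> (nat \<times> 'v) \<Rightarrow> real" where
  "bratteli_potential G F \<beta> D =
     (\<lambda>((k, v), (_, w)).
        - ln (\<Sum>\<^sub>\<infinity>\<mu> \<in> link_paths G (D k) v w. exp (- \<beta> * sum_list (map F \<mu>))))"

text \<open>The convention that \<open>D\<close> is empty at index \<open>-1\<close> is the case \<open>k = 0\<close> below.\<close>
definition start_level :: "('v, 'e) pre_digraph \<Rightarrow> (nat \<Rightarrow> 'v set) \<Rightarrow> (nat \<Rightarrow> 'e) \<Rightarrow> nat" where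
  "start_level G D y =
     (THE k. (\<forall>i. tail G (y i) \<notin> (if k = 0 then {} else D (k - 1))) \<and>
             (\<exists>j. tail G (y j) \<in> D k))"

definition last_vertex_in :: "('v, 'e) pre_digraph \<Rightarrow> 'v set \<Rightarrow> (nat \<Rightarrow> 'e) \<Rightarrow> 'v" where
  "last_vertex_in G S y = tail G (y (GREATEST j. tail G (y j) \<in> S))"

text \<open>
  With \<open>k\<close> the start level of \<open>y\<close>, the path visits at level \<open>k + i\<close> the last vertex of \<open>y\<close>
  lying in \<open>D (k + i)\<close>; this sequence of vertices is turned into a sequence of arrows.
\<close>
definition bratteli_path ::
    "('v, 'e) pre_digraph \<Rightarrow> (nat \<Rightarrow> 'v set) \<Rightarrow> (nat \<Rightarrow> 'e) \<Rightarrow>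
     nat \<Rightarrow> (nat \<times> 'v) \<times> (nat \<times> 'v)" where
  "bratteli_path G D y =
     (let k = start_level G D y; x = (\<lambda>n. (n, last_vertex_in G (D n) y))
      in (\<lambda>i. (x (k + i), x (k + Suc i))))"

end

theory Submission
  imports Defs "HOL-Probability.Infinite_Product_Measure" "HOL-Library.Omega_Words_Fun"
begin

text \<open>
  Write \<open>g(v, w)\<close> for the sum of the weights \<open>exp (- \<beta> F(\<mu>))\<close> of all finite paths \<open>\<mu>\<close> from \<open>v\<close>
  to \<open>w\<close>, that is, for the entry of \<open>\<Sum>n. A(\<beta>)^n\<close>.  The hypothesis on \<open>v0\<close> makes \<open>g\<close> finite at
  all pairs of vertices.  A conformal measure \<open>m\<close> is determined by the harmonic function
  \<open>v \<mapsto> m(Z(v))\<close>, and every non-negative, non-zero harmonic function comes from a conformal measure, the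
  law of a Markov chain (\<open>ex_conformal_of_harmonic\<close>).  Since the expected number of visits to a
  vertex is finite, almost every path wanders (\<open>null_non_wandering\<close>), so it leaves each finite set
  \<open>D n\<close> for a last time.

  Let \<open>\<Omega>\<close> be the set of wandering paths which start at a vertex of some \<open>D n\<close> and never return to
  that \<open>D n\<close>.  The map \<open>\<pi>\<close> lists the last vertices in \<open>D n\<close>, \<open>D (n + 1)\<close>, \<dots>; between two of them the
  path is a link path, and all link paths are possible.  Hence adding an arrow in front of \<open>\<pi> y\<close>
  amounts to adding any one of the corresponding link paths in front of \<open>y\<close>
  (\<open>bratteli_path_preimage_conc\<close>), and since the potential of the Bratteli diagram records the total
  weight of these link paths, the image under \<open>\<pi>\<close> of the restriction of \<open>m\<close> to \<open>\<Omega>\<close> is again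
  conformal.  Multiplied by \<open>g(v0, v0)\<close> it is normalized.  This is the homeomorphism \<open>push\<close>.

  Let \<open>\<Omega>\<^bsub>D n\<^esub>(w)\<close> consist of the paths in \<open>\<Omega>\<close> that start at the vertex \<open>w\<close> of \<open>D n\<close> and never
  return to \<open>D n\<close>.  Cutting paths at the last visit to \<open>D n\<close> gives, for \<open>v\<close> in \<open>D n\<close>,
  \<open>m(Z(v)) = (\<Sum>w\<in>D n. g(v, w) m(\<Omega>\<^bsub>D n\<^esub>(w)))\<close> (\<open>emeasure_vertex\<close>), where \<open>g(v0, v0) m(\<Omega>\<^bsub>D n\<^esub>(w))\<close>
  is the mass that \<open>push m\<close> gives to the vertex \<open>w\<close> of level \<open>n\<close>.  So \<open>push\<close> is injective.  Given a
  conformal measure on the Bratteli diagram, the same sum defines a harmonic function on the graph;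
  cutting paths at the first return to \<open>D n\<close> recovers the numbers \<open>m(\<Omega>\<^bsub>D n\<^esub>(w))\<close> from the numbers
  \<open>m(Z(z))\<close> with \<open>z\<close> in \<open>D n\<close> (\<open>emeasure_first_return\<close>), which shows that the measure obtained is
  mapped to the given one (\<open>push_surj\<close>).  Both cuttings express masses of cylinders by finite linear
  combinations of masses of cylinders on the other side, whence continuity in both directions.

  An end enters only through three properties: it is a Borel set, it does not see finite initial
  segments of paths, and it is a union of fibres of \<open>\<pi>\<close> on the wandering paths, because wandering
  paths with the same image meet in common vertices again and again.  Therefore \<open>m\<close> is concentrated
  on an end exactly if \<open>push m\<close> is concentrated on its image (\<open>concentrated_iff\<close>).
\<close>
section \<open>The Borel sets of a path space\<close>

locale countable_digraph = wf_digraph G for G :: "('v, 'e) pre_digraph" +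
  assumes countable_verts: "countable (verts G)" and countable_arcs: "countable (arcs G)"

lemma countable_walk_set: "countable (arcs G) \<Longrightarrow> (\<And>\<mu>. \<mu> \<in> S \<Longrightarrow> set \<mu> \<subseteq> arcs G) \<Longrightarrow> countable S"
  by (rule countable_subset[of _ "lists (arcs G)"]) auto

text \<open>
  The empty set makes the family closed under intersections.
\<close>
definition cylinders :: "('v, 'e) pre_digraph \<Rightarrow> (nat \<Rightarrow> 'e) set set" where
  "cylinders G = insert {} {cyl G v \<mu> | v \<mu> w. pre_digraph.awalk G v \<mu> w}"

lemma cyl_subset: "cyl G v \<mu> \<subseteq> inf_paths G"
  by (auto simp: cyl_def)

lemma openin_path_topology_subset: "{U. openin (path_topology G) U} \<subseteq> Pow (inf_paths G)"
  by (auto simp: path_topology_def openin_subtopology)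

lemma space_path_borel [simp]: "space (path_borel G) = inf_paths G"
  unfolding path_borel_def by (rule space_measure_of[OF openin_path_topology_subset])

lemma sets_path_borel: "sets (path_borel G) = sigma_sets (inf_paths G) {U. openin (path_topology G) U}"
  unfolding path_borel_def by (rule sets_measure_of[OF openin_path_topology_subset])

lemma openin_path_coord: "openin (path_topology G) {p \<in> inf_paths G. p i \<in> A}"
proof -
  let ?X = "product_topology (\<lambda>_::nat. discrete_topology (arcs G)) UNIV"
  have "openin ?X {p \<in> topspace ?X. p i \<in> A \<inter> arcs G}"
    by (rule openin_continuous_map_preimage[OF continuous_map_product_projection]) auto
  moreover have "{p \<in> inf_paths G. p i \<in> A} = {p \<in> topspace ?X. p i \<in> A \<inter> arcs G} \<inter> inf_paths G"
    by (auto simp: inf_paths_def)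
  ultimately show ?thesis
    unfolding path_topology_def openin_subtopology by blast
qed

lemma measurable_path_coord [measurable]:
  fixes G :: "('v, 'e) pre_digraph"
  shows "(\<lambda>p. p i) \<in> path_borel G \<rightarrow>\<^sub>M count_space UNIV"
proof (rule measurableI)
  fix A :: "'e set"
  have "(\<lambda>p. p i) -` A \<inter> space (path_borel G) = {p \<in> inf_paths G. p i \<in> A}"
    by auto
  then show "(\<lambda>p. p i) -` A \<inter> space (path_borel G) \<in> sets (path_borel G)"
    using openin_path_coord[of G i A] by (simp add: sets_path_borel)
qed simp

lemma measurable_path_tail [measurable]:
  "(\<lambda>p. tail H (p i)) \<in> path_borel G \<rightarrow>\<^sub>M count_space UNIV"
  by (rule measurable_compose[OF measurable_path_coord]) simp

lemma cyl_in_sets [measurable]: "cyl G v \<mu> \<in> sets (path_borel G)"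
proof -
  have "cyl G v \<mu> = {p \<in> space (path_borel G). tail G (p 0) = v \<and> (\<forall>i<length \<mu>. p i = \<mu> ! i)}"
    by (simp add: cyl_def)
  also have "\<dots> \<in> sets (path_borel G)" by measurable
  finally show ?thesis .
qed

context wf_digraph
begin

lemma inf_path_arc: "p \<in> inf_paths G \<Longrightarrow> p i \<in> arcs G"
  and inf_path_head: "p \<in> inf_paths G \<Longrightarrow> head G (p i) = tail G (p (Suc i))"
  and inf_path_tail: "p \<in> inf_paths G \<Longrightarrow> tail G (p i) \<in> verts G"
  by (auto simp: inf_paths_def)

lemma inf_path_segment:
  assumes p: "p \<in> inf_paths G"
  shows "awalk (tail G (p i)) (map p [i..<i + n]) (tail G (p (i + n)))"
proof (induction n)
  case 0
  then show ?case using p by (simp add: awalk_Nil_iff inf_path_tail)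
next
  case (Suc n)
  have "awalk (tail G (p (i + n))) [p (i + n)] (tail G (p (i + Suc n)))"
    using p inf_path_head[OF p, of "i + n"] inf_path_arc[OF p, of "i + n"] inf_path_tail[OF p]
    by (auto simp: awalk_Cons_iff awalk_Nil_iff)
  from awalk_appendI[OF Suc this] show ?case by simp
qed

lemma inf_path_prefix:
  assumes "p \<in> inf_paths G"
  shows "awalk (tail G (p 0)) (prefix n p) (tail G (p n))"
  using inf_path_segment[OF assms, of 0 n] by (simp add: subsequence_def)

lemma suffix_inf_path: "p \<in> inf_paths G \<Longrightarrow> suffix n p \<in> inf_paths G"
  by (auto simp: inf_paths_def)

lemma conc_inf_path:
  assumes "awalk v \<mu> w" "y \<in> inf_paths G" "tail G (y 0) = w"
  shows "\<mu> \<frown> y \<in> inf_paths G \<and> tail G ((\<mu> \<frown> y) 0) = v"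
  using assms(1)
proof (induction \<mu> arbitrary: v)
  case Nil
  then show ?case using assms by (simp add: awalk_Nil_iff)
next
  case (Cons a \<mu>)
  then have a: "a \<in> arcs G" "v = tail G a" "awalk (head G a) \<mu> w"
    by (auto simp: awalk_Cons_iff)
  have *: "\<mu> \<frown> y \<in> inf_paths G" "tail G ((\<mu> \<frown> y) 0) = head G a"
    using Cons.IH[OF a(3)] by auto
  have eq: "((a # \<mu>) \<frown> y) i = (case i of 0 \<Rightarrow> a | Suc j \<Rightarrow> (\<mu> \<frown> y) j)" for i
    by (cases i) (auto simp: conc_def)
  show ?case
    unfolding inf_paths_def mem_Collect_eq eq
    using * a by (auto simp: inf_paths_def split: nat.split)
qed

lemma cyl_eq_conc:
  assumes "awalk v \<mu> w"
  shows "cyl G v \<mu> = (\<frown>) \<mu> ` cyl G w []"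
proof (intro set_eqI iffI)
  fix p assume p: "p \<in> cyl G v \<mu>"
  then have pp: "p \<in> inf_paths G" and v: "tail G (p 0) = v"
    and eq: "\<And>i. i < length \<mu> \<Longrightarrow> p i = \<mu> ! i"
    by (simp_all add: cyl_def)
  have pre: "prefix (length \<mu>) p = \<mu>"
    by (rule nth_equalityI) (simp_all add: eq)
  have "awalk v \<mu> (tail G (p (length \<mu>)))"
    using inf_path_prefix[OF pp, of "length \<mu>"] unfolding pre v .
  then have "tail G (p (length \<mu>)) = w"
    using awalk_ends[OF assms] by blast
  then have "suffix (length \<mu>) p \<in> cyl G w []"
    using suffix_inf_path[OF pp] by (simp add: cyl_def)
  moreover have "p = \<mu> \<frown> suffix (length \<mu>) p"
    by (rule ext) (simp add: conc_def eq)
  ultimately show "p \<in> (\<frown>) \<mu> ` cyl G w []" by (metis imageI)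
next
  fix p assume "p \<in> (\<frown>) \<mu> ` cyl G w []"
  then obtain y where "y \<in> inf_paths G" "tail G (y 0) = w" "p = \<mu> \<frown> y"
    unfolding cyl_def by blast
  then show "p \<in> cyl G v \<mu>"
    using conc_inf_path[OF assms] by (simp add: cyl_def)
qed

lemma cyl_conc_cyl:
  assumes "awalk v \<mu> w" "awalk w \<nu> u"
  shows "cyl G v (\<mu> @ \<nu>) = (\<frown>) \<mu> ` cyl G w \<nu>"
  unfolding cyl_eq_conc[OF awalk_appendI[OF assms]] cyl_eq_conc[OF assms(2)] image_image conc_conc ..

lemma cyl_Int:
  assumes "length \<mu> \<le> length \<nu>"
  shows "cyl G v \<mu> \<inter> cyl G w \<nu> \<in> {{}, cyl G w \<nu>}"
proof (cases "v = w \<and> (\<forall>i<length \<mu>. \<mu> ! i = \<nu> ! i)")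
  case True
  then have "cyl G w \<nu> \<subseteq> cyl G v \<mu>" using assms by (auto simp: cyl_def)
  then show ?thesis by auto
next
  case False
  then have "cyl G v \<mu> \<inter> cyl G w \<nu> = {}" using assms by (force simp: cyl_def)
  then show ?thesis by simp
qed

lemma Int_stable_cylinders: "Int_stable (cylinders G)"
proof (rule Int_stableI)
  fix A B assume AB: "A \<in> cylinders G" "B \<in> cylinders G"
  have *: "cyl G v \<mu> \<inter> cyl G v' \<mu>' \<in> cylinders G"
    if "awalk v \<mu> w" "awalk v' \<mu>' w'" for v \<mu> w v' \<mu>' w'
  proof (cases "length \<mu> \<le> length \<mu>'")
    case True
    from cyl_Int[OF True, of v v'] that show ?thesis unfolding cylinders_def by auto
  next
    case False
    then have "cyl G v' \<mu>' \<inter> cyl G v \<mu> \<in> {{}, cyl G v \<mu>}" by (intro cyl_Int) simp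
    with that show ?thesis unfolding cylinders_def Int_commute[of "cyl G v \<mu>"] by auto
  qed
  consider "A = {} \<or> B = {}"
    | v \<mu> w v' \<mu>' w' where "A = cyl G v \<mu>" "awalk v \<mu> w" "B = cyl G v' \<mu>'" "awalk v' \<mu>' w'"
    using AB unfolding cylinders_def by blast
  then show "A \<inter> B \<in> cylinders G"
  proof cases
    case 1
    then show ?thesis by (auto simp: cylinders_def)
  qed (simp add: *)
qed

end

lemma cylinders_subset: "cylinders G \<subseteq> Pow (inf_paths G)"
  by (auto simp: cylinders_def cyl_def)

context countable_digraph
begin

lemma countable_cylinders: "countable (cylinders G)"
proof -
  have "cylinders G \<subseteq> insert {} ((\<lambda>(v, \<mu>). cyl G v \<mu>) ` (verts G \<times> lists (arcs G)))"
    by (auto simp: cylinders_def awalk_def image_iff lists_eq_set intro!: bexI)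
  then show ?thesis
    by (rule countable_subset)
      (intro countable_insert countable_image countable_SIGMA countable_verts countable_lists countable_arcs)
qed

text \<open>
  A basic open set of the product topology restricts only finitely many coordinates, so around each
  of its paths it contains the cylinder of a long enough prefix.
\<close>
lemma open_Union_cylinders:
  assumes U: "openin (path_topology G) U"
  shows "U = \<Union>{C \<in> cylinders G. C \<subseteq> U}"
proof (intro set_eqI iffI)
  fix p assume p: "p \<in> U"
  let ?X = "product_topology (\<lambda>_::nat. discrete_topology (arcs G)) UNIV"
  obtain T where T: "openin ?X T" "U = T \<inter> inf_paths G"
    using U unfolding path_topology_def openin_subtopology by auto
  have pp: "p \<in> inf_paths G" and "p \<in> T" using p T by auto
  then obtain W where W: "finite {i. W i \<noteq> arcs G}" "p \<in> Pi\<^sub>E UNIV W" "Pi\<^sub>E UNIV W \<subseteq> T"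
    using T(1) unfolding openin_product_topology_alt by auto
  obtain n where n: "\<And>i. i \<ge> n \<Longrightarrow> W i = arcs G"
  proof -
    have "\<exists>n. \<forall>i\<in>{i. W i \<noteq> arcs G}. i < n"
      using finite_nat_set_iff_bounded W(1) by blast
    then show ?thesis using that by (metis (mono_tags, lifting) mem_Collect_eq not_less)
  qed
  let ?C = "cyl G (tail G (p 0)) (prefix n p)"
  have "q i \<in> W i" if "q \<in> ?C" for q i
  proof (cases "i < n")
    case True
    then have "q i = p i" using that by (auto simp: cyl_def)
    then show ?thesis using W(2) by auto
  next
    case False
    then show ?thesis using n that by (auto simp: cyl_def inf_paths_def)
  qed
  then have "?C \<subseteq> U" using W(3) T(2) by (auto simp: cyl_def PiE_UNIV_domain)
  moreover have "?C \<in> cylinders G" using inf_path_prefix[OF pp] by (auto simp: cylinders_def)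
  moreover have "p \<in> ?C" using pp by (auto simp: cyl_def)
  ultimately show "p \<in> \<Union>{C \<in> cylinders G. C \<subseteq> U}" by auto
qed auto

text \<open>
  There are only countably many cylinders, so the union in \<open>open_Union_cylinders\<close> is countable.
\<close>
lemma sets_path_borel_cylinders: "sets (path_borel G) = sigma_sets (inf_paths G) (cylinders G)"
proof (rule antisym)
  have "U \<in> sigma_sets (inf_paths G) (cylinders G)" if "openin (path_topology G) U" for U
  proof -
    have "\<Union>{C \<in> cylinders G. C \<subseteq> U} \<in> sigma_sets (inf_paths G) (cylinders G)"
      by (rule sigma_sets_UNION)
        (auto intro!: sigma_sets.Basic countable_subset[OF _ countable_cylinders])
    then show ?thesis using open_Union_cylinders[OF that] by simp
  qed
  then show "sets (path_borel G) \<subseteq> sigma_sets (inf_paths G) (cylinders G)"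
    unfolding sets_path_borel by (intro sigma_sets_mono) auto
next
  have "cylinders G \<subseteq> sets (path_borel G)"
    by (auto simp: cylinders_def)
  then show "sigma_sets (inf_paths G) (cylinders G) \<subseteq> sets (path_borel G)"
    using sets.sigma_sets_subset[of "cylinders G" "path_borel G"] by simp
qed

lemma measurable_path_borelI:
  assumes "\<And>x. x \<in> space M \<Longrightarrow> f x \<in> inf_paths G"
    and [measurable]: "\<And>i. (\<lambda>x. f x i) \<in> M \<rightarrow>\<^sub>M count_space UNIV"
  shows "f \<in> M \<rightarrow>\<^sub>M path_borel G"
proof (rule measurable_sigma_sets[OF sets_path_borel_cylinders cylinders_subset])
  fix C assume "C \<in> cylinders G"
  moreover have "f -` cyl G v \<mu> \<inter> space M \<in> sets M" for v \<mu>
  proof -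
    have [measurable]: "(\<lambda>x. tail G (f x 0)) \<in> M \<rightarrow>\<^sub>M count_space UNIV"
      by (rule measurable_compose[OF assms(2)]) simp
    have "f -` cyl G v \<mu> \<inter> space M =
        {x \<in> space M. tail G (f x 0) = v \<and> (\<forall>i<length \<mu>. f x i = \<mu> ! i)}"
      using assms(1) by (auto simp: cyl_def)
    also have "\<dots> \<in> sets M" by measurable
    finally show ?thesis .
  qed
  ultimately show "f -` C \<inter> space M \<in> sets M" by (auto simp: cylinders_def)
qed (use assms in auto)

lemma measurable_suffix_path: "suffix n \<in> path_borel G \<rightarrow>\<^sub>M path_borel G"
  by (rule measurable_path_borelI) (simp_all add: suffix_inf_path)

lemma conc_image_eq:
  assumes "awalk v \<mu> w" "B \<subseteq> cyl G w []"
  shows "(\<frown>) \<mu> ` B = suffix (length \<mu>) -` B \<inter> cyl G v \<mu>"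
proof -
  have "suffix (length \<mu>) (\<mu> \<frown> y) = y" for y by (simp add: fun_eq_iff)
  then show ?thesis using cyl_eq_conc[OF assms(1)] assms(2) by auto
qed

lemma conc_image_sets:
  assumes "awalk v \<mu> w" "B \<in> sets (path_borel G)" "B \<subseteq> cyl G w []"
  shows "(\<frown>) \<mu> ` B \<in> sets (path_borel G)"
proof -
  have "(\<frown>) \<mu> ` B = (suffix (length \<mu>) -` B \<inter> space (path_borel G)) \<inter> cyl G v \<mu>"
    using conc_image_eq[OF assms(1,3)] by (auto simp: cyl_def)
  also have "\<dots> \<in> sets (path_borel G)"
    using measurable_sets[OF measurable_suffix_path assms(2)] by auto
  finally show ?thesis .
qed

end

section \<open>Conformal measures and weights of finite paths\<close>

definition walk_weight :: "('e \<Rightarrow> real) \<Rightarrow> 'e list \<Rightarrow> ennreal" where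
  "walk_weight \<phi> \<mu> = ennreal (exp (- sum_list (map \<phi> \<mu>)))"

text \<open>
  Summing by means of a measure on the set of all lists gives countable additivity at once.
\<close>
definition weight :: "('e \<Rightarrow> real) \<Rightarrow> 'e list set \<Rightarrow> ennreal" where
  "weight \<phi> S = emeasure (density (count_space UNIV) (walk_weight \<phi>)) S"

lemma walk_weight_append: "walk_weight \<phi> (\<mu> @ \<nu>) = walk_weight \<phi> \<mu> * walk_weight \<phi> \<nu>"
  by (simp add: walk_weight_def ennreal_mult[symmetric] exp_add[symmetric])

lemma walk_weight_Nil [simp]: "walk_weight \<phi> [] = 1"
  and walk_weight_pos: "0 < walk_weight \<phi> \<mu>"
  and walk_weight_finite: "walk_weight \<phi> \<mu> < top"
  by (simp_all add: walk_weight_def)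

lemma weight_eq: "weight \<phi> S = (\<integral>\<^sup>+\<mu>. walk_weight \<phi> \<mu> \<partial>count_space S)"
proof -
  have "weight \<phi> S = (\<integral>\<^sup>+\<mu>. walk_weight \<phi> \<mu> * indicator S \<mu> \<partial>count_space UNIV)"
    unfolding weight_def by (rule emeasure_density) auto
  also have "\<dots> = (\<integral>\<^sup>+\<mu>. walk_weight \<phi> \<mu> \<partial>restrict_space (count_space UNIV) S)"
    by (rule nn_integral_restrict_space[symmetric]) simp
  finally show ?thesis by (simp add: restrict_count_space)
qed

lemma weight_mono: "S \<subseteq> T \<Longrightarrow> weight \<phi> S \<le> weight \<phi> T"
  unfolding weight_def by (rule emeasure_mono) auto

lemma weight_empty [simp]: "weight \<phi> {} = 0"
  by (simp add: weight_def)

lemma weight_singleton [simp]: "weight \<phi> {\<mu>} = walk_weight \<phi> \<mu>"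
  by (simp add: weight_eq nn_integral_count_space_finite)

lemma weight_ge: "\<mu> \<in> S \<Longrightarrow> walk_weight \<phi> \<mu> \<le> weight \<phi> S"
  using weight_mono[of "{\<mu>}" S \<phi>] by simp

lemma weight_Un: "A \<inter> B = {} \<Longrightarrow> weight \<phi> (A \<union> B) = weight \<phi> A + weight \<phi> B"
  unfolding weight_def by (rule plus_emeasure[symmetric]) auto

lemma weight_UN:
  assumes "countable I" "disjoint_family_on X I"
  shows "weight \<phi> (\<Union>i\<in>I. X i) = (\<integral>\<^sup>+i. weight \<phi> (X i) \<partial>count_space I)"
  unfolding weight_def using assms by (intro emeasure_UN_countable) auto

lemma weight_UN_finite:
  assumes "finite I" "disjoint_family_on X I"
  shows "weight \<phi> (\<Union>i\<in>I. X i) = (\<Sum>i\<in>I. weight \<phi> (X i))"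
  using weight_UN[OF countable_finite[OF assms(1)] assms(2)] assms(1)
  by (simp add: nn_integral_count_space_finite)

lemma weight_append_image: "weight \<phi> ((@) \<mu> ` B) = walk_weight \<phi> \<mu> * weight \<phi> B"
proof -
  have "bij_betw ((@) \<mu>) B ((@) \<mu> ` B)" by (auto simp: bij_betw_def inj_on_def)
  from nn_integral_bij_count_space[OF this, of "walk_weight \<phi>"]
  show ?thesis by (simp add: weight_eq walk_weight_append nn_integral_cmult)
qed

lemma weight_concat:
  assumes "countable A" "disjoint_family_on (\<lambda>\<mu>. (@) \<mu> ` B) A"
  shows "weight \<phi> (\<Union>\<mu>\<in>A. (@) \<mu> ` B) = weight \<phi> A * weight \<phi> B"
  unfolding weight_UN[OF assms] weight_append_image
  by (simp add: weight_eq[of _ A] nn_integral_multc)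

context countable_digraph
begin

text \<open>
  For a single arrow this is conformality read from right to left; longer paths are treated arrow
  by arrow.
\<close>
lemma emeasure_conc_image:
  assumes m: "conformal G \<phi> m" and "awalk v \<mu> w" "B \<in> sets m" "B \<subseteq> cyl G w []"
  shows "emeasure m ((\<frown>) \<mu> ` B) = walk_weight \<phi> \<mu> * emeasure m B"
  using assms(2)
proof (induction \<mu> arbitrary: v)
  case Nil
  then show ?case by (simp add: image_def)
next
  case (Cons a \<mu>)
  have sets: "sets m = sets (path_borel G)" using m by (simp add: conformal_def)
  have a: "a \<in> arcs G" "v = tail G a" "awalk (head G a) \<mu> w"
    using Cons.prems by (auto simp: awalk_Cons_iff)
  let ?B = "(\<frown>) \<mu> ` B"
  have B: "?B \<in> sets m" "?B \<subseteq> cyl G (head G a) []"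
    using conc_image_sets[OF a(3)] assms(3,4) sets cyl_eq_conc[OF a(3)] conc_inf_path[OF a(3)]
    by (auto simp: cyl_def)
  have aw: "awalk v [a] (head G a)" using a by (simp add: arc_implies_awalk)
  have eq: "(\<frown>) (a # \<mu>) ` B = (\<frown>) [a] ` ?B"
    by (simp add: image_image)
  have C: "(\<frown>) [a] ` ?B \<in> sets m" "(\<frown>) [a] ` ?B \<subseteq> cyl G (tail G a) [a]"
    using conc_image_sets[OF aw] B sets cyl_eq_conc[OF aw] a by auto
  have "shift ([a] \<frown> y) = y" for y by (simp add: shift_def fun_eq_iff)
  then have "shift ` ((\<frown>) [a] ` ?B \<inter> cyl G (tail G a) [a]) = ?B"
    using C(2) by (simp add: Int_absorb2 image_image)
  moreover have "emeasure m (shift ` ((\<frown>) [a] ` ?B \<inter> cyl G (tail G a) [a])) =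
      ennreal (exp (\<phi> a)) * emeasure m ((\<frown>) [a] ` ?B \<inter> cyl G (tail G a) [a])"
    using m a(1) C(1) unfolding conformal_def by blast
  ultimately have "emeasure m ?B = ennreal (exp (\<phi> a)) * emeasure m ((\<frown>) [a] ` ?B)"
    using Int_absorb2[OF C(2)] by simp
  then have "ennreal (exp (- \<phi> a)) * emeasure m ?B = emeasure m ((\<frown>) [a] ` ?B)"
    by (simp add: mult.assoc[symmetric] ennreal_mult[symmetric] exp_minus)
  then show ?case
    using Cons.IH[OF a(3)] walk_weight_append[of \<phi> "[a]" \<mu>] unfolding eq
    by (simp add: walk_weight_def mult.assoc)
qed

lemma emeasure_cyl:
  assumes m: "conformal G \<phi> m" and "awalk v \<mu> w"
  shows "emeasure m (cyl G v \<mu>) = walk_weight \<phi> \<mu> * emeasure m (cyl G w [])"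
proof -
  have "cyl G w [] \<in> sets m" using m by (simp add: conformal_def)
  from emeasure_conc_image[OF assms this] show ?thesis
    using cyl_eq_conc[OF assms(2)] by simp
qed

lemma conc_UN_sets:
  assumes "\<And>\<mu>. \<mu> \<in> S \<Longrightarrow> awalk v \<mu> w" "B \<in> sets (path_borel G)" "B \<subseteq> cyl G w []"
  shows "(\<Union>\<mu>\<in>S. (\<frown>) \<mu> ` B) \<in> sets (path_borel G)"
proof (rule sets.countable_UN')
  show "countable S" by (rule countable_walk_set[OF countable_arcs]) (use assms in \<open>auto simp: awalk_def\<close>)
qed (use conc_image_sets assms in blast)

lemma emeasure_conc_UN:
  assumes m: "conformal G \<phi> m" and S: "\<And>\<mu>. \<mu> \<in> S \<Longrightarrow> awalk v \<mu> w"
    and B: "B \<in> sets m" "B \<subseteq> cyl G w []"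
    and disj: "disjoint_family_on (\<lambda>\<mu>. (\<frown>) \<mu> ` B) S"
  shows "emeasure m (\<Union>\<mu>\<in>S. (\<frown>) \<mu> ` B) = weight \<phi> S * emeasure m B"
proof -
  have sets: "sets m = sets (path_borel G)" using m by (simp add: conformal_def)
  have "countable S" by (rule countable_walk_set[OF countable_arcs]) (use S in \<open>auto simp: awalk_def\<close>)
  then have "emeasure m (\<Union>\<mu>\<in>S. (\<frown>) \<mu> ` B) = (\<integral>\<^sup>+\<mu>. emeasure m ((\<frown>) \<mu> ` B) \<partial>count_space S)"
    using disj B S conc_image_sets[where v = v and w = w]
    by (intro emeasure_UN_countable) (simp_all add: sets)
  also have "\<dots> = (\<integral>\<^sup>+\<mu>. walk_weight \<phi> \<mu> * emeasure m B \<partial>count_space S)"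
    using emeasure_conc_image[OF m S B] by (intro nn_integral_cong) simp
  finally show ?thesis by (simp add: weight_eq nn_integral_multc)
qed

text \<open>
  Conformality determines the masses of all cylinders from those of the vertex cylinders, and the
  cylinders are a generator that is closed under intersections.
\<close>
lemma conformal_eqI:
  assumes m: "conformal G \<phi> m" "conformal G \<phi> n"
    and eq: "\<And>v. v \<in> verts G \<Longrightarrow> emeasure m (cyl G v []) = emeasure n (cyl G v [])"
  shows "m = n"
proof (rule measure_eqI_generator_eq_countable[OF Int_stable_cylinders cylinders_subset])
  have cyls: "emeasure m (cyl G v \<mu>) = emeasure n (cyl G v \<mu>)" if "awalk v \<mu> w" for v \<mu> w
    using emeasure_cyl[OF m(1) that] emeasure_cyl[OF m(2) that] eq[OF awalk_last_in_verts[OF that]] by simp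
  then show "emeasure m X = emeasure n X" if "X \<in> cylinders G" for X
    using that by (auto simp: cylinders_def)
  show "(\<lambda>v. cyl G v []) ` verts G \<subseteq> cylinders G"
    by (force simp: cylinders_def awalk_Nil_iff)
  show "\<Union>((\<lambda>v. cyl G v []) ` verts G) = inf_paths G"
    by (auto simp: cyl_def inf_path_tail)
  show "countable ((\<lambda>v. cyl G v []) ` verts G)" using countable_verts by auto
qed (use m sets_path_borel_cylinders in \<open>auto simp: conformal_def\<close>)

lemma conformal_harmonic:
  assumes m: "conformal G \<phi> m" and fin: "finite (out_arcs G v)"
  shows "emeasure m (cyl G v []) =
    (\<Sum>a\<in>out_arcs G v. walk_weight \<phi> [a] * emeasure m (cyl G (head G a) []))"
proof -
  have eq: "cyl G v [] = (\<Union>a\<in>out_arcs G v. cyl G v [a])"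
    by (auto simp: cyl_def inf_path_arc)
  have "emeasure m (cyl G v []) = (\<Sum>a\<in>out_arcs G v. emeasure m (cyl G v [a]))"
    unfolding eq
  proof (rule sum_emeasure[symmetric])
    show "(\<lambda>a. cyl G v [a]) ` out_arcs G v \<subseteq> sets m"
      using m by (auto simp: conformal_def)
    show "disjoint_family_on (\<lambda>a. cyl G v [a]) (out_arcs G v)"
      by (auto simp: disjoint_family_on_def cyl_def)
  qed (rule fin)
  also have "\<dots> = (\<Sum>a\<in>out_arcs G v. walk_weight \<phi> [a] * emeasure m (cyl G (head G a) []))"
    by (intro sum.cong refl emeasure_cyl[OF m]) (auto simp: awalk_Cons_iff awalk_Nil_iff)
  finally show ?thesis .
qed

end

lemma (in wf_digraph) awalk_nth_consecutive:
  assumes "awalk v \<mu> w" "Suc i < length \<mu>"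
  shows "head G (\<mu> ! i) = tail G (\<mu> ! Suc i)"
  using assms
proof (induction \<mu> arbitrary: v i)
  case (Cons a \<mu>)
  then have a: "awalk (head G a) \<mu> w" by (simp add: awalk_Cons_iff)
  show ?case
  proof (cases i)
    case 0
    then show ?thesis using a Cons.prems by (cases \<mu>) (auto simp: awalk_Cons_iff)
  next
    case (Suc j)
    then show ?thesis using Cons.IH[OF a] Cons.prems by simp
  qed
qed simp

lemma space_PiM_Collect_eq_prod_emb:
  "{x \<in> space (Pi\<^sub>M I M). \<forall>k\<in>J. x k \<in> X k} = prod_emb I M J (Pi\<^sub>E J X)"
  by (auto simp: prod_emb_def space_PiM restrict_PiE_iff)

section \<open>The conformal measure of a harmonic function\<close>

context countable_digraph
begin

text \<open>
  For a fixed arrow, both sides of the conformality equation are measures in the Borel set of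
  continuations of that arrow, so it is enough to compare them on cylinders.
\<close>
lemma conformalI_cylinders:
  assumes sets: "sets m = sets (path_borel G)" and nonzero: "emeasure m (inf_paths G) \<noteq> 0"
    and fin: "\<And>v. v \<in> verts G \<Longrightarrow> emeasure m (cyl G v []) < \<infinity>"
    and step: "\<And>a \<mu> w. a \<in> arcs G \<Longrightarrow> awalk (head G a) \<mu> w \<Longrightarrow>
      emeasure m (cyl G (tail G a) (a # \<mu>)) = walk_weight \<phi> [a] * emeasure m (cyl G (head G a) \<mu>)"
  shows "conformal G \<phi> m"
proof -
  have "emeasure m (shift ` (B \<inter> cyl G (tail G a) [a])) =
      ennreal (exp (\<phi> a)) * emeasure m (B \<inter> cyl G (tail G a) [a])"
    if a: "a \<in> arcs G" and B: "B \<in> sets m" for a B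
  proof -
    let ?Z = "cyl G (tail G a) [a]"
    have aw: "awalk (tail G a) [a] (head G a)" using a by (rule arc_implies_awalk)
    \<comment> \<open>On a Borel set of paths from the head of the arrow, the first measure is the weight of the
      arrow times \<open>m\<close>, the second is the \<open>m\<close>-mass after the arrow has been put in front.\<close>
    define N1 where "N1 = density m (\<lambda>x. walk_weight \<phi> [a] * indicator (cyl G (head G a) []) x)"
    define N2 where "N2 = distr (density m (indicator ?Z)) (path_borel G) (suffix 1)"
    have cs: "cyl G v \<mu> \<in> sets m" for v \<mu> by (simp add: sets)
    have N1: "emeasure N1 X = walk_weight \<phi> [a] * emeasure m (cyl G (head G a) [] \<inter> X)"
      if "X \<in> sets m" for X
    proof -
      have "emeasure N1 X =
          (\<integral>\<^sup>+x. walk_weight \<phi> [a] * indicator (cyl G (head G a) [] \<inter> X) x \<partial>m)"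
        unfolding N1_def using that cs
        by (subst emeasure_density) (auto intro!: nn_integral_cong simp: indicator_inter_arith mult.assoc)
      also have "\<dots> = walk_weight \<phi> [a] * emeasure m (cyl G (head G a) [] \<inter> X)"
        using that cs by (subst nn_integral_cmult_indicator) auto
      finally show ?thesis .
    qed
    have meas: "suffix 1 \<in> m \<rightarrow>\<^sub>M path_borel G"
      using measurable_suffix_path measurable_cong_sets[OF sets refl] by blast
    have space: "space m = inf_paths G"
      using sets_eq_imp_space_eq[OF sets] by simp
    have N2: "emeasure N2 X = emeasure m (suffix 1 -` X \<inter> ?Z)" if X: "X \<in> sets m" for X
    proof -
      have pre: "suffix 1 -` X \<inter> space m \<in> sets m"
        using measurable_sets[OF meas] X sets by simp
      moreover have "?Z \<inter> (suffix 1 -` X \<inter> space m) = suffix 1 -` X \<inter> ?Z"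
        using space cyl_subset[of G] by auto
      ultimately have Y: "suffix 1 -` X \<inter> ?Z \<in> sets m"
        using cs sets.Int[of ?Z m] by metis
      have "emeasure N2 X = (\<integral>\<^sup>+x. indicator ?Z x * indicator (suffix 1 -` X \<inter> space m) x \<partial>m)"
        unfolding N2_def using X cs meas sets emeasure_density[OF _ pre, of "indicator ?Z"]
        by (subst emeasure_distr) auto
      also have "\<dots> = (\<integral>\<^sup>+x. indicator (suffix 1 -` X \<inter> ?Z) x \<partial>m)"
        by (intro nn_integral_cong) (auto split: split_indicator)
      finally show ?thesis using Y by simp
    qed
    have "N1 = N2"
    proof (rule measure_eqI_generator_eq_countable[OF Int_stable_cylinders cylinders_subset])
      fix X assume "X \<in> cylinders G"
      then consider "X = {}" | u \<nu> t where "X = cyl G u \<nu>" "awalk u \<nu> t"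
        unfolding cylinders_def by blast
      then show "emeasure N1 X = emeasure N2 X"
      proof cases
        case (2 u \<nu> t)
        then have X: "X \<in> sets m" by (simp add: cs)
        show ?thesis
        proof (cases "u = head G a")
          case True
          then have sub: "X \<subseteq> cyl G (head G a) []" using 2 by (auto simp: cyl_def)
          then have "suffix 1 -` X \<inter> ?Z = (\<frown>) [a] ` X"
            using conc_image_eq[OF aw sub] by simp
          also have "\<dots> = cyl G (tail G a) (a # \<nu>)"
            using cyl_conc_cyl[OF aw, of \<nu> t] 2 True by simp
          finally have "suffix 1 -` X \<inter> ?Z = cyl G (tail G a) (a # \<nu>)" .
          moreover have "cyl G (head G a) [] \<inter> X = X" using sub by auto
          ultimately show ?thesis
            unfolding N1[OF X] N2[OF X] using step[OF a, of \<nu> t] 2 True by simp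
        next
          case False
          then have "cyl G (head G a) [] \<inter> X = {}" using 2 by (auto simp: cyl_def)
          moreover have "suffix 1 -` X \<inter> ?Z = {}"
            using False 2 by (auto simp: cyl_def inf_path_head[symmetric])
          ultimately show ?thesis unfolding N1[OF X] N2[OF X] by simp
        qed
      qed simp
    next
      show "(\<lambda>v. cyl G v []) ` verts G \<subseteq> cylinders G"
        by (force simp: cylinders_def awalk_Nil_iff)
      show "\<Union>((\<lambda>v. cyl G v []) ` verts G) = inf_paths G"
        by (auto simp: cyl_def inf_path_tail)
      show "countable ((\<lambda>v. cyl G v []) ` verts G)" using countable_verts by auto
      fix X assume "X \<in> (\<lambda>v. cyl G v []) ` verts G"
      then obtain v where v: "v \<in> verts G" "X = cyl G v []" by auto
      have "emeasure m (cyl G (head G a) [] \<inter> X) \<le> emeasure m X"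
        using v cs by (intro emeasure_mono) auto
      also have "\<dots> < \<infinity>" using fin v by simp
      finally have "emeasure N1 X < \<infinity>"
        using v cs walk_weight_finite[of \<phi> "[a]"] by (simp add: N1 ennreal_mult_less_top)
      then show "emeasure N1 X \<noteq> \<infinity>" by simp
    qed (simp_all add: N1_def N2_def sets sets_path_borel_cylinders)
    let ?C = "shift ` (B \<inter> ?Z)"
    have sh: "shift p = suffix 1 p" for p :: "nat \<Rightarrow> 'e" by (simp add: shift_def fun_eq_iff)
    have pa: "p = [a] \<frown> suffix 1 p" if "p \<in> ?Z" for p
      using that by (auto simp: cyl_def conc_def fun_eq_iff)
    have img: "B \<inter> ?Z = (\<frown>) [a] ` ?C" unfolding sh image_image using pa by force
    have sub: "?C \<subseteq> cyl G (head G a) []"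
      by (auto simp: sh cyl_def suffix_inf_path inf_path_head[symmetric])
    have spR: "space (restrict_space m (cyl G (head G a) [])) = cyl G (head G a) []"
      unfolding space_restrict_space space using cyl_subset[of G] by blast
    have eqC: "?C = (\<lambda>y. [a] \<frown> y) -` (B \<inter> ?Z) \<inter> space (restrict_space m (cyl G (head G a) []))"
    proof (intro set_eqI iffI)
      fix y assume y: "y \<in> ?C"
      then obtain z where z: "z \<in> B \<inter> ?Z" "y = shift z" by (rule imageE)
      then have "[a] \<frown> y = z" using pa[of z] by (simp add: sh)
      then show "y \<in> (\<lambda>y. [a] \<frown> y) -` (B \<inter> ?Z) \<inter> space (restrict_space m (cyl G (head G a) []))"
        using z(1) subsetD[OF sub y] unfolding spR by simp
    next
      fix y assume "y \<in> (\<lambda>y. [a] \<frown> y) -` (B \<inter> ?Z) \<inter> space (restrict_space m (cyl G (head G a) []))"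
      then have "[a] \<frown> y \<in> B \<inter> ?Z" by (simp only: vimage_def mem_Collect_eq Int_iff)
      moreover have "y = shift ([a] \<frown> y)" by (simp add: shift_def fun_eq_iff)
      ultimately show "y \<in> ?C" by (rule rev_image_eqI[where f = shift])
    qed
    have "(\<lambda>y. [a] \<frown> y) \<in> restrict_space m (cyl G (head G a) []) \<rightarrow>\<^sub>M path_borel G"
    proof (rule measurable_path_borelI)
      fix y assume "y \<in> space (restrict_space m (cyl G (head G a) []))"
      then show "[a] \<frown> y \<in> inf_paths G"
        using conc_inf_path[OF aw] by (auto simp: space_restrict_space cyl_def)
    next
      fix i
      have *: "(\<lambda>y. y j) \<in> m \<rightarrow>\<^sub>M count_space UNIV" for j
        using measurable_path_coord[of j G] measurable_cong_sets[OF sets refl] by blast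
      show "(\<lambda>y. ([a] \<frown> y) i) \<in> restrict_space m (cyl G (head G a) []) \<rightarrow>\<^sub>M count_space UNIV"
        unfolding conc_def by (cases "i < length [a]") (simp_all add: * measurable_restrict_space1)
    qed
    moreover have "B \<inter> ?Z \<in> sets (path_borel G)" using B cs sets by auto
    ultimately have "?C \<in> sets (restrict_space m (cyl G (head G a) []))"
      unfolding eqC by (rule measurable_sets)
    then have C: "?C \<in> sets m"
      using cs by (subst (asm) sets_restrict_space_iff) auto
    have "cyl G (head G a) [] \<inter> ?C = ?C" using sub by blast
    moreover have "suffix 1 -` ?C \<inter> ?Z = B \<inter> ?Z"
      using conc_image_eq[OF aw sub] img by simp
    ultimately have "walk_weight \<phi> [a] * emeasure m ?C = emeasure m (B \<inter> ?Z)"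
      using N1[OF C] N2[OF C] \<open>N1 = N2\<close> by simp
    moreover have "ennreal (exp (\<phi> a)) * walk_weight \<phi> [a] = 1"
      by (simp add: walk_weight_def ennreal_mult[symmetric] exp_minus)
    ultimately show ?thesis
      by (metis mult.assoc mult_1)
  qed
  then show ?thesis using assms by (simp add: conformal_def)
qed

text \<open>
  The measure is the law of a Markov chain which has initial masses \<open>\<psi>\<close> and goes along the arrow \<open>a\<close>
  with probability \<open>exp (- \<phi> a) * \<psi> (head a) / \<psi> (tail a)\<close>.  It is constructed from independent
  choices: for each time \<open>i\<close> and each vertex \<open>v\<close> with \<open>\<psi> v \<noteq> 0\<close> an arrow \<open>\<xi> (i, v)\<close> is drawn, to be used
  if the path is in \<open>v\<close> at time \<open>i\<close>.  A path consults each pair \<open>(i, v)\<close> at most once, so the event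
  that it begins with a given finite path is a finite box of the product space, and the product of
  the probabilities telescopes.
\<close>
lemma ex_conformal_of_harmonic:
  assumes fin_out: "\<And>v. v \<in> verts G \<Longrightarrow> finite (out_arcs G v)"
    and fin: "\<And>v. v \<in> verts G \<Longrightarrow> \<psi> v < (\<infinity>::ennreal)"
    and harm: "\<And>v. v \<in> verts G \<Longrightarrow> \<psi> v = (\<Sum>a\<in>out_arcs G v. walk_weight \<phi> [a] * \<psi> (head G a))"
    and v0: "v0 \<in> verts G" "\<psi> v0 \<noteq> 0"
  shows "\<exists>m. conformal G \<phi> m \<and> (\<forall>v\<in>verts G. emeasure m (cyl G v []) = \<psi> v)"
proof -
  define V where "V = {v \<in> verts G. \<psi> v \<noteq> 0}"
  \<comment> \<open>Only arrows towards vertices with \<open>\<psi> \<noteq> 0\<close> are offered.  Then every single draw, not just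
    almost every one, yields an infinite path, and vertices without outgoing arrows are never met.\<close>
  define A where "A = (\<lambda>v. {a \<in> out_arcs G v. \<psi> (head G a) \<noteq> 0})"
  define p where "p = (\<lambda>a. walk_weight \<phi> [a] * \<psi> (head G a) / \<psi> (tail G a))"
  define K where "K = (\<lambda>(i::nat, v). point_measure (A v) p)"
  define I where "I = (UNIV :: nat set) \<times> V"
  define P where "P = Pi\<^sub>M I K"
  \<comment> \<open>\<open>vx v \<xi> i\<close> is the vertex reached at time \<open>i\<close> from \<open>v\<close> by following the choices \<open>\<xi>\<close>, and \<open>T\<close>
    lists the arrows used.\<close>
  define vx where "vx = (\<lambda>v (\<xi> :: nat \<times> 'v \<Rightarrow> 'e). rec_nat v (\<lambda>i u. head G (\<xi> (i, u))))"
  define T where "T = (\<lambda>(v, \<xi> :: nat \<times> 'v \<Rightarrow> 'e) i. \<xi> (i, vx v \<xi> i))"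
  define Q where "Q = point_measure V \<psi> \<Otimes>\<^sub>M P"
  define m where "m = distr Q (path_borel G) T"
  have finA: "finite (A v)" if "v \<in> V" for v
    using that fin_out by (intro finite_subset[of "A v" "out_arcs G v"]) (auto simp: A_def V_def)
  have prob: "prob_space (K k)" if kI: "k \<in> I" for k
  proof
    obtain i v where k: "k = (i, v)" "v \<in> V" using kI by (auto simp: I_def)
    then have v: "v \<in> verts G" "\<psi> v \<noteq> 0" by (auto simp: V_def)
    have "emeasure (K k) (space (K k)) = (\<Sum>a\<in>A v. p a)"
      using finA[OF k(2)] by (simp add: K_def k space_point_measure emeasure_point_measure_finite)
    also have "\<dots> = (\<Sum>a\<in>out_arcs G v. p a)"
      using fin_out v by (intro sum.mono_neutral_left) (auto simp: A_def p_def)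
    also have "\<dots> = (\<Sum>a\<in>out_arcs G v. walk_weight \<phi> [a] * \<psi> (head G a)) / \<psi> v"
      by (simp add: p_def divide_ennreal_def sum_distrib_right)
    also have "\<dots> = 1"
      using harm[OF v(1)] fin[OF v(1)] v(2) by (simp add: ennreal_divide_self)
    finally show "emeasure (K k) (space (K k)) = 1" .
  qed
  have spaceP: "\<xi> (i, v) \<in> A v" if "\<xi> \<in> space P" "v \<in> V" for \<xi> i v
    using that by (auto simp: P_def space_PiM I_def K_def space_point_measure PiE_iff)
  have AV: "head G a \<in> V" "a \<in> arcs G" "tail G a = v" if "a \<in> A v" for a v
    using that by (auto simp: A_def V_def)
  have vxV: "vx v \<xi> i \<in> V" if "\<xi> \<in> space P" "v \<in> V" for \<xi> v i
  proof (induction i)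
    case (Suc i)
    then show ?case using AV(1)[OF spaceP[OF that(1) Suc]] by (simp add: vx_def)
  qed (use that in \<open>simp add: vx_def\<close>)
  have TA: "T (v, \<xi>) i \<in> A (vx v \<xi> i)" if "\<xi> \<in> space P" "v \<in> V" for \<xi> v i
    using spaceP vxV that by (simp add: T_def)
  have Tpath: "T (v, \<xi>) \<in> inf_paths G" and Ttail: "tail G (T (v, \<xi>) i) = vx v \<xi> i"
    if "\<xi> \<in> space P" "v \<in> V" for \<xi> v i
  proof -
    have tl: "tail G (T (v, \<xi>) i) = vx v \<xi> i" for i using AV TA that by blast
    have hd: "head G (T (v, \<xi>) i) = vx v \<xi> (Suc i)" for i by (simp add: T_def vx_def)
    show "tail G (T (v, \<xi>) i) = vx v \<xi> i" by (rule tl)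
    show "T (v, \<xi>) \<in> inf_paths G"
      unfolding inf_paths_def using tl hd AV(2)[OF TA[OF that]] by simp
  qed
  have spQ: "space Q = V \<times> space P" by (simp add: Q_def space_pair_measure space_point_measure)
  have pos: "\<psi> v \<noteq> 0 \<and> (\<forall>a\<in>set \<mu>. \<psi> (head G a) \<noteq> 0 \<and> \<psi> (tail G a) \<noteq> 0)"
    if "awalk v \<mu> w" "\<psi> w \<noteq> 0" for v \<mu> w
    using that(1)
  proof (induction \<mu> arbitrary: v)
    case Nil
    then show ?case using that by (simp add: awalk_Nil_iff)
  next
    case (Cons a \<mu>)
    then have a: "a \<in> out_arcs G v" "tail G a = v" "v \<in> verts G" "awalk (head G a) \<mu> w"
      by (auto simp: awalk_Cons_iff)
    have IH: "\<psi> (head G a) \<noteq> 0" using Cons.IH[OF a(4)] by simp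
    have "\<psi> v \<noteq> 0"
    proof
      assume "\<psi> v = 0"
      then have "walk_weight \<phi> [a] * \<psi> (head G a) = 0"
        using harm[OF a(3)] a(1) fin_out[OF a(3)] by (simp add: sum_eq_0_iff)
      then show False using IH walk_weight_pos[of \<phi> "[a]"] by auto
    qed
    then show ?case using Cons.IH[OF a(4)] a by auto
  qed
  have pre: "T -` cyl G v \<mu> \<inter> space Q =
     (if \<psi> w = 0 then {} else {v} \<times> {\<xi> \<in> space P. \<forall>k\<in>(\<lambda>i. (i, tail G (\<mu> ! i))) ` {..<length \<mu>}. \<xi> k \<in> {\<mu> ! fst k}})"
    if aw: "awalk v \<mu> w" for v \<mu> w
  proof (cases "\<psi> w = 0")
    case True
    have False if "(u, \<xi>) \<in> T -` cyl G v \<mu> \<inter> space Q" for u \<xi>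
    proof -
      have *: "\<xi> \<in> space P" "u \<in> V" using that by (auto simp: spQ)
      have "T (u, \<xi>) \<in> (\<frown>) \<mu> ` cyl G w []"
        using that cyl_eq_conc[OF aw] by auto
      then obtain y where "y \<in> cyl G w []" "T (u, \<xi>) = \<mu> \<frown> y" by blast
      then have "tail G (T (u, \<xi>) (length \<mu>)) = w" by (simp add: cyl_def)
      then show False using Ttail[OF *] vxV[OF *] True by (auto simp: V_def)
    qed
    then show ?thesis using True by auto
  next
    case False
    have vV: "v \<in> V" using pos[OF aw False] aw by (auto simp: V_def awalk_def)
    have vxmu: "vx v \<xi> i = tail G (\<mu> ! i)"
      if "\<forall>j<length \<mu>. \<xi> (j, tail G (\<mu> ! j)) = \<mu> ! j" "i < length \<mu>" for \<xi> i
      using that(2)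
    proof (induction i)
      case 0
      then show ?case using aw by (cases \<mu>) (auto simp: vx_def awalk_Cons_iff)
    next
      case (Suc i)
      have "vx v \<xi> (Suc i) = head G (\<xi> (i, vx v \<xi> i))" by (simp add: vx_def)
      also have "\<dots> = head G (\<mu> ! i)" using Suc that(1) by simp
      also have "\<dots> = tail G (\<mu> ! Suc i)"
        using awalk_nth_consecutive[OF aw Suc.prems] .
      finally show ?case .
    qed
    show ?thesis
    proof (intro set_eqI iffI)
      fix x assume "x \<in> T -` cyl G v \<mu> \<inter> space Q"
      then obtain u \<xi> where x: "x = (u, \<xi>)" "u \<in> V" "\<xi> \<in> space P" "T (u, \<xi>) \<in> cyl G v \<mu>"
        by (auto simp: spQ)
      have "u = v" using Ttail[OF x(3,2), of 0] x(4) by (simp add: cyl_def vx_def)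
      moreover have "\<xi> (i, tail G (\<mu> ! i)) = \<mu> ! i" if "i < length \<mu>" for i
        using Ttail[OF x(3,2), of i] x(4) that by (auto simp: cyl_def T_def)
      ultimately show "x \<in> (if \<psi> w = 0 then {} else {v} \<times> {\<xi> \<in> space P. \<forall>k\<in>(\<lambda>i. (i, tail G (\<mu> ! i))) ` {..<length \<mu>}. \<xi> k \<in> {\<mu> ! fst k}})"
        using False x by simp
    next
      fix x assume "x \<in> (if \<psi> w = 0 then {} else {v} \<times> {\<xi> \<in> space P. \<forall>k\<in>(\<lambda>i. (i, tail G (\<mu> ! i))) ` {..<length \<mu>}. \<xi> k \<in> {\<mu> ! fst k}})"
      then obtain \<xi> where x: "x = (v, \<xi>)" "\<xi> \<in> space P"
        and \<xi>: "\<forall>j<length \<mu>. \<xi> (j, tail G (\<mu> ! j)) = \<mu> ! j"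
        using False by auto
      have "T (v, \<xi>) i = \<mu> ! i" if "i < length \<mu>" for i
        using vxmu[OF \<xi> that] \<xi> that by (simp add: T_def)
      moreover have "tail G (T (v, \<xi>) 0) = v"
        using Ttail[OF x(2) vV, of 0] by (simp add: vx_def)
      ultimately show "x \<in> T -` cyl G v \<mu> \<inter> space Q"
        using x vV Tpath[OF x(2) vV] by (simp add: spQ cyl_def)
    qed
  qed
  have nthA: "\<mu> ! i \<in> A (tail G (\<mu> ! i))" "tail G (\<mu> ! i) \<in> V"
    if "awalk v \<mu> w" "\<psi> w \<noteq> 0" "i < length \<mu>" for v \<mu> w i
  proof -
    have "\<mu> ! i \<in> set \<mu>" using that by simp
    moreover have "set \<mu> \<subseteq> arcs G" using that by (auto simp: awalk_def)
    ultimately show "\<mu> ! i \<in> A (tail G (\<mu> ! i))" "tail G (\<mu> ! i) \<in> V"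
      using pos[OF that(1,2)] by (auto simp: A_def V_def)
  qed
  have box: "{\<xi> \<in> space P. \<forall>k\<in>(\<lambda>i. (i, tail G (\<mu> ! i))) ` {..<length \<mu>}. \<xi> k \<in> {\<mu> ! fst k}} \<in> sets P" (is "?B \<in> _")
    and box_eq: "emeasure P {\<xi> \<in> space P. \<forall>k\<in>(\<lambda>i. (i, tail G (\<mu> ! i))) ` {..<length \<mu>}. \<xi> k \<in> {\<mu> ! fst k}} = (\<Prod>i<length \<mu>. p (\<mu> ! i))"
    if aw: "awalk v \<mu> w" "\<psi> w \<noteq> 0" for v \<mu> w
  proof -
    let ?J = "(\<lambda>i. (i, tail G (\<mu> ! i))) ` {..<length \<mu>}"
    have J: "finite ?J" "?J \<subseteq> I" using nthA[OF aw] by (auto simp: I_def)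
    have S: "{\<mu> ! fst k} \<in> sets (K k)" if "k \<in> ?J" for k
      using that nthA[OF aw] by (auto simp: K_def sets_point_measure)
    have eq: "?B = prod_emb I K ?J (Pi\<^sub>E ?J (\<lambda>k. {\<mu> ! fst k}))"
      unfolding P_def by (rule space_PiM_Collect_eq_prod_emb)
    show "?B \<in> sets P"
      unfolding eq unfolding P_def using J S by (intro sets_PiM_I) auto
    have "emeasure P ?B = (\<Prod>k\<in>?J. emeasure (K k) {\<mu> ! fst k})"
      unfolding eq unfolding P_def using J S prob by (intro emeasure_PiM_emb) auto
    also have "\<dots> = (\<Prod>i<length \<mu>. emeasure (K (i, tail G (\<mu> ! i))) {\<mu> ! i})"
      by (subst prod.reindex) (auto simp: inj_on_def)
    also have "\<dots> = (\<Prod>i<length \<mu>. p (\<mu> ! i))"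
      using nthA[OF aw] finA by (intro prod.cong) (auto simp: K_def emeasure_point_measure_finite2)
    finally show "emeasure P ?B = (\<Prod>i<length \<mu>. p (\<mu> ! i))" .
  qed
  have telescope: "\<psi> v * (\<Prod>i<length \<mu>. p (\<mu> ! i)) = walk_weight \<phi> \<mu> * \<psi> w"
    if "awalk v \<mu> w" "\<psi> w \<noteq> 0" for v \<mu> w
    using that(1)
  proof (induction \<mu> arbitrary: v)
    case Nil
    then show ?case by (simp add: awalk_Nil_iff)
  next
    case (Cons a \<mu>)
    then have a: "a \<in> arcs G" "tail G a = v" "v \<in> verts G" "awalk (head G a) \<mu> w"
      by (auto simp: awalk_Cons_iff)
    have "\<psi> v \<noteq> 0" using pos[OF Cons.prems that(2)] by simp
    then have "\<psi> v * p a = walk_weight \<phi> [a] * \<psi> (head G a)"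
      unfolding p_def a(2) using fin[OF a(3)]
      by (simp add: ennreal_times_divide mult.commute[of "\<psi> v"] ennreal_mult_divide_eq)
    then have "\<psi> v * (\<Prod>i<length (a # \<mu>). p ((a # \<mu>) ! i)) =
        walk_weight \<phi> [a] * (\<psi> (head G a) * (\<Prod>i<length \<mu>. p (\<mu> ! i)))"
      by (simp add: prod.lessThan_Suc_shift mult.assoc[symmetric] del: prod.lessThan_Suc)
    also have "\<dots> = walk_weight \<phi> (a # \<mu>) * \<psi> w"
      using Cons.IH[OF a(4)] walk_weight_append[of \<phi> "[a]" \<mu>] by (simp add: mult.assoc)
    finally show ?case .
  qed
  interpret P: prob_space P unfolding P_def using prob by (rule prob_space_PiM)
  have T: "T \<in> Q \<rightarrow>\<^sub>M path_borel G"
  proof (rule measurable_sigma_sets[OF sets_path_borel_cylinders cylinders_subset])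
    show "T \<in> space Q \<rightarrow> inf_paths G" using Tpath by (auto simp: spQ)
    fix C assume "C \<in> cylinders G"
    then consider "C = {}" | v \<mu> w where "C = cyl G v \<mu>" "awalk v \<mu> w"
      unfolding cylinders_def by blast
    then show "T -` C \<inter> space Q \<in> sets Q"
    proof cases
      case (2 v \<mu> w)
      show ?thesis
      proof (cases "\<psi> w = 0")
        case False
        have "v \<in> V" using pos[OF 2(2) False] 2(2) by (auto simp: V_def awalk_def)
        then show ?thesis
          unfolding 2(1) pre[OF 2(2)] using False box[OF 2(2) False]
          by (auto simp: Q_def sets_point_measure intro!: pair_measureI)
      qed (simp add: 2 pre[OF 2(2)])
    qed simp
  qed
  have m_cyl: "emeasure m (cyl G v \<mu>) = walk_weight \<phi> \<mu> * \<psi> w" if aw: "awalk v \<mu> w" for v \<mu> w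
  proof (cases "\<psi> w = 0")
    case True
    then show ?thesis unfolding m_def using T pre[OF aw] by (simp add: emeasure_distr)
  next
    case False
    have "v \<in> V" using pos[OF aw False] aw by (auto simp: V_def awalk_def)
    then have "emeasure m (cyl G v \<mu>) = \<psi> v * (\<Prod>i<length \<mu>. p (\<mu> ! i))"
      unfolding m_def using T pre[OF aw] False box[OF aw False] box_eq[OF aw False]
      by (simp add: emeasure_distr Q_def P.emeasure_pair_measure_Times sets_point_measure
          emeasure_point_measure_finite2)
    with telescope[OF aw False] show ?thesis by simp
  qed
  have m_vertex: "emeasure m (cyl G v []) = \<psi> v" if "v \<in> verts G" for v
    using m_cyl[of v "[]" v] that by (simp add: awalk_Nil_iff)
  have "conformal G \<phi> m"
  proof (rule conformalI_cylinders)
    show sets: "sets m = sets (path_borel G)" by (simp add: m_def)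
    have "emeasure m (cyl G v0 []) \<le> emeasure m (inf_paths G)"
      using sets.top[of m] by (intro emeasure_mono cyl_subset) (simp add: m_def)
    then show "emeasure m (inf_paths G) \<noteq> 0" using v0 m_vertex[OF v0(1)] by auto
    show "emeasure m (cyl G v []) < \<infinity>" if "v \<in> verts G" for v
      using m_vertex[OF that] fin[OF that] by simp
    fix a \<mu> w assume a: "a \<in> arcs G" "awalk (head G a) \<mu> w"
    then have "awalk (tail G a) (a # \<mu>) w" by (simp add: awalk_Cons_iff)
    from m_cyl[OF this] m_cyl[OF a(2)]
    show "emeasure m (cyl G (tail G a) (a # \<mu>)) = walk_weight \<phi> [a] * emeasure m (cyl G (head G a) \<mu>)"
      using walk_weight_append[of \<phi> "[a]" \<mu>] by (simp add: mult.assoc)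
  qed
  then show ?thesis using m_vertex by blast
qed

end

section \<open>Unique decompositions of paths\<close>

lemma disjoint_family_on_eqI:
  assumes "\<And>i j x. i \<in> I \<Longrightarrow> j \<in> I \<Longrightarrow> x \<in> X i \<Longrightarrow> x \<in> X j \<Longrightarrow> i = j"
  shows "disjoint_family_on X I"
  unfolding disjoint_family_on_def using assms by fast

lemma disjoint_family_on_imageI:
  assumes "\<And>i j x y. i \<in> I \<Longrightarrow> j \<in> I \<Longrightarrow> x \<in> X \<Longrightarrow> y \<in> X \<Longrightarrow> f i x = f j y \<Longrightarrow> i = j"
  shows "disjoint_family_on (\<lambda>i. f i ` X) I"
proof (rule disjoint_family_on_eqI)
  fix i j x assume "i \<in> I" "j \<in> I" "x \<in> f i ` X" "x \<in> f j ` X"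
  then show "i = j" using assms[of i j] by (elim imageE) metis
qed

lemma conc_eq_concD:
  assumes "\<mu> \<frown> y = \<mu>' \<frown> y'" "length \<mu> \<le> length \<mu>'"
  shows "\<exists>\<sigma>. \<mu>' = \<mu> @ \<sigma> \<and> y = \<sigma> \<frown> y'"
proof (intro exI conjI)
  have eq: "(\<mu> \<frown> y) i = (\<mu>' \<frown> y') i" for i using assms by simp
  have "\<mu> ! i = \<mu>' ! i" if "i < length \<mu>" for i
    using eq[of i] that assms(2) by simp
  then have "take (length \<mu>) \<mu>' = \<mu>"
    using assms(2) by (intro nth_equalityI) auto
  then show "\<mu>' = \<mu> @ drop (length \<mu>) \<mu>'" by (metis append_take_drop_id)
  show "y = drop (length \<mu>) \<mu>' \<frown> y'"
  proof
    fix i show "y i = (drop (length \<mu>) \<mu>' \<frown> y') i"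
      using eq[of "length \<mu> + i"] assms(2) by (cases "length \<mu> + i < length \<mu>'") (auto simp: add.commute)
  qed
qed

lemma emeasure_Diff_plus:
  assumes "B \<in> sets M" "A \<in> sets M" "B \<subseteq> A"
  shows "emeasure M A = emeasure M (A - B) + emeasure M B"
proof -
  have "A - B \<union> B = A" "(A - B) \<inter> B = {}" using assms(3) by auto
  then show ?thesis using plus_emeasure[of "A - B" M B] assms by simp
qed

lemma UN_UN_imageI:
  "z \<in> D \<Longrightarrow> \<rho> \<in> A z \<Longrightarrow> x \<in> B z \<Longrightarrow> y = f \<rho> x \<Longrightarrow> y \<in> (\<Union>z\<in>D. \<Union>\<rho>\<in>A z. f \<rho> ` B z)"
  by auto

lemma UN_UN_imageE:
  assumes "y \<in> (\<Union>z\<in>D. \<Union>\<rho>\<in>A z. f \<rho> ` B z)"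
  obtains z \<rho> x where "z \<in> D" "\<rho> \<in> A z" "x \<in> B z" "y = f \<rho> x"
  using assms by auto

context countable_digraph
begin

lemma countable_walks: "(\<And>\<mu>. \<mu> \<in> S \<Longrightarrow> \<exists>w. awalk v \<mu> w) \<Longrightarrow> countable S"
  by (rule countable_walk_set[OF countable_arcs]) (auto simp: awalk_def)

lemma walk_target_unique: "awalk v \<mu> w \<Longrightarrow> awalk v \<mu> w' \<Longrightarrow> w = w'"
  using awalk_ends by blast

text \<open>
  Paths are cut at a distinguished vertex \<open>z\<close> of \<open>D\<close> into a beginning from \<open>A z\<close> and a rest from
  \<open>B z\<close>.  The last assumption says that a path which can be cut at two places has them at the same
  position: a cut after \<open>\<rho>\<close> and a later one after \<open>\<rho> @ \<sigma>\<close> force \<open>\<sigma>\<close> to be empty.  Cutting at the first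
  return to \<open>D\<close> and at the last visit to \<open>D\<close> are both of this kind, for finite and for infinite paths.
\<close>
lemma weight_decomposition:
  assumes D: "finite D" and A: "\<And>z \<rho>. z \<in> D \<Longrightarrow> \<rho> \<in> A z \<Longrightarrow> awalk v \<rho> z"
    and unique: "\<And>z z' \<rho> \<sigma> \<nu>. z \<in> D \<Longrightarrow> z' \<in> D \<Longrightarrow> \<rho> \<in> A z \<Longrightarrow> \<rho> @ \<sigma> \<in> A z' \<Longrightarrow>
      \<sigma> @ \<nu> \<in> B z \<Longrightarrow> \<nu> \<in> B z' \<Longrightarrow> \<sigma> = []"
  shows "weight \<phi> (\<Union>z\<in>D. \<Union>\<rho>\<in>A z. (@) \<rho> ` B z) = (\<Sum>z\<in>D. weight \<phi> (A z) * weight \<phi> (B z))"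
proof -
  have eq: "\<rho> = \<rho>'" if "z \<in> D" "z' \<in> D" "\<rho> \<in> A z" "\<rho>' \<in> A z'" "\<nu> \<in> B z" "\<nu>' \<in> B z'" "\<rho> @ \<nu> = \<rho>' @ \<nu>'"
    for z z' \<rho> \<rho>' \<nu> \<nu>'
  proof -
    from that(7) obtain \<sigma> where "\<rho> = \<rho>' @ \<sigma> \<and> \<sigma> @ \<nu> = \<nu>' \<or> \<rho> @ \<sigma> = \<rho>' \<and> \<nu> = \<sigma> @ \<nu>'"
      unfolding append_eq_append_conv2 by blast
    then show ?thesis using unique that by (metis append_Nil2)
  qed
  have cA: "countable (A z)" if "z \<in> D" for z
    using A[OF that] by (intro countable_walks) blast
  have "disjoint_family_on (\<lambda>\<rho>. (@) \<rho> ` B z) (A z)" if "z \<in> D" for z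
    by (rule disjoint_family_on_imageI) (rule eq[OF that that])
  moreover have "disjoint_family_on (\<lambda>z. \<Union>\<rho>\<in>A z. (@) \<rho> ` B z) D"
  proof (rule disjoint_family_on_eqI)
    fix z z' x assume z: "z \<in> D" "z' \<in> D"
      and "x \<in> (\<Union>\<rho>\<in>A z. (@) \<rho> ` B z)" "x \<in> (\<Union>\<rho>\<in>A z'. (@) \<rho> ` B z')"
    then obtain \<rho> \<rho>' \<nu> \<nu>' where "\<rho> \<in> A z" "\<rho>' \<in> A z'" "\<nu> \<in> B z" "\<nu>' \<in> B z'" "\<rho> @ \<nu> = \<rho>' @ \<nu>'"
      by (elim UN_E imageE) simp
    with eq[OF z this] z show "z = z'" using A walk_target_unique by metis
  qed
  ultimately show ?thesis
    using D cA by (simp add: weight_UN_finite weight_concat)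
qed

lemma
  assumes m: "conformal G \<phi> m" and D: "finite D"
    and A: "\<And>z \<rho>. z \<in> D \<Longrightarrow> \<rho> \<in> A z \<Longrightarrow> awalk v \<rho> z"
    and B: "\<And>z. z \<in> D \<Longrightarrow> B z \<in> sets m" "\<And>z. z \<in> D \<Longrightarrow> B z \<subseteq> cyl G z []"
    and unique: "\<And>z z' \<rho> \<sigma> y. z \<in> D \<Longrightarrow> z' \<in> D \<Longrightarrow> \<rho> \<in> A z \<Longrightarrow> \<rho> @ \<sigma> \<in> A z' \<Longrightarrow>
      \<sigma> \<frown> y \<in> B z \<Longrightarrow> y \<in> B z' \<Longrightarrow> \<sigma> = []"
  shows decomposition_sets: "(\<Union>z\<in>D. \<Union>\<rho>\<in>A z. (\<frown>) \<rho> ` B z) \<in> sets m"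
    and emeasure_decomposition:
      "emeasure m (\<Union>z\<in>D. \<Union>\<rho>\<in>A z. (\<frown>) \<rho> ` B z) = (\<Sum>z\<in>D. weight \<phi> (A z) * emeasure m (B z))"
proof -
  have sets: "sets m = sets (path_borel G)" using m by (simp add: conformal_def)
  have eq: "\<rho> = \<rho>'" if "z \<in> D" "z' \<in> D" "\<rho> \<in> A z" "\<rho>' \<in> A z'" "y \<in> B z" "y' \<in> B z'" "\<rho> \<frown> y = \<rho>' \<frown> y'"
    for z z' \<rho> \<rho>' y y'
  proof (cases "length \<rho> \<le> length \<rho>'")
    case True
    with conc_eq_concD[OF that(7)] unique that show ?thesis by (metis append_Nil2)
  next
    case False
    with conc_eq_concD[OF that(7)[symmetric]] unique that show ?thesis by (metis append_Nil2 nat_le_linear)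
  qed
  have S: "(\<Union>\<rho>\<in>A z. (\<frown>) \<rho> ` B z) \<in> sets m" if "z \<in> D" for z
    unfolding sets
    by (rule conc_UN_sets[OF A[OF that] B(1)[OF that, unfolded sets] B(2)[OF that]])
  then show "(\<Union>z\<in>D. \<Union>\<rho>\<in>A z. (\<frown>) \<rho> ` B z) \<in> sets m"
    using D by auto
  have dA: "disjoint_family_on (\<lambda>\<rho>. (\<frown>) \<rho> ` B z) (A z)" if "z \<in> D" for z
    by (rule disjoint_family_on_imageI) (rule eq[OF that that])
  have E: "emeasure m (\<Union>\<rho>\<in>A z. (\<frown>) \<rho> ` B z) = weight \<phi> (A z) * emeasure m (B z)" if "z \<in> D" for z
    by (rule emeasure_conc_UN[OF m A[OF that] B(1)[OF that] B(2)[OF that] dA[OF that]])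
  have disj: "disjoint_family_on (\<lambda>z. \<Union>\<rho>\<in>A z. (\<frown>) \<rho> ` B z) D"
  proof (rule disjoint_family_on_eqI)
    fix z z' x assume z: "z \<in> D" "z' \<in> D"
      and "x \<in> (\<Union>\<rho>\<in>A z. (\<frown>) \<rho> ` B z)" "x \<in> (\<Union>\<rho>\<in>A z'. (\<frown>) \<rho> ` B z')"
    then obtain \<rho> \<rho>' y y' where "\<rho> \<in> A z" "\<rho>' \<in> A z'" "y \<in> B z" "y' \<in> B z'" "\<rho> \<frown> y = \<rho>' \<frown> y'"
      by (elim UN_E imageE) simp
    with eq[OF z this] z show "z = z'" using A walk_target_unique by metis
  qed
  have "emeasure m (\<Union>z\<in>D. \<Union>\<rho>\<in>A z. (\<frown>) \<rho> ` B z) = (\<Sum>z\<in>D. emeasure m (\<Union>\<rho>\<in>A z. (\<frown>) \<rho> ` B z))"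
    using S disj D by (intro sum_emeasure[symmetric]) auto
  then show "emeasure m (\<Union>z\<in>D. \<Union>\<rho>\<in>A z. (\<frown>) \<rho> ` B z) = (\<Sum>z\<in>D. weight \<phi> (A z) * emeasure m (B z))"
    using E by simp
qed

end

section \<open>Transience\<close>

locale transient_digraph = countable_digraph G for G :: "('v, 'e) pre_digraph" +
  fixes \<phi> :: "'e \<Rightarrow> real"
  assumes row_finite: "row_finite G"
    and transient: "\<And>v w. v \<in> verts G \<Longrightarrow> w \<in> verts G \<Longrightarrow> weight \<phi> {\<mu>. awalk v \<mu> w} < \<infinity>"
begin

definition green :: "'v \<Rightarrow> 'v \<Rightarrow> ennreal" where
  "green v w = weight \<phi> {\<mu>. awalk v \<mu> w}"

definition first_returns :: "'v set \<Rightarrow> 'v \<Rightarrow> 'v \<Rightarrow> 'e list set" where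
  "first_returns D w u = {\<mu>. awalk w \<mu> u \<and> \<mu> \<noteq> [] \<and> (\<forall>a\<in>set (butlast \<mu>). head G a \<notin> D)}"

lemma finite_out_arcs: "finite (out_arcs G v)"
proof (cases "v \<in> verts G")
  case True
  then show ?thesis using row_finite by (simp add: row_finite_def)
next
  case False
  then have "out_arcs G v = {}" by auto
  then show ?thesis by simp
qed

lemma green_finite: "v \<in> verts G \<Longrightarrow> w \<in> verts G \<Longrightarrow> green v w < top"
  using transient by (simp add: green_def)

lemma conformal_finite: "conformal G \<phi> m \<Longrightarrow> v \<in> verts G \<Longrightarrow> emeasure m (cyl G v []) < top"
  by (simp add: conformal_def)

lemma green_step:
  assumes "v \<noteq> w"
  shows "green v w = (\<Sum>a\<in>out_arcs G v. walk_weight \<phi> [a] * green (head G a) w)"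
proof -
  have "\<mu> \<in> (\<Union>a\<in>out_arcs G v. (@) [a] ` {\<mu>. awalk (head G a) \<mu> w})" if "awalk v \<mu> w" for \<mu>
    using that assms by (cases \<mu>) (auto simp: awalk_Nil_iff awalk_Cons_iff)
  then have "{\<mu>. awalk v \<mu> w} = (\<Union>a\<in>out_arcs G v. (@) [a] ` {\<mu>. awalk (head G a) \<mu> w})"
    by (auto simp: awalk_Cons_iff)
  moreover have "disjoint_family_on (\<lambda>a. (@) [a] ` {\<mu>. awalk (head G a) \<mu> w}) (out_arcs G v)"
    by (auto simp: disjoint_family_on_def)
  ultimately show ?thesis
    unfolding green_def using finite_out_arcs by (simp only: weight_UN_finite weight_append_image)
qed

lemma first_returns_prefix_free:
  assumes "z \<in> D" "\<rho> \<in> first_returns D w z" "\<rho> @ \<sigma> \<in> first_returns D w z'"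
  shows "\<sigma> = []"
proof (rule ccontr)
  assume "\<sigma> \<noteq> []"
  then have "last \<rho> \<in> set (butlast (\<rho> @ \<sigma>))"
    using assms(2) by (auto simp: first_returns_def butlast_append)
  moreover have "head G (last \<rho>) = z"
    using assms(2) by (auto simp: first_returns_def awalk_verts_conv elim!: awalkE')
  ultimately show False using assms by (auto simp: first_returns_def)
qed

text \<open>
  A non-empty walk that ends in \<open>D\<close> is cut at its first return to \<open>D\<close>.
\<close>
lemma green_first_return:
  assumes D: "finite D" and w: "w \<in> verts G" and u: "u \<in> D"
  shows "green w u = (if w = u then 1 else 0) + (\<Sum>z\<in>D. weight \<phi> (first_returns D w z) * green z u)"
proof -
  let ?R = "\<Union>z\<in>D. \<Union>\<rho>\<in>first_returns D w z. (@) \<rho> ` {\<nu>. awalk z \<nu> u}"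
  have "\<mu> \<in> (if w = u then {[]} else {}) \<union> ?R" if \<mu>: "awalk w \<mu> u" for \<mu>
  proof (cases "\<mu> = []")
    case True
    then show ?thesis using \<mu> by (simp add: awalk_Nil_iff)
  next
    case False
    then have "head G (last \<mu>) = u" "last \<mu> \<in> set \<mu>"
      using \<mu> by (auto simp: awalk_verts_conv elim!: awalkE')
    then have "\<exists>a\<in>set \<mu>. head G a \<in> D" using u by auto
    from split_list_first_prop[OF this]
    obtain xs a ys where s: "\<mu> = xs @ a # ys" "head G a \<in> D" "\<forall>x\<in>set xs. head G x \<notin> D"
      by (elim exE conjE bexE)
    from \<mu> have aw: "awalk w (xs @ [a]) (head G a)" "awalk (head G a) ys u"
      unfolding s(1) by (auto simp: awalk_Cons_iff awalk_Nil_iff)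
    then have "xs @ [a] \<in> first_returns D w (head G a)"
      using s(3) unfolding first_returns_def by simp
    moreover have "\<mu> = (xs @ [a]) @ ys" using s by simp
    ultimately have "\<mu> \<in> ?R"
      using s(2) aw(2) by (intro UN_UN_imageI[of "head G a" D "xs @ [a]" _ ys]) (assumption | simp)+
    then show ?thesis by simp
  qed
  moreover have "awalk w (\<rho> @ \<nu>) u" if "\<rho> \<in> first_returns D w z" "awalk z \<nu> u" for \<rho> \<nu> z
    using that awalk_appendI unfolding first_returns_def by blast
  moreover have "awalk w [] u" if "w = u" using that w by (simp add: awalk_Nil_iff)
  ultimately have eq: "{\<mu>. awalk w \<mu> u} = (if w = u then {[]} else {}) \<union> ?R"
    by (intro set_eqI iffI) (blast, elim UnE UN_UN_imageE, auto split: if_splits)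
  have "weight \<phi> {\<mu>. awalk w \<mu> u} = weight \<phi> (if w = u then {[]} else {}) + weight \<phi> ?R"
    unfolding eq by (rule weight_Un) (auto simp: first_returns_def)
  also have "weight \<phi> ?R = (\<Sum>z\<in>D. weight \<phi> (first_returns D w z) * weight \<phi> {\<nu>. awalk z \<nu> u})"
  proof (rule weight_decomposition[where v = w])
    show "\<sigma> = []" if "z \<in> D" "\<rho> \<in> first_returns D w z" "\<rho> @ \<sigma> \<in> first_returns D w z'" for z z' \<rho> \<sigma>
      using first_returns_prefix_free that by blast
  qed (use D in \<open>auto simp: first_returns_def\<close>)
  finally show ?thesis by (simp add: green_def)
qed

text \<open>
  A walk from \<open>D\<close> to the outside is cut at its last visit to \<open>D\<close>.
\<close>
lemma green_last_exit:
  assumes D: "finite D" "D \<subseteq> verts G" and v: "v \<in> D" and w: "w \<notin> D"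
  shows "green v w = (\<Sum>u\<in>D. green v u * weight \<phi> (link_paths G D u w))"
proof -
  let ?R = "\<Union>u\<in>D. \<Union>\<rho>\<in>{\<mu>. awalk v \<mu> u}. (@) \<rho> ` link_paths G D u w"
  have "\<mu> \<in> ?R" if \<mu>: "awalk v \<mu> w" for \<mu>
  proof (cases "\<exists>a\<in>set \<mu>. head G a \<in> D")
    case False
    then have "\<mu> \<in> link_paths G D v w" using \<mu> v w by (auto simp: link_paths_def)
    moreover have "awalk v [] v" using v D by (auto simp: awalk_Nil_iff)
    ultimately show ?thesis using v by (intro UN_UN_imageI[of v D "[]" _ \<mu>]) simp_all
  next
    case True
    from split_list_last_prop[OF this]
    obtain xs a ys where s: "\<mu> = xs @ a # ys" "head G a \<in> D" "\<forall>x\<in>set ys. head G x \<notin> D"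
      by (elim exE conjE bexE)
    from \<mu> have aw: "awalk v (xs @ [a]) (head G a)" "awalk (head G a) ys w"
      unfolding s(1) by (auto simp: awalk_Cons_iff awalk_Nil_iff)
    then have "ys \<in> link_paths G D (head G a) w"
      using s w by (auto simp: link_paths_def)
    moreover have "\<mu> = (xs @ [a]) @ ys" using s by simp
    ultimately show ?thesis
      using aw(1) s(2) by (intro UN_UN_imageI[of "head G a" D "xs @ [a]" _ ys]) (assumption | simp)+
  qed
  moreover have "awalk v (\<rho> @ \<nu>) w" if "awalk v \<rho> u" "\<nu> \<in> link_paths G D u w" for \<rho> \<nu> u
    using that awalk_appendI unfolding link_paths_def by blast
  ultimately have "{\<mu>. awalk v \<mu> w} = ?R"
    by (intro set_eqI iffI) (blast, elim UN_UN_imageE, simp)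
  moreover have "weight \<phi> ?R = (\<Sum>u\<in>D. weight \<phi> {\<mu>. awalk v \<mu> u} * weight \<phi> (link_paths G D u w))"
  proof (rule weight_decomposition[where v = v])
    fix z z' \<rho> \<sigma> \<nu>
    assume *: "z \<in> D" "z' \<in> D" "\<rho> \<in> {\<mu>. awalk v \<mu> z}" "\<rho> @ \<sigma> \<in> {\<mu>. awalk v \<mu> z'}"
      "\<sigma> @ \<nu> \<in> link_paths G D z w" "\<nu> \<in> link_paths G D z' w"
    show "\<sigma> = []"
    proof (rule ccontr)
      assume "\<sigma> \<noteq> []"
      then have "head G (last \<sigma>) = z'"
        using *(4) by (auto simp: awalk_verts_conv elim!: awalkE' split: if_splits)
      moreover have "last \<sigma> \<in> set (\<sigma> @ \<nu>)" using \<open>\<sigma> \<noteq> []\<close> by simp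
      ultimately show False using * unfolding link_paths_def by blast
    qed
  qed (use D in auto)
  ultimately show ?thesis by (simp add: green_def)
qed

lemma first_returns_le_green: "weight \<phi> (first_returns D w u) \<le> green w u"
  unfolding green_def by (rule weight_mono) (auto simp: first_returns_def)

section \<open>Wandering paths, last exits and first returns\<close>

text \<open>
  Countably many conditions describe the wandering paths, which makes them a Borel set.
\<close>
lemma wan_eq: "wan G = {p \<in> inf_paths G. \<forall>v\<in>verts G. \<exists>N. \<forall>i\<ge>N. tail G (p i) \<noteq> v}"
proof (intro set_eqI iffI)
  fix p assume p: "p \<in> {p \<in> inf_paths G. \<forall>v\<in>verts G. \<exists>N. \<forall>i\<ge>N. tail G (p i) \<noteq> v}"
  have "\<exists>N. \<forall>i\<ge>N. tail G (p i) \<notin> H" if "finite H" "H \<subseteq> verts G" for H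
    using that
  proof (induction H)
    case (insert v H)
    then obtain N M where N: "\<forall>i\<ge>N. tail G (p i) \<notin> H" "\<forall>i\<ge>M. tail G (p i) \<noteq> v"
      using p by auto
    then show ?case by (intro exI[of _ "max N M"]) auto
  qed simp
  then show "p \<in> wan G" using p by (auto simp: wan_def)
next
  fix p assume p: "p \<in> wan G"
  have "\<exists>N. \<forall>i\<ge>N. tail G (p i) \<noteq> v" if "v \<in> verts G" for v
  proof -
    have "{v} \<subseteq> verts G \<and> finite {v}" using that by simp
    then show ?thesis using p unfolding wan_def by blast
  qed
  then show "p \<in> {p \<in> inf_paths G. \<forall>v\<in>verts G. \<exists>N. \<forall>i\<ge>N. tail G (p i) \<noteq> v}"
    using p by (auto simp: wan_def)
qed

lemma wan_sets [measurable]: "wan G \<in> sets (path_borel G)"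
proof -
  have "wan G = {p \<in> space (path_borel G). \<forall>v\<in>verts G. \<exists>N. \<forall>i\<ge>N. tail G (p i) \<noteq> v}"
    by (simp add: wan_eq)
  also have "\<dots> \<in> sets (path_borel G)"
    using countable_verts by measurable
  finally show ?thesis .
qed

lemma exit_paths_sets: "exit_paths G D w \<in> sets (path_borel G)"
proof -
  have [measurable]: "Measurable.pred (path_borel G) (\<lambda>p. tail G (p i) \<notin> D)" for i
    by (rule measurable_compose[OF measurable_path_tail]) simp
  have "exit_paths G D w =
      wan G \<inter> {y \<in> space (path_borel G). tail G (y 0) = w \<and> (\<forall>i. tail G (y (Suc i)) \<notin> D)}"
    by (auto simp: exit_paths_def wan_def Suc_le_eq dest: gr0_implies_Suc)
  also have "\<dots> \<in> sets (path_borel G)"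
    by (intro sets.Int wan_sets) measurable
  finally show ?thesis .
qed

lemma exit_paths_subset: "exit_paths G D w \<subseteq> cyl G w []"
  by (auto simp: exit_paths_def cyl_def wan_def)

lemma wan_suffix: "p \<in> wan G \<Longrightarrow> suffix n p \<in> wan G"
  unfolding wan_def by (auto simp: suffix_inf_path) (meson trans_le_add2)

lemma wan_conc:
  assumes "awalk v \<mu> w" "tail G (y 0) = w" "y \<in> inf_paths G"
  shows "\<mu> \<frown> y \<in> wan G \<longleftrightarrow> y \<in> wan G"
proof
  assume "\<mu> \<frown> y \<in> wan G"
  moreover have "suffix (length \<mu>) (\<mu> \<frown> y) = y" by (simp add: fun_eq_iff)
  ultimately show "y \<in> wan G" using wan_suffix by metis
next
  assume y: "y \<in> wan G"
  have "\<exists>N. \<forall>i\<ge>N. tail G ((\<mu> \<frown> y) i) \<notin> H" if H: "H \<subseteq> verts G \<and> finite H" for H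
  proof -
    obtain N where "\<forall>i\<ge>N. tail G (y i) \<notin> H" using y H unfolding wan_def by blast
    then have "\<forall>i\<ge>N + length \<mu>. tail G ((\<mu> \<frown> y) i) \<notin> H" by simp
    then show ?thesis by blast
  qed
  then show "\<mu> \<frown> y \<in> wan G"
    using conc_inf_path[OF assms(1,3,2)] unfolding wan_def by simp
qed

lemma exit_paths_unique:
  assumes "z' \<in> D" "\<sigma> \<frown> y \<in> exit_paths G D z" "y \<in> exit_paths G D z'"
  shows "\<sigma> = []"
proof (rule ccontr)
  assume "\<sigma> \<noteq> []"
  then have "1 \<le> length \<sigma>" by (cases \<sigma>) auto
  then have "tail G ((\<sigma> \<frown> y) (length \<sigma>)) \<notin> D"
    using assms(2) unfolding exit_paths_def by blast
  then show False using assms by (simp add: exit_paths_def)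
qed

lemma ex_last_visit:
  assumes y: "y \<in> wan G" and D: "finite D" "D \<subseteq> verts G" and i: "tail G (y i) \<in> D"
  shows "\<exists>j. tail G (y j) \<in> D \<and> suffix j y \<in> exit_paths G D (tail G (y j))"
proof -
  obtain N where N: "\<forall>k\<ge>N. tail G (y k) \<notin> D" using y D unfolding wan_def by blast
  have bound: "k \<le> N" if "tail G (y k) \<in> D" for k
    using N that by (meson nat_le_linear)
  let ?j = "GREATEST k. tail G (y k) \<in> D"
  have "tail G (y ?j) \<in> D" using i bound by (rule GreatestI_nat)
  moreover have "tail G (y k) \<notin> D" if "k > ?j" for k
    using Greatest_le_nat[of "\<lambda>k. tail G (y k) \<in> D" k N] bound that by auto
  ultimately show ?thesis
    using wan_suffix[OF y] by (intro exI[of _ ?j]) (auto simp: exit_paths_def)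
qed

text \<open>
  A wandering path is cut at its last visit to \<open>D\<close>.  Cutting respects membership in \<open>B\<close> because \<open>B\<close>
  does not see initial segments.
\<close>
lemma emeasure_last_exit:
  assumes m: "conformal G \<phi> m" and D: "finite D" "D \<subseteq> verts G" and v: "v \<in> D"
    and B: "B \<in> sets m"
    and inv: "\<And>\<mu> w y. awalk v \<mu> w \<Longrightarrow> y \<in> wan G \<Longrightarrow> tail G (y 0) = w \<Longrightarrow> \<mu> \<frown> y \<in> B \<longleftrightarrow> y \<in> B"
  shows "emeasure m (cyl G v [] \<inter> wan G \<inter> B) = (\<Sum>w\<in>D. green v w * emeasure m (exit_paths G D w \<inter> B))"
proof -
  have sets: "sets m = sets (path_borel G)" using m by (simp add: conformal_def)
  let ?R = "\<Union>w\<in>D. \<Union>\<rho>\<in>{\<mu>. awalk v \<mu> w}. (\<frown>) \<rho> ` (exit_paths G D w \<inter> B)"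
  have "y \<in> ?R" if y: "y \<in> cyl G v [] \<inter> wan G \<inter> B" for y
  proof -
    have *: "y \<in> wan G" "tail G (y 0) \<in> D" "y \<in> inf_paths G" "tail G (y 0) = v" "y \<in> B"
      using y v by (auto simp: cyl_def)
    obtain j where j: "tail G (y j) \<in> D" "suffix j y \<in> exit_paths G D (tail G (y j))"
      using ex_last_visit[OF *(1) D *(2)] by blast
    have aw: "awalk v (prefix j y) (tail G (y j))"
      using inf_path_prefix[OF *(3), of j] *(4) by simp
    have eq: "y = prefix j y \<frown> suffix j y" by simp
    then have "suffix j y \<in> B"
      using inv[OF aw, of "suffix j y"] wan_suffix[OF *(1), of j] *(5) by simp
    then show ?thesis using j aw by (intro UN_UN_imageI[where f = "(\<frown>)", OF _ _ _ eq]) simp_all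
  qed
  moreover have "\<rho> \<frown> y \<in> cyl G v [] \<inter> wan G \<inter> B"
    if "awalk v \<rho> w" "y \<in> exit_paths G D w \<inter> B" for \<rho> w y
  proof -
    have y: "y \<in> wan G" "tail G (y 0) = w" "y \<in> inf_paths G" "y \<in> B"
      using that by (auto simp: exit_paths_def wan_def)
    then show ?thesis
      using conc_inf_path[OF that(1) y(3,2)] wan_conc[OF that(1) y(2,3)] inv[OF that(1) y(1,2)]
      by (simp add: cyl_def)
  qed
  ultimately have eq: "cyl G v [] \<inter> wan G \<inter> B = ?R"
    by (intro set_eqI iffI) (blast, elim UN_UN_imageE, simp)
  show ?thesis
    unfolding eq green_def
  proof (rule emeasure_decomposition[OF m D(1), where v = v])
    show "exit_paths G D z \<inter> B \<in> sets m" for z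
      using exit_paths_sets B by (auto simp: sets)
    show "exit_paths G D z \<inter> B \<subseteq> cyl G z []" for z using exit_paths_subset by blast
    show "\<sigma> = []" if "z' \<in> D" "\<sigma> \<frown> y \<in> exit_paths G D z \<inter> B" "y \<in> exit_paths G D z' \<inter> B" for z z' \<sigma> y
      using exit_paths_unique that by blast
  qed auto
qed

lemma emeasure_visit:
  assumes m: "conformal G \<phi> m" and u: "u \<in> verts G"
  shows "emeasure m {y \<in> cyl G v []. tail G (y i) = u} =
    weight \<phi> {\<mu>. awalk v \<mu> u \<and> length \<mu> = i} * emeasure m (cyl G u [])"
proof -
  have eq: "{y \<in> cyl G v []. tail G (y i) = u} =
      (\<Union>z\<in>{u}. \<Union>\<rho>\<in>{\<mu>. awalk v \<mu> z \<and> length \<mu> = i}. (\<frown>) \<rho> ` cyl G z [])" (is "?L = ?R")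
  proof (intro set_eqI iffI)
    fix y assume "y \<in> ?L"
    then have y: "y \<in> inf_paths G" "tail G (y 0) = v" "tail G (y i) = u" by (auto simp: cyl_def)
    have "awalk v (prefix i y) u" using inf_path_prefix[OF y(1), of i] y by simp
    moreover have "suffix i y \<in> cyl G u []" using y suffix_inf_path by (simp add: cyl_def)
    ultimately show "y \<in> ?R" by (intro UN_UN_imageI[where f = "(\<frown>)", OF _ _ _ prefix_suffix[of y i]]) simp_all
  next
    fix y assume "y \<in> ?R"
    then obtain \<rho> z where \<rho>: "awalk v \<rho> u" "length \<rho> = i" "z \<in> cyl G u []" "y = \<rho> \<frown> z"
      by (elim UN_UN_imageE) auto
    then show "y \<in> ?L" using conc_inf_path[OF \<rho>(1), of z] by (simp add: cyl_def)
  qed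
  have "emeasure m ?R = (\<Sum>z\<in>{u}. weight \<phi> {\<mu>. awalk v \<mu> z \<and> length \<mu> = i} * emeasure m (cyl G z []))"
    by (rule emeasure_decomposition[OF m, where v = v]) (use m in \<open>auto simp: conformal_def\<close>)
  then show ?thesis unfolding eq by simp
qed

text \<open>
  By Borel--Cantelli: the expected number of visits to \<open>u\<close> of a path from \<open>v\<close> is \<open>green v u\<close> times the
  mass of \<open>Z(u)\<close>, which is finite.
\<close>
lemma null_non_wandering:
  assumes m: "conformal G \<phi> m"
  shows "inf_paths G - wan G \<in> null_sets m"
proof -
  have sets: "sets m = sets (path_borel G)" using m by (simp add: conformal_def)
  have space: "space m = inf_paths G" using sets_eq_imp_space_eq[OF sets] by simp
  have cs: "cyl G v \<mu> \<in> sets m" for v \<mu> by (simp add: sets)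
  have fin: "AE y in m. y \<in> cyl G v [] \<longrightarrow> (\<exists>N. \<forall>i\<ge>N. tail G (y i) \<noteq> u)" if v: "v \<in> verts G" and u: "u \<in> verts G" for v u
  proof -
    let ?A = "\<lambda>i. {y \<in> cyl G v []. tail G (y i) = u}"
    have A: "?A i \<in> sets m" for i
    proof -
      have "{y \<in> space (path_borel G). tail G (y i) = u} \<in> sets (path_borel G)" by measurable
      moreover have "?A i = cyl G v [] \<inter> {y \<in> space (path_borel G). tail G (y i) = u}"
        by (auto simp: cyl_def)
      ultimately have "?A i \<in> sets (path_borel G)" by simp
      also have "\<dots> = sets m" by (simp add: sets)
      finally show ?thesis .
    qed
    have finA: "emeasure m (?A i) < \<infinity>" for i
    proof -
      have "emeasure m (?A i) \<le> emeasure m (cyl G v [])" using cs by (intro emeasure_mono) auto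
      also have "\<dots> < \<infinity>" using conformal_finite[OF m v] by simp
      finally show ?thesis .
    qed
    have "(\<Sum>i. weight \<phi> {\<mu>. awalk v \<mu> u \<and> length \<mu> = i}) = green v u"
    proof -
      have "{\<mu>. awalk v \<mu> u} = (\<Union>i. {\<mu>. awalk v \<mu> u \<and> length \<mu> = i})" by auto
      then show ?thesis unfolding green_def weight_def
        by (simp only:) (rule suminf_emeasure, auto simp: disjoint_family_on_def)
    qed
    then have "(\<Sum>i. emeasure m (?A i)) = green v u * emeasure m (cyl G u [])"
      by (simp add: emeasure_visit[OF m u])
    also have "\<dots> < top"
      using green_finite[OF v u] conformal_finite[OF m u] by (simp add: ennreal_mult_less_top)
    finally have "(\<Sum>i. ennreal (measure m (?A i))) \<noteq> top"
      using finA by (simp add: emeasure_eq_ennreal_measure less_top)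
    then have "summable (\<lambda>i. measure m (?A i))" by (intro summable_suminf_not_top) auto
    from borel_cantelli_AE1[OF A finA this]
    have "AE y in m. \<forall>\<^sub>F i in sequentially. y \<in> space m - ?A i" .
    then show ?thesis
      by (rule AE_mp) (auto simp: eventually_sequentially)
  qed
  have "AE y in m. \<forall>v\<in>verts G. \<forall>u\<in>verts G. y \<in> cyl G v [] \<longrightarrow> (\<exists>N. \<forall>i\<ge>N. tail G (y i) \<noteq> u)"
    unfolding AE_ball_countable[OF countable_verts] by (intro ballI fin)
  then have "AE y in m. y \<notin> inf_paths G - wan G"
  proof (rule AE_mp, intro AE_I2 impI)
    fix y assume y: "y \<in> space m"
      "\<forall>v\<in>verts G. \<forall>u\<in>verts G. y \<in> cyl G v [] \<longrightarrow> (\<exists>N. \<forall>i\<ge>N. tail G (y i) \<noteq> u)"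
    then have "y \<in> inf_paths G" by (simp add: space)
    then have "tail G (y 0) \<in> verts G" "y \<in> cyl G (tail G (y 0)) []"
      by (simp_all add: inf_path_tail cyl_def)
    with y(2) have "\<forall>u\<in>verts G. \<exists>N. \<forall>i\<ge>N. tail G (y i) \<noteq> u" by blast
    then have "y \<in> wan G" using \<open>y \<in> inf_paths G\<close> unfolding wan_eq by simp
    then show "y \<notin> inf_paths G - wan G" by simp
  qed
  moreover have "inf_paths G - wan G \<in> sets m"
    using sets.compl_sets[of "wan G" "path_borel G"] by (simp add: sets wan_sets)
  ultimately show ?thesis by (simp add: AE_iff_null_sets)
qed

text \<open>
  A path from \<open>D\<close> either returns to \<open>D\<close>, and is cut at the first return, or never does; in the
  second case it is an exit path, up to the null set of paths that do not wander.
\<close>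
lemma emeasure_first_return:
  assumes m: "conformal G \<phi> m" and D: "finite D" "D \<subseteq> verts G" and w: "w \<in> D"
  shows "emeasure m (cyl G w []) = emeasure m (exit_paths G D w) +
    (\<Sum>z\<in>D. weight \<phi> (first_returns D w z) * emeasure m (cyl G z []))"
proof -
  have sets: "sets m = sets (path_borel G)" using m by (simp add: conformal_def)
  have cs: "cyl G v \<mu> \<in> sets m" for v \<mu> by (simp add: sets)
  let ?R = "\<Union>z\<in>D. \<Union>\<rho>\<in>first_returns D w z. (\<frown>) \<rho> ` cyl G z []"
  have uniq: "\<sigma> = []" if "z \<in> D" "\<rho> \<in> first_returns D w z" "\<rho> @ \<sigma> \<in> first_returns D w z'" for z z' \<rho> \<sigma>
    using first_returns_prefix_free that by blast
  have fr: "awalk w \<rho> z" if "\<rho> \<in> first_returns D w z" for \<rho> z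
    using that by (simp add: first_returns_def)
  have Rsets: "?R \<in> sets m"
    by (rule decomposition_sets[OF m D(1), where v = w]) (use cs fr uniq in auto)
  have R: "emeasure m ?R = (\<Sum>z\<in>D. weight \<phi> (first_returns D w z) * emeasure m (cyl G z []))"
    by (rule emeasure_decomposition[OF m D(1), where v = w]) (use cs fr uniq in auto)
  have eq: "cyl G w [] - ?R = {y \<in> cyl G w []. \<forall>i\<ge>1. tail G (y i) \<notin> D}" (is "_ = ?N")
  proof (intro set_eqI iffI)
    fix y assume y: "y \<in> cyl G w [] - ?R"
    then have yi: "y \<in> inf_paths G" "tail G (y 0) = w" by (auto simp: cyl_def)
    have "tail G (y i) \<notin> D" if i1: "i \<ge> 1" for i
    proof
      assume i: "tail G (y i) \<in> D"
      obtain k where k: "i = Suc k" using i1 by (cases i) auto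
      define j where "j = (LEAST j. tail G (y (Suc j)) \<in> D)"
      have j: "tail G (y (Suc j)) \<in> D"
        unfolding j_def by (rule LeastI[of _ k]) (use i k in simp)
      have nj: "tail G (y (Suc l)) \<notin> D" if "l < j" for l
        using not_less_Least that unfolding j_def by blast
      have aw: "awalk w (prefix (Suc j) y) (tail G (y (Suc j)))"
        using inf_path_prefix[OF yi(1), of "Suc j"] yi(2) by simp
      have "butlast (prefix (Suc j) y) = prefix j y"
        by (simp add: subsequence_def)
      then have "prefix (Suc j) y \<in> first_returns D w (tail G (y (Suc j)))"
        using aw nj inf_path_head[OF yi(1)] by (auto simp: first_returns_def subsequence_def)
      moreover have "suffix (Suc j) y \<in> cyl G (tail G (y (Suc j))) []"
        using suffix_inf_path[OF yi(1)] by (simp add: cyl_def)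
      moreover have "y = prefix (Suc j) y \<frown> suffix (Suc j) y" by (rule prefix_suffix)
      ultimately have "y \<in> ?R" using j by (intro UN_UN_imageI)
      then show False using y by simp
    qed
    then show "y \<in> ?N" using y by auto
  next
    fix y assume y: "y \<in> ?N"
    have False if "z \<in> D" "\<rho> \<in> first_returns D w z" "x \<in> cyl G z []" "y = \<rho> \<frown> x" for z \<rho> x
    proof -
      have "\<rho> \<noteq> []" using that by (simp add: first_returns_def)
      then have "1 \<le> length \<rho>" by (cases \<rho>) auto
      then have "tail G (y (length \<rho>)) \<notin> D" using y by blast
      then show False using that by (simp add: cyl_def)
    qed
    then have "y \<notin> ?R" by (intro notI) (elim UN_UN_imageE)
    then show "y \<in> cyl G w [] - ?R" using y by simp
  qed
  have "emeasure m ?N = emeasure m (exit_paths G D w)"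
  proof (rule emeasure_eq_AE)
    have "AE y in m. y \<notin> inf_paths G - wan G" using null_non_wandering[OF m] by (rule AE_not_in)
    then show "AE y in m. y \<in> ?N \<longleftrightarrow> y \<in> exit_paths G D w"
      by (rule AE_mp) (auto simp: exit_paths_def cyl_def wan_def intro!: AE_I2)
    show "?N \<in> sets m" using Rsets cs unfolding eq[symmetric] by auto
    show "exit_paths G D w \<in> sets m" using exit_paths_sets by (simp add: sets)
  qed
  moreover have "\<rho> \<frown> y \<in> cyl G w []" if "\<rho> \<in> first_returns D w z" "y \<in> cyl G z []" for \<rho> z y
    using conc_inf_path[OF fr[OF that(1)], of y] that(2) by (simp add: cyl_def)
  then have "?R \<subseteq> cyl G w []" by (intro subsetI) (elim UN_UN_imageE, simp)
  then have "emeasure m (cyl G w []) = emeasure m (cyl G w [] - ?R) + emeasure m ?R"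
    by (rule emeasure_Diff_plus[OF Rsets cs])
  ultimately show ?thesis unfolding eq R by simp
qed

end

section \<open>Sums of weights as powers of the weighted adjacency matrix\<close>

lemma nn_integral_count_space_infsum:
  assumes nonneg: "\<And>x. 0 \<le> f x" and fin: "(\<integral>\<^sup>+x. ennreal (f x) \<partial>count_space A) < top"
  shows "(\<integral>\<^sup>+x. ennreal (f x) \<partial>count_space A) = ennreal (\<Sum>\<^sub>\<infinity>x\<in>A. f x)"
proof -
  have "Infinite_Set_Sum.abs_summable_on f A"
    unfolding Infinite_Set_Sum.abs_summable_on_def
    using assms by (intro integrableI_nonneg) (auto simp: less_top)
  then show ?thesis
    using nonneg by (simp add: nn_integral_conv_infsetsum infsetsum_infsum)
qed

context countable_digraph
begin

lemma adj_pow_nonneg: "0 \<le> adj_pow G F \<beta> n v w"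
  by (induction n arbitrary: v) (auto simp: adj_def intro!: infsum_nonneg sum_nonneg mult_nonneg_nonneg)

lemma adj_pow_Suc_eq:
  assumes "finite (out_arcs G v)"
  shows "adj_pow G F \<beta> (Suc n) v w =
    (\<Sum>a\<in>out_arcs G v. exp (- (\<beta> * F a)) * adj_pow G F \<beta> n (head G a) w)"
proof -
  let ?S = "head G ` out_arcs G v"
  have "adj_pow G F \<beta> (Suc n) v w = (\<Sum>\<^sub>\<infinity>u\<in>?S. adj G F \<beta> v u * adj_pow G F \<beta> n u w)"
    unfolding adj_pow.simps
  proof (rule infsum_cong_neutral)
    fix u assume "u \<in> verts G - ?S"
    then have "out_arcs G v \<inter> in_arcs G u = {}" by (auto simp: in_arcs_def)
    then show "adj G F \<beta> v u * adj_pow G F \<beta> n u w = 0" by (simp add: adj_def)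
  qed auto
  also have "\<dots> = (\<Sum>u\<in>?S. adj G F \<beta> v u * adj_pow G F \<beta> n u w)"
    using assms by simp
  also have "\<dots> = (\<Sum>u\<in>?S. \<Sum>a\<in>{a. a \<in> out_arcs G v \<and> head G a = u}.
      exp (- (\<beta> * F a)) * adj_pow G F \<beta> n (head G a) w)"
  proof (rule sum.cong[OF refl])
    fix u
    have "out_arcs G v \<inter> in_arcs G u = {a. a \<in> out_arcs G v \<and> head G a = u}" by auto
    then show "adj G F \<beta> v u * adj_pow G F \<beta> n u w = (\<Sum>a\<in>{a. a \<in> out_arcs G v \<and> head G a = u}.
        exp (- (\<beta> * F a)) * adj_pow G F \<beta> n (head G a) w)"
      by (simp add: adj_def sum_distrib_right)
  qed
  also have "\<dots> = (\<Sum>a\<in>out_arcs G v. exp (- (\<beta> * F a)) * adj_pow G F \<beta> n (head G a) w)"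
    by (rule sum.image_gen[OF assms, symmetric])
  finally show ?thesis .
qed

lemma weight_walks_length:
  assumes rf: "row_finite G" and v: "v \<in> verts G"
  shows "weight (\<lambda>a. \<beta> * F a) {\<mu>. awalk v \<mu> w \<and> length \<mu> = n} = ennreal (adj_pow G F \<beta> n v w)"
  using v
proof (induction n arbitrary: v)
  case 0
  have "{\<mu>. awalk v \<mu> w \<and> length \<mu> = 0} = (if v = w then {[]} else {})"
    using 0 by (auto simp: awalk_Nil_iff)
  then show ?case by simp
next
  case (Suc n)
  let ?\<phi> = "\<lambda>a. \<beta> * F a"
  have fin: "finite (out_arcs G v)" using rf Suc.prems by (simp add: row_finite_def)
  have "\<mu> \<in> (\<Union>a\<in>out_arcs G v. (@) [a] ` {\<mu>. awalk (head G a) \<mu> w \<and> length \<mu> = n})"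
    if "awalk v \<mu> w \<and> length \<mu> = Suc n" for \<mu>
    using that by (cases \<mu>) (auto simp: awalk_Cons_iff)
  then have "{\<mu>. awalk v \<mu> w \<and> length \<mu> = Suc n} =
      (\<Union>a\<in>out_arcs G v. (@) [a] ` {\<mu>. awalk (head G a) \<mu> w \<and> length \<mu> = n})"
    by (auto simp: awalk_Cons_iff)
  moreover have "disjoint_family_on (\<lambda>a. (@) [a] ` {\<mu>. awalk (head G a) \<mu> w \<and> length \<mu> = n}) (out_arcs G v)"
    by (auto simp: disjoint_family_on_def)
  ultimately have "weight ?\<phi> {\<mu>. awalk v \<mu> w \<and> length \<mu> = Suc n} =
      (\<Sum>a\<in>out_arcs G v. walk_weight ?\<phi> [a] * weight ?\<phi> {\<mu>. awalk (head G a) \<mu> w \<and> length \<mu> = n})"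
    using fin by (simp only: weight_UN_finite weight_append_image)
  also have "\<dots> = (\<Sum>a\<in>out_arcs G v. ennreal (exp (- (\<beta> * F a)) * adj_pow G F \<beta> n (head G a) w))"
    by (intro sum.cong refl) (simp add: Suc.IH walk_weight_def ennreal_mult adj_pow_nonneg)
  also have "\<dots> = ennreal (adj_pow G F \<beta> (Suc n) v w)"
    unfolding adj_pow_Suc_eq[OF fin] by (simp add: sum_ennreal adj_pow_nonneg del: adj_pow.simps)
  finally show ?case .
qed

lemma weight_walks_suminf:
  "weight \<phi> {\<mu>. awalk v \<mu> w} = (\<Sum>n. weight \<phi> {\<mu>. awalk v \<mu> w \<and> length \<mu> = n})"
proof -
  have "{\<mu>. awalk v \<mu> w} = (\<Union>n. {\<mu>. awalk v \<mu> w \<and> length \<mu> = n})" by auto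
  then show ?thesis unfolding weight_def
    by (simp only:) (rule suminf_emeasure[symmetric], auto simp: disjoint_family_on_def)
qed

text \<open>
  A walk \<open>\<mu>\<close> from \<open>v0\<close> to \<open>v\<close> can be put in front of all walks from \<open>v\<close> to \<open>w\<close>, so the total weight
  of the latter is at most \<open>green v0 w\<close> divided by the weight of \<open>\<mu>\<close>.
\<close>
lemma transient_digraph_of_summable:
  assumes rf: "row_finite G" and v0: "v0 \<in> verts G"
    and sum: "\<forall>v\<in>verts G. summable (\<lambda>n. adj_pow G F \<beta> n v0 v) \<and> 0 < (\<Sum>n. adj_pow G F \<beta> n v0 v)"
  shows "transient_digraph G (\<lambda>a. \<beta> * F a)"
proof
  let ?\<phi> = "\<lambda>a. \<beta> * F a"
  have W: "weight ?\<phi> {\<mu>. awalk v0 \<mu> v} = ennreal (\<Sum>n. adj_pow G F \<beta> n v0 v)" if "v \<in> verts G" for v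
    unfolding weight_walks_suminf weight_walks_length[OF rf v0]
    using sum that by (simp add: suminf_ennreal2 adj_pow_nonneg)
  fix v w assume v: "v \<in> verts G" and w: "w \<in> verts G"
  have "0 < (\<Sum>n. adj_pow G F \<beta> n v0 v)" using sum v by blast
  then have "weight ?\<phi> {\<mu>. awalk v0 \<mu> v} \<noteq> 0" using W[OF v] by (simp add: ennreal_eq_0_iff)
  then obtain \<mu> where \<mu>: "awalk v0 \<mu> v" by (cases "{\<mu>. awalk v0 \<mu> v} = {}") auto
  have "walk_weight ?\<phi> \<mu> * weight ?\<phi> {\<nu>. awalk v \<nu> w} = weight ?\<phi> ((@) \<mu> ` {\<nu>. awalk v \<nu> w})"
    by (simp add: weight_append_image)
  also have "\<dots> \<le> weight ?\<phi> {\<nu>. awalk v0 \<nu> w}"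
    using awalk_appendI[OF \<mu>] by (intro weight_mono) auto
  also have "\<dots> < top" using W[OF w] by simp
  finally show "weight ?\<phi> {\<nu>. awalk v \<nu> w} < \<infinity>"
    using walk_weight_pos[of ?\<phi> \<mu>] by (auto simp: ennreal_mult_less_top)
qed (rule rf)

end

section \<open>Paths leaving the sets of an exhaustion\<close>

lemma (in wf_digraph) last_vertex_in_eq:
  assumes "suffix j y \<in> exit_paths G S (tail G (y j))" "tail G (y j) \<in> S"
  shows "last_vertex_in G S y = tail G (y j)"
proof -
  have "k \<le> j" if "tail G (y k) \<in> S" for k
  proof (rule ccontr)
    assume "\<not> k \<le> j"
    then have "tail G (suffix j y (k - j)) \<notin> S" using assms(1) by (simp add: exit_paths_def del: suffix_nth)
    then show False using that \<open>\<not> k \<le> j\<close> by simp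
  qed
  then have "(GREATEST j. tail G (y j) \<in> S) = j"
    using assms(2) by (intro Greatest_equality) auto
  then show ?thesis by (simp add: last_vertex_in_def)
qed

locale exhausted_digraph = transient_digraph G "\<lambda>a. \<beta> * F a"
  for G :: "('v, 'e) pre_digraph" and \<beta> :: real and F :: "'e \<Rightarrow> real" +
  fixes v0 :: 'v and D :: "nat \<Rightarrow> 'v set"
  assumes exhaustion: "exhaustion G v0 D"
begin

abbreviation "\<phi> \<equiv> \<lambda>a. \<beta> * F a"
abbreviation "\<B> \<equiv> bratteli G D"
abbreviation "F\<^sub>\<beta> \<equiv> bratteli_potential G F \<beta> D"
abbreviation "\<pi> \<equiv> bratteli_path G D"

lemma D_0: "D 0 = {v0}"
  and D_finite: "finite (D n)"
  and D_verts: "D n \<subseteq> verts G"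
  and D_Union: "(\<Union>n. D n) = verts G"
  and D_interior: "D n \<subseteq> interior_verts G (D (Suc n))"
  using exhaustion by (auto simp: exhaustion_def)

lemma D_step: "a \<in> arcs G \<Longrightarrow> tail G a \<in> D n \<Longrightarrow> head G a \<in> D (Suc n)"
  using subsetD[OF D_interior[of n], of "tail G a"] by (auto simp: interior_verts_def image_subset_iff)

lemma D_mono: "m \<le> n \<Longrightarrow> D m \<subseteq> D n"
  by (rule lift_Suc_mono_le[of D]) (use D_interior in \<open>auto simp: interior_verts_def\<close>)

lemma v0_vert: "v0 \<in> verts G"
  using D_0 D_verts[of 0] by auto

lemma exit_vertsI: "y \<in> exit_paths G (D n) w \<Longrightarrow> w \<in> D n \<Longrightarrow> w \<in> exit_verts G (D n)"
  by (auto simp: exit_verts_def)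

text \<open>
  All arrows starting in \<open>D n\<close> end in \<open>D (Suc n)\<close>, so a path that starts in \<open>D n\<close> is still in
  \<open>D (Suc n)\<close> after one step.  In particular the level of a path in \<open>\<Omega>\<close> below is unique.
\<close>
lemma exit_vert_new:
  assumes y: "y \<in> exit_paths G (D (Suc n)) w"
  shows "w \<notin> D n"
proof
  assume "w \<in> D n"
  have p: "y \<in> inf_paths G" "tail G (y 0) = w" using y by (auto simp: exit_paths_def wan_def)
  have "head G (y 0) \<in> D (Suc n)"
    using D_step[of "y 0" n] inf_path_arc[OF p(1)] p(2) \<open>w \<in> D n\<close> by simp
  then show False using y inf_path_head[OF p(1), of 0] by (auto simp: exit_paths_def)
qed

text \<open>
  On these paths \<open>\<pi>\<close> forgets nothing but the choice of link paths.  In general it also forgets the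
  initial segment up to the last visit to the set of the start level.
\<close>
definition \<Omega> :: "(nat \<Rightarrow> 'e) set" where
  "\<Omega> = (\<Union>n. \<Union>w\<in>D n. exit_paths G (D n) w)"

lemma \<Omega>I: "y \<in> exit_paths G (D n) w \<Longrightarrow> w \<in> D n \<Longrightarrow> y \<in> \<Omega>"
  by (auto simp: \<Omega>_def)

lemma \<Omega>E:
  assumes "y \<in> \<Omega>"
  obtains n w where "y \<in> exit_paths G (D n) w" "w \<in> D n"
  using assms by (auto simp: \<Omega>_def)

lemma \<Omega>_sets: "\<Omega> \<in> sets (path_borel G)"
  unfolding \<Omega>_def using D_finite exit_paths_sets by (intro sets.countable_UN sets.finite_UN) auto

lemma start_level_eq:
  assumes y: "y \<in> exit_paths G (D n) w" and w: "w \<in> D n"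
  shows "start_level G D y = n"
  unfolding start_level_def
proof (rule the_equality)
  have t: "tail G (y 0) = w" "\<And>i. i \<ge> 1 \<Longrightarrow> tail G (y i) \<notin> D n" using y by (auto simp: exit_paths_def)
  have "tail G (y i) \<notin> D (n - 1)" if "n \<noteq> 0" for i
  proof (cases i)
    case 0
    then show ?thesis using exit_vert_new[of y "n - 1" w] y t that by simp
  next
    case (Suc j)
    then show ?thesis using t(2)[of i] D_mono[of "n - 1" n] by auto
  qed
  then show "(\<forall>i. tail G (y i) \<notin> (if n = 0 then {} else D (n - 1))) \<and> (\<exists>j. tail G (y j) \<in> D n)"
    using t(1) w by auto
  fix k assume k: "(\<forall>i. tail G (y i) \<notin> (if k = 0 then {} else D (k - 1))) \<and> (\<exists>j. tail G (y j) \<in> D k)"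
  show "k = n"
  proof (rule linorder_cases)
    assume "k < n"
    then have "D k \<subseteq> D (n - 1)" by (intro D_mono) simp
    then show ?thesis using k \<open>k < n\<close> \<open>\<And>i. n \<noteq> 0 \<Longrightarrow> tail G (y i) \<notin> D (n - 1)\<close> by auto
  next
    assume "n < k"
    then have "w \<in> D (k - 1)" using w subsetD[OF D_mono[of n "k - 1"]] \<open>n < k\<close> by simp
    then show ?thesis using k t(1) \<open>n < k\<close> by (metis not_less_zero)
  qed
qed

abbreviation last_at :: "nat \<Rightarrow> (nat \<Rightarrow> 'e) \<Rightarrow> 'v" where
  "last_at n y \<equiv> last_vertex_in G (D n) y"

lemma last_at_visit:
  assumes y: "y \<in> wan G" and i: "tail G (y i) \<in> D n"
  obtains j where "last_at n y = tail G (y j)" "tail G (y j) \<in> D n"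
    "suffix j y \<in> exit_paths G (D n) (tail G (y j))"
proof -
  obtain j where "tail G (y j) \<in> D n \<and> suffix j y \<in> exit_paths G (D n) (tail G (y j))"
    using ex_last_visit[OF y D_finite D_verts i] by blast
  then show ?thesis using that last_vertex_in_eq by blast
qed

lemma last_at_suffix:
  assumes y: "y \<in> wan G" and i: "tail G (y (k + i)) \<in> D n"
  shows "last_at n (suffix k y) = last_at n y"
proof -
  have "tail G (suffix k y i) \<in> D n" using i by simp
  from last_at_visit[OF wan_suffix[OF y] this] obtain j where
    j: "last_at n (suffix k y) = tail G (suffix k y j)" "tail G (suffix k y j) \<in> D n"
      "suffix j (suffix k y) \<in> exit_paths G (D n) (tail G (suffix k y j))" .
  then show ?thesis using last_vertex_in_eq[of "k + j" y "D n"] by simp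
qed

lemma bratteli_path_eq:
  assumes "y \<in> exit_paths G (D n) w" "w \<in> D n"
  shows "\<pi> y i = ((n + i, last_at (n + i) y), (n + Suc i, last_at (n + Suc i) y))"
  unfolding bratteli_path_def start_level_eq[OF assms] Let_def ..

text \<open>
  The path is cut at its last visit to \<open>D (Suc n)\<close>.  This visit is outside \<open>D n\<close> by \<open>exit_vert_new\<close>,
  so it comes after the start.
\<close>
lemma exit_path_decompose:
  assumes y: "y \<in> exit_paths G (D n) w" and w: "w \<in> D n"
  obtains \<mu> z where "\<mu> \<in> link_paths G (D n) w (last_at (Suc n) y)"
    "z \<in> exit_paths G (D (Suc n)) (last_at (Suc n) y)" "last_at (Suc n) y \<in> D (Suc n)" "y = \<mu> \<frown> z"
proof -
  have p: "y \<in> wan G" "y \<in> inf_paths G" "tail G (y 0) = w"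
    using y by (auto simp: exit_paths_def wan_def)
  have "tail G (y 0) \<in> D (Suc n)" using w p(3) D_mono[of n "Suc n"] by auto
  from last_at_visit[OF p(1) this] obtain j where
    j: "last_at (Suc n) y = tail G (y j)" "tail G (y j) \<in> D (Suc n)"
      "suffix j y \<in> exit_paths G (D (Suc n)) (tail G (y j))" .
  have "tail G (y j) \<notin> D n" using exit_vert_new j(3) by blast
  moreover have "awalk w (prefix j y) (tail G (y j))"
    using inf_path_prefix[OF p(2), of j] p(3) by simp
  moreover have "head G (y i) \<notin> D n" for i
    using y inf_path_head[OF p(2), of i] by (auto simp: exit_paths_def)
  ultimately have "prefix j y \<in> link_paths G (D n) w (tail G (y j))"
    using w by (auto simp: link_paths_def subsequence_def)
  then show ?thesis using that[of "prefix j y" "suffix j y"] j by simp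
qed

lemma link_conc_exit_path:
  assumes \<mu>: "\<mu> \<in> link_paths G (D n) w u" and z: "z \<in> exit_paths G (D (Suc n)) u"
  shows "\<mu> \<frown> z \<in> exit_paths G (D n) w"
proof -
  have m: "awalk w \<mu> u" "w \<in> D n" "\<And>a. a \<in> set \<mu> \<Longrightarrow> head G a \<notin> D n"
    using \<mu> by (auto simp: link_paths_def)
  have zz: "z \<in> wan G" "z \<in> inf_paths G" "tail G (z 0) = u" "\<And>i. i \<ge> 1 \<Longrightarrow> tail G (z i) \<notin> D (Suc n)"
    using z by (auto simp: exit_paths_def wan_def)
  have p: "\<mu> \<frown> z \<in> inf_paths G" "tail G ((\<mu> \<frown> z) 0) = w" using conc_inf_path[OF m(1) zz(2,3)] by auto
  have "tail G ((\<mu> \<frown> z) (Suc i)) \<notin> D n" for i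
  proof (cases "i < length \<mu>")
    case True
    then show ?thesis using inf_path_head[OF p(1), of i] m(3)[of "\<mu> ! i"] by simp
  next
    case False
    then have "tail G ((\<mu> \<frown> z) (Suc i)) = tail G (z (Suc i - length \<mu>))" by simp
    moreover have "Suc i - length \<mu> \<ge> 1" using False by simp
    ultimately show ?thesis using zz(4) D_mono[of n "Suc n"] by auto
  qed
  then have "tail G ((\<mu> \<frown> z) i) \<notin> D n" if "i \<ge> 1" for i
    using that by (cases i) auto
  then show ?thesis
    using p wan_conc[OF m(1) zz(3,2)] zz(1) by (simp add: exit_paths_def)
qed

lemma last_at_conc:
  assumes "awalk v \<mu> u" "z \<in> exit_paths G (D n) u" "u \<in> D n" "n \<le> m"
  shows "last_at m (\<mu> \<frown> z) = last_at m z"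
proof -
  have z: "z \<in> wan G" "z \<in> inf_paths G" "tail G (z 0) = u"
    using assms(2) by (auto simp: exit_paths_def wan_def)
  have "u \<in> D m" using assms D_mono by blast
  moreover have "suffix (length \<mu>) (\<mu> \<frown> z) = z" by (simp add: fun_eq_iff)
  moreover have "\<mu> \<frown> z \<in> wan G" using wan_conc[OF assms(1) z(3,2)] z(1) by simp
  ultimately show ?thesis
    using last_at_suffix[of "\<mu> \<frown> z" "length \<mu>" 0 m] z by simp
qed

lemma last_at_start:
  assumes "y \<in> exit_paths G (D n) w" "w \<in> D n"
  shows "last_at n y = w"
  using last_vertex_in_eq[of 0 y "D n"] assms by (simp add: exit_paths_def)

lemma bratteli_path_conc:
  assumes \<mu>: "\<mu> \<in> link_paths G (D n) w u" and z: "z \<in> exit_paths G (D (Suc n)) u" and u: "u \<in> D (Suc n)"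
  shows "\<pi> (\<mu> \<frown> z) = [((n, w), (Suc n, u))] \<frown> \<pi> z"
proof
  fix i
  have m: "awalk w \<mu> u" "w \<in> D n" using \<mu> by (auto simp: link_paths_def)
  note y = link_conc_exit_path[OF \<mu> z]
  show "\<pi> (\<mu> \<frown> z) i = ([((n, w), (Suc n, u))] \<frown> \<pi> z) i"
  proof (cases i)
    case 0
    then show ?thesis
      unfolding bratteli_path_eq[OF y m(2)]
      using last_at_start[OF y m(2)] last_at_conc[OF m(1) z u, of "Suc n"] last_at_start[OF z u] by simp
  next
    case (Suc j)
    then show ?thesis
      unfolding bratteli_path_eq[OF y m(2)]
      using last_at_conc[OF m(1) z u] bratteli_path_eq[OF z u, of j] by (simp add: conc_def)
  qed
qed

section \<open>The Bratteli diagram\<close>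

lemma bratteli_verts: "(n, w) \<in> verts \<B> \<longleftrightarrow> w \<in> exit_verts G (D n)"
  and bratteli_arcs: "((n, v), x) \<in> arcs \<B> \<longleftrightarrow> (\<exists>w. x = (Suc n, w) \<and> v \<in> exit_verts G (D n) \<and>
        w \<in> exit_verts G (D (Suc n)) \<and> link_paths G (D n) v w \<noteq> {})"
  and bratteli_tail [simp]: "tail \<B> = fst"
  and bratteli_head [simp]: "head \<B> = snd"
  by (auto simp: bratteli_def)

lemma bratteli_arcE:
  assumes "a \<in> arcs \<B>"
  obtains n v w where "a = ((n, v), (Suc n, w))" "v \<in> exit_verts G (D n)"
    "w \<in> exit_verts G (D (Suc n))" "link_paths G (D n) v w \<noteq> {}"
  using assms by (auto simp: bratteli_def)

lemma exit_verts_subset: "exit_verts G (D n) \<subseteq> D n"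
  by (auto simp: exit_verts_def)

sublocale B: countable_digraph \<B>
proof
  fix a assume "a \<in> arcs \<B>"
  then show "tail \<B> a \<in> verts \<B>" "head \<B> a \<in> verts \<B>"
    by (auto elim!: bratteli_arcE simp: bratteli_verts)
next
  have "verts \<B> \<subseteq> UNIV \<times> verts G"
    using D_verts exit_verts_subset by (auto simp: bratteli_def)
  then show c: "countable (verts \<B>)"
    by (rule countable_subset) (intro countable_SIGMA countable_verts countableI_type)
  have "arcs \<B> \<subseteq> verts \<B> \<times> verts \<B>"
    by (auto elim!: bratteli_arcE simp: bratteli_verts)
  then show "countable (arcs \<B>)"
    by (rule countable_subset) (intro countable_SIGMA c)
qed

lemma bratteli_row_finite: "finite (out_arcs \<B> x)"
proof -
  have "out_arcs \<B> x \<subseteq> (\<lambda>w. (x, (Suc (fst x), w))) ` D (Suc (fst x))"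
  proof
    fix a assume "a \<in> out_arcs \<B> x"
    then have a: "a \<in> arcs \<B>" "fst a = x" by simp_all
    obtain n v w where "a = ((n, v), (Suc n, w))" "w \<in> exit_verts G (D (Suc n))"
      using a(1) by (rule bratteli_arcE)
    then show "a \<in> (\<lambda>w. (x, (Suc (fst x), w))) ` D (Suc (fst x))"
      using a(2) exit_verts_subset[of "Suc n"] by auto
  qed
  then show ?thesis using D_finite by (meson finite_imageI finite_subset)
qed

lemma bratteli_path_first:
  assumes "y \<in> exit_paths G (D n) w" "w \<in> D n"
  shows "fst (\<pi> y 0) = (n, w)"
  using bratteli_path_eq[OF assms, of 0] last_at_start[OF assms] by simp

lemma bratteli_path_arc_0:
  assumes y: "y \<in> exit_paths G (D n) w" and w: "w \<in> D n"
  shows "\<pi> y 0 \<in> arcs \<B>"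
proof -
  from exit_path_decompose[OF y w] obtain \<mu> z where
    "\<mu> \<in> link_paths G (D n) w (last_at (Suc n) y)" "z \<in> exit_paths G (D (Suc n)) (last_at (Suc n) y)"
    "last_at (Suc n) y \<in> D (Suc n)" .
  then show ?thesis
    using bratteli_path_eq[OF y w, of 0] last_at_start[OF y w] exit_vertsI[OF y w] exit_vertsI
    by (auto simp: bratteli_arcs)
qed

lemma bratteli_path_in_paths:
  assumes "y \<in> \<Omega>"
  shows "\<pi> y \<in> inf_paths \<B>"
proof -
  have arc: "\<pi> y i \<in> arcs \<B>" if "y \<in> exit_paths G (D n) w" "w \<in> D n" for i n w y
    using that
  proof (induction i arbitrary: n w y)
    case 0
    then show ?case by (rule bratteli_path_arc_0)
  next
    case (Suc i)
    from exit_path_decompose[OF Suc.prems] obtain \<mu> z where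
      *: "\<mu> \<in> link_paths G (D n) w (last_at (Suc n) y)" "z \<in> exit_paths G (D (Suc n)) (last_at (Suc n) y)"
      "last_at (Suc n) y \<in> D (Suc n)" "y = \<mu> \<frown> z" .
    then have "\<pi> y (Suc i) = \<pi> z i"
      using bratteli_path_conc[OF *(1,2,3)] by (simp add: conc_def)
    then show ?case using Suc.IH[OF *(2,3)] by simp
  qed
  obtain n w where y: "y \<in> exit_paths G (D n) w" "w \<in> D n" using assms by (rule \<Omega>E)
  show ?thesis
    unfolding inf_paths_def using arc[OF y] by (simp add: bratteli_path_eq[OF y])
qed

text \<open>
  The reason for conformality on the Bratteli diagram: an arrow in front of the image corresponds
  to all link paths of that arrow in front of the path.  The union over the singleton gives the
  right-hand side the shape required by \<open>emeasure_decomposition\<close>.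
\<close>
lemma bratteli_path_preimage_conc:
  assumes a: "((n, w), (Suc n, u)) \<in> arcs \<B>" and C: "C \<subseteq> cyl \<B> (Suc n, u) []"
  shows "{y \<in> \<Omega>. \<pi> y \<in> (\<frown>) [((n, w), (Suc n, u))] ` C} =
    (\<Union>t\<in>{u}. \<Union>\<mu>\<in>link_paths G (D n) w t. (\<frown>) \<mu> ` {z \<in> \<Omega>. \<pi> z \<in> C})" (is "?L = ?R")
proof (intro set_eqI iffI)
  fix y assume "y \<in> ?L"
  then obtain c where y: "y \<in> \<Omega>" "\<pi> y = [((n, w), (Suc n, u))] \<frown> c" "c \<in> C" by blast
  obtain n' w' where yn: "y \<in> exit_paths G (D n') w'" "w' \<in> D n'" using y(1) by (rule \<Omega>E)
  have eq: "\<pi> y 0 = ((n, w), (Suc n, u))" unfolding y(2) by simp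
  then have n: "n' = n" "w' = w" "last_at (Suc n) y = u"
    using bratteli_path_first[OF yn] bratteli_path_eq[OF yn, of 0] by auto
  from exit_path_decompose[OF yn[unfolded n]] obtain \<mu> z where
    *: "\<mu> \<in> link_paths G (D n) w u" "z \<in> exit_paths G (D (Suc n)) u" "u \<in> D (Suc n)" "y = \<mu> \<frown> z"
    unfolding n .
  have "[((n, w), (Suc n, u))] \<frown> \<pi> z = [((n, w), (Suc n, u))] \<frown> c"
    using bratteli_path_conc[OF *(1,2,3)] *(4) y(2) by simp
  then have "\<pi> z = c" using conc_eq_concD by fastforce
  then show "y \<in> ?R"
    using * y(3) \<Omega>I by (intro UN_UN_imageI[where f = "(\<frown>)" and z = u, OF _ _ _ *(4)]) auto
next
  fix y assume "y \<in> ?R"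
  then obtain \<mu> z where y: "\<mu> \<in> link_paths G (D n) w u" "z \<in> \<Omega>" "\<pi> z \<in> C" "y = \<mu> \<frown> z"
    by (elim UN_UN_imageE) auto
  obtain n' w' where zn: "z \<in> exit_paths G (D n') w'" "w' \<in> D n'" using y(2) by (rule \<Omega>E)
  have "fst (\<pi> z 0) = (Suc n, u)" using y(3) C by (auto simp: cyl_def)
  then have n: "n' = Suc n" "w' = u" using bratteli_path_first[OF zn] by auto
  have "y \<in> exit_paths G (D n) w" using link_conc_exit_path[OF y(1)] zn n y(4) by simp
  moreover have "w \<in> D n" using y(1) by (simp add: link_paths_def)
  ultimately have "y \<in> \<Omega>" by (rule \<Omega>I)
  then show "y \<in> ?L"
    using bratteli_path_conc[OF y(1)] zn n y by auto
qed

lemma bratteli_preimage_vertex: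
  "{y \<in> \<Omega>. \<pi> y \<in> cyl \<B> (n, w) []} = (if w \<in> D n then exit_paths G (D n) w else {})"
proof -
  have "\<pi> y \<in> cyl \<B> (n, w) [] \<longleftrightarrow> n' = n \<and> w' = w" if "y \<in> exit_paths G (D n') w'" "w' \<in> D n'" for y n' w'
    using bratteli_path_first[OF that] bratteli_path_in_paths[OF \<Omega>I[OF that]] by (auto simp: cyl_def)
  then show ?thesis by (auto simp: \<Omega>_def)
qed

lemma bratteli_preimage_sets:
  assumes "B.awalk x \<nu> x'"
  shows "{y \<in> \<Omega>. \<pi> y \<in> cyl \<B> x \<nu>} \<in> sets (path_borel G)"
  using assms
proof (induction \<nu> arbitrary: x)
  case Nil
  obtain n w where "x = (n, w)" by (cases x)
  then show ?case using bratteli_preimage_vertex[of n w] exit_paths_sets by simp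
next
  case (Cons a \<nu>)
  then have a: "a \<in> arcs \<B>" "x = fst a" "B.awalk (snd a) \<nu> x'" by (auto simp: B.awalk_Cons_iff)
  obtain n v w where nvw: "a = ((n, v), (Suc n, w))" "v \<in> exit_verts G (D n)"
    "w \<in> exit_verts G (D (Suc n))" using a(1) by (rule bratteli_arcE)
  let ?C = "cyl \<B> (Suc n, w) \<nu>"
  have sub: "?C \<subseteq> cyl \<B> (Suc n, w) []" by (auto simp: cyl_def)
  have aw: "B.awalk (n, v) [a] (Suc n, w)" "B.awalk (Suc n, w) \<nu> x'"
    using B.arc_implies_awalk[OF a(1)] a(3) nvw(1) by auto
  have "cyl \<B> x (a # \<nu>) = (\<frown>) [a] ` ?C"
    using B.cyl_conc_cyl[OF aw] a(2) nvw(1) by simp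
  then have eq: "{y \<in> \<Omega>. \<pi> y \<in> cyl \<B> x (a # \<nu>)} =
      (\<Union>t\<in>{w}. \<Union>\<mu>\<in>link_paths G (D n) v t. (\<frown>) \<mu> ` {z \<in> \<Omega>. \<pi> z \<in> ?C})"
    using bratteli_path_preimage_conc[of n v w, OF _ sub] a(1) nvw(1) by simp
  have "{z \<in> \<Omega>. \<pi> z \<in> ?C} \<subseteq> {z \<in> \<Omega>. \<pi> z \<in> cyl \<B> (Suc n, w) []}" using sub by blast
  then have "{z \<in> \<Omega>. \<pi> z \<in> ?C} \<subseteq> cyl G w []"
    unfolding bratteli_preimage_vertex using exit_paths_subset by (auto split: if_splits)
  moreover have "{z \<in> \<Omega>. \<pi> z \<in> ?C} \<in> sets (path_borel G)"
    using Cons.IH[OF aw(2)] .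
  ultimately show ?case
    unfolding eq using conc_UN_sets[of "link_paths G (D n) v w" v w]
    by (simp add: link_paths_def)
qed

lemma measurable_bratteli_path: "\<pi> \<in> restrict_space (path_borel G) \<Omega> \<rightarrow>\<^sub>M path_borel \<B>"
proof (rule measurable_sigma_sets[OF B.sets_path_borel_cylinders cylinders_subset])
  have sub: "\<Omega> \<subseteq> inf_paths G" using sets.sets_into_space[OF \<Omega>_sets] by simp
  then have sp: "space (restrict_space (path_borel G) \<Omega>) = \<Omega>"
    by (auto simp: space_restrict_space)
  show "\<pi> \<in> space (restrict_space (path_borel G) \<Omega>) \<rightarrow> inf_paths \<B>"
    unfolding sp using bratteli_path_in_paths by blast
  fix C assume "C \<in> cylinders \<B>"
  then consider "C = {}" | x \<nu> x' where "C = cyl \<B> x \<nu>" "B.awalk x \<nu> x'"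
    unfolding cylinders_def by blast
  then show "\<pi> -` C \<inter> space (restrict_space (path_borel G) \<Omega>) \<in> sets (restrict_space (path_borel G) \<Omega>)"
  proof cases
    case (2 x \<nu> x')
    have "\<pi> -` C \<inter> \<Omega> = {y \<in> \<Omega>. \<pi> y \<in> cyl \<B> x \<nu>}" using 2 by auto
    then show ?thesis
      unfolding sp using bratteli_preimage_sets[OF 2(2)] \<Omega>_sets
      by (subst sets_restrict_space_iff) (auto simp: Int_absorb2[OF sub])
  qed simp
qed

lemma weight_link:
  assumes "((n, v), (Suc n, w)) \<in> arcs \<B>"
  shows "weight \<phi> (link_paths G (D n) v w) = walk_weight F\<^sub>\<beta> [((n, v), (Suc n, w))]"
proof -
  let ?L = "link_paths G (D n) v w" and ?f = "\<lambda>\<mu>. exp (- \<beta> * sum_list (map F \<mu>))"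
  have L: "?L \<noteq> {}" and v: "v \<in> verts G" and w: "w \<in> verts G"
    using assms D_verts exit_verts_subset by (auto simp: bratteli_arcs)
  have ww: "walk_weight \<phi> \<mu> = ennreal (?f \<mu>)" for \<mu>
    by (simp add: walk_weight_def sum_list_const_mult)
  have "weight \<phi> ?L \<le> green v w"
    unfolding green_def by (rule weight_mono) (auto simp: link_paths_def)
  then have fin: "weight \<phi> ?L < top" using green_finite[OF v w] by (rule le_less_trans)
  have eq: "weight \<phi> ?L = ennreal (\<Sum>\<^sub>\<infinity>\<mu>\<in>?L. ?f \<mu>)"
    using fin unfolding weight_eq ww by (intro nn_integral_count_space_infsum) auto
  obtain \<mu> where "\<mu> \<in> ?L" using L by blast
  then have "0 < weight \<phi> ?L" using weight_ge[of \<mu> ?L \<phi>] walk_weight_pos[of \<phi> \<mu>] by (meson less_le_trans)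
  then have "0 < (\<Sum>\<^sub>\<infinity>\<mu>\<in>?L. ?f \<mu>)" unfolding eq by simp
  then show ?thesis unfolding eq by (simp add: walk_weight_def bratteli_potential_def)
qed

end

section \<open>Gluing link paths\<close>

text \<open>
  The concatenation of infinitely many non-empty words.  An empty first word is excluded by a
  default value to make the recursion terminate.
\<close>
function glue :: "(nat \<Rightarrow> 'a list) \<Rightarrow> nat \<Rightarrow> 'a" where
  "glue \<mu> i = (if \<mu> 0 = [] then undefined else if i < length (\<mu> 0) then \<mu> 0 ! i
    else glue (\<lambda>n. \<mu> (Suc n)) (i - length (\<mu> 0)))"
  by auto
termination
proof (relation "Wellfounded.measure snd")
  fix \<mu> :: "nat \<Rightarrow> 'a list" and i assume "\<mu> 0 \<noteq> []" "\<not> i < length (\<mu> 0)"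
  then have "0 < length (\<mu> 0)" "length (\<mu> 0) \<le> i" by simp_all
  then have "i - length (\<mu> 0) < i" by linarith
  then show "((\<lambda>n. \<mu> (Suc n), i - length (\<mu> 0)), \<mu>, i) \<in> Wellfounded.measure snd" by simp
qed simp

declare glue.simps [simp del]

lemma glue_conc: "\<mu> 0 \<noteq> [] \<Longrightarrow> glue \<mu> = \<mu> 0 \<frown> glue (\<lambda>n. \<mu> (Suc n))"
  by (rule ext) (subst glue.simps, simp add: conc_def)

lemma measurable_glue:
  assumes "\<And>n. (\<lambda>x. f x n) \<in> M \<rightarrow>\<^sub>M count_space UNIV"
  shows "(\<lambda>x. glue (f x) i) \<in> M \<rightarrow>\<^sub>M count_space UNIV"
  using assms
proof (induction i arbitrary: f rule: less_induct)
  case (less i)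
  have f0: "(\<lambda>x. f x 0) \<in> M \<rightarrow>\<^sub>M count_space UNIV" by (rule less.prems)
  have tail: "(\<lambda>x. glue (\<lambda>n. f x (Suc n)) (i - l)) \<in> M \<rightarrow>\<^sub>M count_space UNIV" if "0 < l" "l \<le> i" for l
    using that less.prems by (intro less.IH) auto
  define g where "g l x = (if l = 0 then undefined else if i < l then f x 0 ! i
      else glue (\<lambda>n. f x (Suc n)) (i - l))" for l x
  have "g l \<in> M \<rightarrow>\<^sub>M count_space UNIV" for l
  proof -
    have "(\<lambda>x. f x 0 ! i) \<in> M \<rightarrow>\<^sub>M count_space UNIV"
      by (rule measurable_compose[OF f0]) simp
    then show ?thesis using tail[of l] by (cases "l = 0"; cases "i < l") (simp_all add: g_def[abs_def])
  qed
  moreover have "(\<lambda>x. length (f x 0)) \<in> M \<rightarrow>\<^sub>M count_space UNIV"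
    by (rule measurable_compose[OF f0]) simp
  ultimately have "(\<lambda>x. g (length (f x 0)) x) \<in> M \<rightarrow>\<^sub>M count_space UNIV"
    by (rule measurable_compose_countable)
  moreover have "glue (f x) i = g (length (f x 0)) x" for x
    by (subst glue.simps) (simp add: g_def)
  ultimately show ?case by simp
qed

context exhausted_digraph
begin

text \<open>
  Replacing every arrow by one of its link paths produces a preimage under \<open>\<pi>\<close>.  In the proof, \<open>z n\<close>
  is the path glued from the link paths of the arrows number \<open>n, n + 1, \<dots>\<close>; it starts at the vertex
  \<open>v n\<close> on level \<open>k + n\<close> and never returns to \<open>D (k + n)\<close>.
\<close>
lemma bratteli_path_glue:
  assumes x: "x \<in> inf_paths \<B>"
    and sel: "\<And>n v w. ((n, v), (Suc n, w)) \<in> arcs \<B> \<Longrightarrow> sel ((n, v), (Suc n, w)) \<in> link_paths G (D n) v w"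
  shows "glue (\<lambda>i. sel (x i)) \<in> \<Omega>" and "\<pi> (glue (\<lambda>i. sel (x i))) = x"
proof -
  obtain k w0 where kw: "fst (x 0) = (k, w0)" by (cases "fst (x 0)")
  have "\<exists>v w. x i = ((k + i, v), (Suc (k + i), w))" for i
  proof (induction i)
    case 0
    have "x 0 \<in> arcs \<B>" using x by (auto simp: inf_paths_def)
    then show ?case using kw by (auto elim!: bratteli_arcE)
  next
    case (Suc i)
    have "x (Suc i) \<in> arcs \<B>" "snd (x i) = fst (x (Suc i))" using x by (auto simp: inf_paths_def)
    then show ?case using Suc by (auto elim!: bratteli_arcE)
  qed
  then obtain v u where vu: "\<And>i. x i = ((k + i, v i), (Suc (k + i), u i))" by metis
  have u: "u i = v (Suc i)" for i
  proof -
    have "snd (x i) = fst (x (Suc i))" using x by (simp add: inf_paths_def)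
    then show ?thesis unfolding vu by simp
  qed
  have arc: "((k + i, v i), (Suc (k + i), v (Suc i))) \<in> arcs \<B>" for i
  proof -
    have "x i \<in> arcs \<B>" using x by (simp add: inf_paths_def)
    then show ?thesis unfolding vu u .
  qed
  define \<mu> where "\<mu> i = sel (x i)" for i
  have \<mu>: "\<mu> i \<in> link_paths G (D (k + i)) (v i) (v (Suc i))" for i
    unfolding \<mu>_def vu u by (rule sel[OF arc])
  have link: "awalk (v i) (\<mu> i) (v (Suc i))" "\<mu> i \<noteq> []" "\<And>a. a \<in> set (\<mu> i) \<Longrightarrow> head G a \<notin> D (k + i)" for i
    using \<mu>[of i] by (auto simp: link_paths_def awalk_Nil_iff)
  have vD: "v i \<in> D (k + i)" for i
    using \<mu>[of i] by (simp add: link_paths_def)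
  define z where "z n = glue (\<lambda>i. \<mu> (n + i))" for n
  have z: "z n = \<mu> n \<frown> z (Suc n)" for n
    unfolding z_def using glue_conc[of "\<lambda>i. \<mu> (n + i)"] link(2)[of n] by simp
  have z_tail0: "tail G (z n 0) = v n" for n
    using link(1,2)[of n] z[of n] by (cases "\<mu> n") (auto simp: awalk_Cons_iff)
  have z_step: "z n i \<in> arcs G \<and> head G (z n i) = tail G (z n (Suc i)) \<and> head G (z n i) \<notin> D (k + n)" for n i
  proof (induction i arbitrary: n rule: less_induct)
    case (less i)
    show ?case
    proof (cases "i < length (\<mu> n)")
      case True
      then have zi: "z n i = \<mu> n ! i" and "\<mu> n ! i \<in> set (\<mu> n)" using z[of n] by simp_all
      then have 1: "z n i \<in> arcs G" "head G (z n i) \<notin> D (k + n)"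
        using link(1)[of n] link(3)[of "z n i" n] by (auto simp: awalk_def)
      have "head G (z n i) = tail G (z n (Suc i))"
      proof (cases "Suc i < length (\<mu> n)")
        case True
        then show ?thesis using awalk_nth_consecutive[OF link(1) True] zi z[of n] by simp
      next
        case False
        then have "Suc i = length (\<mu> n)" using \<open>i < length (\<mu> n)\<close> by simp
        then have "\<mu> n ! i = last (\<mu> n)" "z n (Suc i) = z (Suc n) 0"
          using z[of n] link(2)[of n] by (simp_all add: last_conv_nth flip: \<open>Suc i = length (\<mu> n)\<close>)
        moreover have "head G (last (\<mu> n)) = v (Suc n)"
          using link(1,2)[of n] by (auto simp: awalk_verts_conv elim!: awalkE')
        ultimately show ?thesis using zi z_tail0 by simp
      qed
      with 1 show ?thesis by simp
    next
      case False
      let ?j = "i - length (\<mu> n)"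
      have "?j < i" using False link(2)[of n] by (cases "\<mu> n") auto
      from less.IH[OF this, of "Suc n"] have IH: "z (Suc n) ?j \<in> arcs G"
        "head G (z (Suc n) ?j) = tail G (z (Suc n) (Suc ?j))" "head G (z (Suc n) ?j) \<notin> D (k + Suc n)"
        by auto
      have "z n i = z (Suc n) ?j" "z n (Suc i) = z (Suc n) (Suc ?j)"
        using z[of n] False by (simp_all add: Suc_diff_le)
      then show ?thesis using IH D_mono[of "k + n" "k + Suc n"] by auto
    qed
  qed
  have z_path: "z n \<in> inf_paths G" for n
    using z_step by (auto simp: inf_paths_def)
  have z_out: "tail G (z n i) \<notin> D (k + n)" if i1: "i \<ge> 1" for n i
  proof -
    obtain j where "i = Suc j" using i1 by (cases i) auto
    then show ?thesis using z_step[of n j] by metis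
  qed
  have z_suffix: "\<exists>l. suffix l (z 0) = z n" for n
  proof (induction n)
    case (Suc n)
    then obtain l where l: "suffix l (z 0) = z n" by blast
    have "suffix (length (\<mu> n)) (z n) = z (Suc n)" using z[of n] by (simp add: fun_eq_iff)
    then have "suffix (l + length (\<mu> n)) (z 0) = z (Suc n)" using l by (metis suffix_suffix)
    then show ?case by blast
  qed (metis suffix_0)
  have "z 0 \<in> wan G"
    unfolding wan_eq
  proof (intro CollectI conjI ballI z_path)
    fix a assume "a \<in> verts G"
    then obtain n where n: "a \<in> D n" using D_Union by auto
    obtain l where l: "suffix l (z 0) = z n" using z_suffix by blast
    have "tail G (z 0 i) \<noteq> a" if "i \<ge> Suc l" for i
    proof -
      have "z 0 i = suffix l (z 0) (i - l)" using that by simp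
      then have "z 0 i = z n (i - l)" unfolding l .
      moreover have "i - l \<ge> 1" using that by simp
      ultimately have "tail G (z 0 i) \<notin> D (k + n)" using z_out by simp
      then show ?thesis using n D_mono[of n "k + n"] by auto
    qed
    then show "\<exists>N. \<forall>i\<ge>N. tail G (z 0 i) \<noteq> a" by blast
  qed
  then have z_wan: "z n \<in> wan G" for n
    using z_suffix[of n] wan_suffix by metis
  have z_exit: "z n \<in> exit_paths G (D (k + n)) (v n)" for n
    using z_wan z_tail0 z_out by (simp add: exit_paths_def)
  have "\<pi> (z n) i = x (n + i)" for n i
  proof (induction i arbitrary: n)
    case 0
    have "\<pi> (z n) = [((k + n, v n), (Suc (k + n), v (Suc n)))] \<frown> \<pi> (z (Suc n))"
      using bratteli_path_conc[OF \<mu>[of n]] z_exit[of "Suc n"] vD[of "Suc n"] z[of n] by simp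
    then show ?case using vu[of n] u[of n] by simp
  next
    case (Suc i)
    have "\<pi> (z n) = [((k + n, v n), (Suc (k + n), v (Suc n)))] \<frown> \<pi> (z (Suc n))"
      using bratteli_path_conc[OF \<mu>[of n]] z_exit[of "Suc n"] vD[of "Suc n"] z[of n] by simp
    then have "\<pi> (z n) (Suc i) = \<pi> (z (Suc n)) i" by (simp add: conc_def)
    then show ?case using Suc.IH by simp
  qed
  then have 1: "\<pi> (z 0) = x" by (intro ext) simp
  have 2: "z 0 \<in> \<Omega>" using z_exit[of 0] vD[of 0] by (auto intro: \<Omega>I)
  have "z 0 = glue (\<lambda>i. sel (x i))" by (simp add: z_def \<mu>_def)
  with 1 2 show "glue (\<lambda>i. sel (x i)) \<in> \<Omega>" "\<pi> (glue (\<lambda>i. sel (x i))) = x" by simp_all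
qed

end

section \<open>Ends\<close>

context transient_digraph
begin

text \<open>
  Two given connections need not fit together: the second one may leave \<open>q\<close> before the first one has
  arrived.  So the second one is chosen after the arrival, and the gap is bridged along \<open>q\<close> itself,
  which avoids \<open>H\<close> from some time on because \<open>q\<close> wanders.
\<close>
lemma leads_to_trans:
  assumes pq: "leads_to G p q" and qr: "leads_to G q r" and q: "q \<in> wan G"
  shows "leads_to G p r"
  unfolding leads_to_def
proof (intro allI impI)
  fix H N assume H: "H \<subseteq> verts G \<and> finite H"
  have qi: "q \<in> inf_paths G" using q by (simp add: wan_def)
  obtain M where M: "\<forall>i\<ge>M. tail G (q i) \<notin> H" using q H unfolding wan_def by blast
  obtain i j \<mu> where 1: "i \<ge> max N M" "j \<ge> max N M" "awalk (tail G (p i)) \<mu> (tail G (q j))"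
    "set (awalk_verts (tail G (p i)) \<mu>) \<inter> H = {}"
    using pq H unfolding leads_to_def by metis
  obtain l k \<nu> where 2: "l \<ge> max N j" "k \<ge> max N j" "awalk (tail G (q l)) \<nu> (tail G (r k))"
    "set (awalk_verts (tail G (q l)) \<nu>) \<inter> H = {}"
    using qr H unfolding leads_to_def by metis
  let ?\<rho> = "map q [j..<l]"
  have \<rho>: "awalk (tail G (q j)) ?\<rho> (tail G (q l))"
    using inf_path_segment[OF qi, of j "l - j"] 2(1) by simp
  have "set (awalk_verts (tail G (q j)) ?\<rho>) \<inter> H = {}"
    unfolding set_awalk_verts[OF \<rho>] using M 1(2) inf_path_head[OF qi] by auto
  moreover have "awalk (tail G (p i)) (\<mu> @ ?\<rho> @ \<nu>) (tail G (r k))"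
    using 1(3) \<rho> 2(3) awalk_appendI by blast
  moreover have "set (awalk_verts (tail G (p i)) (\<mu> @ ?\<rho> @ \<nu>)) \<inter> H = {}"
    using 1(4) 2(4) \<open>set (awalk_verts (tail G (q j)) ?\<rho>) \<inter> H = {}\<close>
    unfolding set_awalk_verts[OF 1(3)] set_awalk_verts[OF \<rho>] set_awalk_verts[OF 2(3)]
      set_awalk_verts[OF \<open>awalk (tail G (p i)) (\<mu> @ ?\<rho> @ \<nu>) (tail G (r k))\<close>] by auto
  moreover have "i \<ge> N" "k \<ge> N" using 1 2 by auto
  ultimately show "\<exists>i\<ge>N. \<exists>j\<ge>N. \<exists>\<mu>. awalk (tail G (p i)) \<mu> (tail G (r j)) \<and>
      set (awalk_verts (tail G (p i)) \<mu>) \<inter> H = {}" by blast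
qed

text \<open>
  At a common vertex the path of length 0 is a connection.
\<close>
lemma leads_to_common:
  assumes p: "p \<in> wan G" and common: "\<And>N. \<exists>i\<ge>N. \<exists>j\<ge>N. tail G (p i) = tail G (q j)"
  shows "leads_to G p q"
  unfolding leads_to_def
proof (intro allI impI)
  fix H N assume H: "H \<subseteq> verts G \<and> finite H"
  obtain M where M: "\<forall>i\<ge>M. tail G (p i) \<notin> H" using p H unfolding wan_def by blast
  obtain i j where ij: "i \<ge> max N M" "j \<ge> max N M" "tail G (p i) = tail G (q j)"
    using common[of "max N M"] by blast
  have "p \<in> inf_paths G" using p by (simp add: wan_def)
  then have "awalk (tail G (p i)) [] (tail G (q j))" using ij(3) inf_path_tail[of p i] by (simp add: awalk_Nil_iff)
  moreover have "tail G (p i) \<notin> H" using M ij(1) by simp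
  then have "set (awalk_verts (tail G (p i)) []) \<inter> H = {}" by simp
  moreover have "i \<ge> N" "j \<ge> N" using ij by auto
  ultimately show "\<exists>i\<ge>N. \<exists>j\<ge>N. \<exists>\<mu>. awalk (tail G (p i)) \<mu> (tail G (q j)) \<and>
      set (awalk_verts (tail G (p i)) \<mu>) \<inter> H = {}" by blast
qed

lemma ends_eq:
  assumes "E \<in> ends G"
  obtains q where "q \<in> wan G" "E = {p \<in> wan G. leads_to G q p \<and> leads_to G p q}"
  using assms unfolding ends_def by (elim quotientE) (auto simp: Image_def)

lemma ends_subset_wan: "E \<in> ends G \<Longrightarrow> E \<subseteq> wan G"
  by (erule ends_eq) auto

lemma ends_common:
  assumes E: "E \<in> ends G" and p: "p \<in> E" and p': "p' \<in> wan G"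
    and common: "\<And>N. \<exists>i\<ge>N. \<exists>j\<ge>N. tail G (p i) = tail G (p' j)"
  shows "p' \<in> E"
proof -
  obtain q where q: "q \<in> wan G" "E = {p \<in> wan G. leads_to G q p \<and> leads_to G p q}"
    using E by (rule ends_eq)
  have pw: "p \<in> wan G" using p q by simp
  have 1: "leads_to G p p'" using pw common by (rule leads_to_common)
  have 2: "leads_to G p' p" using p' common by (intro leads_to_common) metis+
  show ?thesis
    using leads_to_trans[OF _ 1 pw, of q] leads_to_trans[OF 2 _ pw, of q] p p' q by blast
qed

text \<open>
  An end consists of the wandering paths equivalent to one fixed path \<open>q\<close>, and this equivalence is a
  countable combination of conditions on single vertices of the path.
\<close>
lemma ends_sets:
  assumes E: "E \<in> ends G"
  shows "E \<in> sets (path_borel G)"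
proof -
  obtain q where q: "q \<in> wan G" "E = {p \<in> wan G. leads_to G q p \<and> leads_to G p q}"
    using E by (rule ends_eq)
  define \<H> where "\<H> = {H. finite H \<and> H \<subseteq> verts G}"
  have H: "countable \<H>" unfolding \<H>_def using countable_verts by (rule countable_Collect_finite_subset)
  have 1: "leads_to G q p \<longleftrightarrow> (\<forall>H\<in>\<H>. \<forall>N. \<exists>i\<ge>N. \<exists>j\<ge>N. \<exists>\<mu>.
      awalk (tail G (q i)) \<mu> (tail G (p j)) \<and> set (awalk_verts (tail G (q i)) \<mu>) \<inter> H = {})" for p
    unfolding leads_to_def \<H>_def by auto
  have 2: "leads_to G p q \<longleftrightarrow> (\<forall>H\<in>\<H>. \<forall>N. \<exists>i\<ge>N. \<exists>j\<ge>N. \<exists>\<mu>.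
      awalk (tail G (p i)) \<mu> (tail G (q j)) \<and> set (awalk_verts (tail G (p i)) \<mu>) \<inter> H = {})" for p
    unfolding leads_to_def \<H>_def by auto
  have m1 [measurable]: "Measurable.pred (path_borel G) (\<lambda>p. \<exists>\<mu>. awalk (tail G (q i)) \<mu> (tail G (p j)) \<and>
      set (awalk_verts (tail G (q i)) \<mu>) \<inter> H = {})" for H i j
    by (rule measurable_compose[OF measurable_path_tail[where H = G and i = j]]) simp
  have m2 [measurable]: "Measurable.pred (path_borel G) (\<lambda>p. \<exists>\<mu>. awalk (tail G (p i)) \<mu> (tail G (q j)) \<and>
      set (awalk_verts (tail G (p i)) \<mu>) \<inter> H = {})" for H i j
    by (rule measurable_compose[OF measurable_path_tail[where H = G and i = i]]) simp
  have "{p \<in> space (path_borel G). leads_to G q p} \<in> sets (path_borel G)"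
    unfolding 1 using H by measurable
  moreover have "{p \<in> space (path_borel G). leads_to G p q} \<in> sets (path_borel G)"
    unfolding 2 using H by measurable
  ultimately have "wan G \<inter> {p \<in> space (path_borel G). leads_to G q p} \<inter>
      {p \<in> space (path_borel G). leads_to G p q} \<in> sets (path_borel G)"
    using wan_sets by blast
  moreover have "wan G \<inter> {p \<in> space (path_borel G). leads_to G q p} \<inter>
      {p \<in> space (path_borel G). leads_to G p q} = E"
    unfolding q(2) by (auto simp: wan_def)
  ultimately show ?thesis by simp
qed

lemma ends_tail_invariant:
  assumes E: "E \<in> ends G" and aw: "awalk v \<mu> w" and y: "y \<in> wan G" "tail G (y 0) = w"
  shows "\<mu> \<frown> y \<in> E \<longleftrightarrow> y \<in> E"
proof -
  have yp: "y \<in> inf_paths G" using y by (simp add: wan_def)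
  have "\<mu> \<frown> y \<in> wan G" using wan_conc[OF aw y(2) yp] y(1) by simp
  moreover have "\<exists>i\<ge>N. \<exists>j\<ge>N. tail G ((\<mu> \<frown> y) i) = tail G (y j)" for N
    by (intro exI[of _ "N + length \<mu>"] exI[of _ N] conjI) simp_all
  moreover have "\<exists>i\<ge>N. \<exists>j\<ge>N. tail G (y i) = tail G ((\<mu> \<frown> y) j)" for N
    by (intro exI[of _ "N + length \<mu>"] exI[of _ N] conjI) simp_all
  ultimately show ?thesis using ends_common[OF E] y(1) by blast
qed

end

context exhausted_digraph
begin

text \<open>
  The last vertex in \<open>D n\<close> is not visited before a time at which the path is in \<open>D n\<close>, and every time
  is of this kind for large \<open>n\<close>.
\<close>
lemma last_at_late:
  assumes y: "y \<in> wan G"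
  shows "\<exists>M. \<forall>n\<ge>M. \<exists>i\<ge>N. last_at n y = tail G (y i)"
proof -
  have yp: "y \<in> inf_paths G" using y by (simp add: wan_def)
  obtain M where M: "tail G (y N) \<in> D M" using inf_path_tail[OF yp, of N] D_Union by auto
  have "\<exists>i\<ge>N. last_at n y = tail G (y i)" if "n \<ge> M" for n
  proof -
    have n: "tail G (y N) \<in> D n" using M that D_mono by blast
    then obtain j where j: "last_at n y = tail G (y j)" "suffix j y \<in> exit_paths G (D n) (tail G (y j))"
      using last_at_visit[OF y] by metis
    have "N \<le> j"
    proof (rule ccontr)
      assume "\<not> N \<le> j"
      then have "tail G (suffix j y (N - j)) \<notin> D n" using j(2) by (simp add: exit_paths_def del: suffix_nth)
      then show False using n \<open>\<not> N \<le> j\<close> by simp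
    qed
    then show ?thesis using j by blast
  qed
  then show ?thesis by blast
qed

lemma bratteli_path_determines_last_at:
  assumes "\<pi> y = \<pi> y'"
  shows "\<exists>M. \<forall>n\<ge>M. last_at n y = last_at n y'"
proof -
  let ?k = "start_level G D y" and ?k' = "start_level G D y'"
  have eq: "\<pi> y i = \<pi> y' i" for i using assms by simp
  have "?k = ?k'" using eq[of 0] by (simp add: bratteli_path_def Let_def)
  then have "last_at (?k + i) y = last_at (?k + i) y'" for i
    using eq[of i] by (simp add: bratteli_path_def Let_def)
  then have "last_at n y = last_at n y'" if "n \<ge> ?k" for n
    using that by (metis le_add_diff_inverse)
  then show ?thesis by blast
qed

text \<open>
  Paths with the same image under \<open>\<pi>\<close> have the same last vertex in \<open>D n\<close> for all large \<open>n\<close>, hence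
  common vertices at arbitrarily late times.
\<close>
lemma ends_saturated:
  assumes E: "E \<in> ends G" and y: "y \<in> E" and y': "y' \<in> wan G" and eq: "\<pi> y = \<pi> y'"
  shows "y' \<in> E"
proof (rule ends_common[OF E y y'])
  fix N
  have "y \<in> wan G" using ends_subset_wan[OF E] y by blast
  then obtain M where M: "\<forall>n\<ge>M. \<exists>i\<ge>N. last_at n y = tail G (y i)" using last_at_late by blast
  obtain M' where M': "\<forall>n\<ge>M'. \<exists>i\<ge>N. last_at n y' = tail G (y' i)" using last_at_late[OF y'] by blast
  obtain M'' where M'': "\<forall>n\<ge>M''. last_at n y = last_at n y'"
    using bratteli_path_determines_last_at[OF eq] by blast
  let ?n = "max M (max M' M'')"
  have "last_at ?n y = last_at ?n y'" using M'' by simp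
  moreover have "\<exists>i\<ge>N. last_at ?n y = tail G (y i)" "\<exists>i\<ge>N. last_at ?n y' = tail G (y' i)"
    using M M' by simp_all
  ultimately show "\<exists>i\<ge>N. \<exists>j\<ge>N. tail G (y i) = tail G (y' j)" by metis
qed

lemma \<Omega>_subset_wan: "\<Omega> \<subseteq> wan G"
  by (auto simp: \<Omega>_def exit_paths_def)

lemma bratteli_image_iff:
  assumes E: "E \<in> ends G" and y: "y \<in> \<Omega>"
  shows "\<pi> y \<in> \<pi> ` E \<longleftrightarrow> y \<in> E"
proof
  assume "\<pi> y \<in> \<pi> ` E"
  then obtain y' where y': "\<pi> y = \<pi> y'" "y' \<in> E" by (rule imageE)
  have "y \<in> wan G" using y \<Omega>_subset_wan by blast
  then show "y \<in> E" using ends_saturated[OF E y'(2)] y'(1) by simp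
qed simp

text \<open>
  With a fixed link path for every arrow, gluing is a measurable section of \<open>\<pi>\<close>.  Since \<open>E\<close> is a
  union of fibres of \<open>\<pi>\<close>, its image is the preimage of \<open>E\<close> under this section.
\<close>
lemma bratteli_image_sets:
  assumes E: "E \<in> ends G"
  shows "inf_paths \<B> - \<pi> ` E \<in> sets (path_borel \<B>)"
proof -
  have "\<exists>\<mu>. \<mu> \<in> link_paths G (D n) v w" if "((n, v), (Suc n, w)) \<in> arcs \<B>" for n v w
    using that by (auto simp: bratteli_arcs)
  then have "\<forall>a. \<exists>\<mu>. a \<in> arcs \<B> \<longrightarrow> \<mu> \<in> link_paths G (D (fst (fst a))) (snd (fst a)) (snd (snd a))"
    by (metis bratteli_arcE fst_conv snd_conv)
  then obtain sel where sel: "\<And>a. a \<in> arcs \<B> \<Longrightarrow> sel a \<in> link_paths G (D (fst (fst a))) (snd (fst a)) (snd (snd a))"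
    by metis
  define \<sigma> where "\<sigma> x = glue (\<lambda>i. sel (x i))" for x :: "nat \<Rightarrow> (nat \<times> 'v) \<times> (nat \<times> 'v)"
  have \<sigma>: "\<sigma> x \<in> \<Omega>" "\<pi> (\<sigma> x) = x" if "x \<in> inf_paths \<B>" for x
    using bratteli_path_glue[OF that, of sel] sel by (force simp: \<sigma>_def)+
  have meas: "\<sigma> \<in> path_borel \<B> \<rightarrow>\<^sub>M path_borel G"
  proof (rule measurable_path_borelI)
    show "\<sigma> x \<in> inf_paths G" if "x \<in> space (path_borel \<B>)" for x
      using \<sigma>(1)[of x] that sets.sets_into_space[OF \<Omega>_sets] by auto
    show "(\<lambda>x. \<sigma> x i) \<in> path_borel \<B> \<rightarrow>\<^sub>M count_space UNIV" for i
      unfolding \<sigma>_def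
      by (rule measurable_glue, rule measurable_compose[OF measurable_path_coord]) simp
  qed
  have "x \<in> \<pi> ` E \<longleftrightarrow> \<sigma> x \<in> E" if x: "x \<in> inf_paths \<B>" for x
    using bratteli_image_iff[OF E \<sigma>(1)[OF x]] \<sigma>(2)[OF x] by simp
  then have "inf_paths \<B> - \<pi> ` E = inf_paths \<B> - (\<sigma> -` E \<inter> inf_paths \<B>)" by blast
  moreover have "\<sigma> -` E \<inter> inf_paths \<B> \<in> sets (path_borel \<B>)"
    using measurable_sets[OF meas ends_sets[OF E]] by simp
  ultimately show ?thesis using sets.compl_sets by force
qed

end

section \<open>The cylinder topology\<close>

lemma topspace_cyl_topology:
  assumes "verts G \<noteq> {}"
  shows "topspace (cyl_topology G M) = M"
proof -
  obtain v where v: "v \<in> verts G" using assms by blast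
  let ?S = "{{m \<in> M. measure m (cyl G v \<mu>) \<in> U} | v \<mu> w U. pre_digraph.awalk G v \<mu> w \<and> open U}"
  have "pre_digraph.awalk G v [] v" using v by (simp add: pre_digraph.awalk_def pre_digraph.cas.simps)
  then have "{m \<in> M. measure m (cyl G v []) \<in> UNIV} \<in> ?S" using open_UNIV by blast
  moreover have "{m \<in> M. measure m (cyl G v []) \<in> UNIV} = M" by simp
  ultimately have "M \<in> ?S" by (simp only:)
  then have "M \<subseteq> \<Union>?S" by (rule Union_upper)
  moreover have "\<Union>?S \<subseteq> M" by auto
  ultimately show ?thesis by (simp add: cyl_topology_def)
qed

text \<open>
  The topology is the initial one for the masses of cylinders; this and the next lemma are the two
  halves of its universal property.
\<close>
lemma continuous_map_cyl:
  assumes "verts G \<noteq> {}" and "pre_digraph.awalk G v \<mu> w"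
  shows "continuous_map (cyl_topology G M) euclideanreal (\<lambda>m. measure m (cyl G v \<mu>))"
  unfolding continuous_map_def topspace_cyl_topology[OF assms(1)]
proof (intro conjI allI impI)
  fix U :: "real set" assume "openin euclidean U"
  then show "openin (cyl_topology G M) {m \<in> M. measure m (cyl G v \<mu>) \<in> U}"
    unfolding cyl_topology_def using assms(2) by (intro topology_generated_by_Basis) auto
qed simp

lemma continuous_map_into_cyl_topology:
  assumes "verts G \<noteq> {}" and f: "\<And>x. x \<in> topspace T \<Longrightarrow> f x \<in> M"
    and cont: "\<And>v \<mu> w. pre_digraph.awalk G v \<mu> w \<Longrightarrow>
      continuous_map T euclideanreal (\<lambda>x. measure (f x) (cyl G v \<mu>))"
  shows "continuous_map T (cyl_topology G M) f"
  unfolding cyl_topology_def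
proof (rule continuous_on_generated_topo)
  fix W assume "W \<in> {{m \<in> M. measure m (cyl G v \<mu>) \<in> U} | v \<mu> w U. pre_digraph.awalk G v \<mu> w \<and> open U}"
  then obtain v \<mu> w U where W: "W = {m \<in> M. measure m (cyl G v \<mu>) \<in> U}" "pre_digraph.awalk G v \<mu> w" "open U"
    by blast
  have "f -` W \<inter> topspace T = {x \<in> topspace T. measure (f x) (cyl G v \<mu>) \<in> U}"
    using f W(1) by auto
  then show "openin T (f -` W \<inter> topspace T)"
    using openin_continuous_map_preimage[OF cont[OF W(2)]] W(3) by simp
next
  have eq: "\<Union>{{m \<in> M. measure m (cyl G v \<mu>) \<in> U} | v \<mu> w U. pre_digraph.awalk G v \<mu> w \<and> open U} = M"
    using topspace_cyl_topology[OF assms(1), of M] by (simp add: cyl_topology_def)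
  show "f ` topspace T \<subseteq> \<Union>{{m \<in> M. measure m (cyl G v \<mu>) \<in> U} | v \<mu> w U. pre_digraph.awalk G v \<mu> w \<and> open U}"
    unfolding eq using f by blast
qed

section \<open>Transport of conformal measures to the Bratteli diagram\<close>

context exhausted_digraph
begin

text \<open>
  The factor is the reciprocal of the mass of the exit paths from \<open>{v0}\<close> under a measure that gives
  mass 1 to \<open>Z(v0)\<close>.
\<close>
definition push :: "(nat \<Rightarrow> 'e) measure \<Rightarrow> (nat \<Rightarrow> (nat \<times> 'v) \<times> (nat \<times> 'v)) measure" where
  "push m = distr (restrict_space (scale_measure (green v0 v0) m) \<Omega>) (path_borel \<B>) \<pi>"

lemma green_v0: "green v0 v0 \<noteq> 0" "green v0 v0 \<noteq> top" "green v0 v0 < top"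
proof -
  have "awalk v0 [] v0" using v0_vert by (simp add: awalk_Nil_iff)
  then have "1 \<le> green v0 v0" using weight_ge[of "[]" "{\<mu>. awalk v0 \<mu> v0}" \<phi>] by (simp add: green_def)
  then show "green v0 v0 \<noteq> 0" by auto
  show "green v0 v0 < top" using v0_vert by (intro green_finite)
  then show "green v0 v0 \<noteq> top" by simp
qed

lemma sets_push [simp]: "sets (push m) = sets (path_borel \<B>)"
  by (simp add: push_def)

lemma \<Omega>_preimage_sets:
  assumes "A \<in> sets (path_borel \<B>)"
  shows "{y \<in> \<Omega>. \<pi> y \<in> A} \<in> sets (path_borel G)"
proof -
  have sub: "\<Omega> \<subseteq> inf_paths G" using sets.sets_into_space[OF \<Omega>_sets] by simp
  have "\<pi> -` A \<inter> space (restrict_space (path_borel G) \<Omega>) \<in> sets (restrict_space (path_borel G) \<Omega>)"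
    using measurable_bratteli_path assms by (rule measurable_sets)
  moreover have "\<pi> -` A \<inter> space (restrict_space (path_borel G) \<Omega>) = {y \<in> \<Omega>. \<pi> y \<in> A}"
    using sub by (auto simp: space_restrict_space)
  ultimately show ?thesis
    using \<Omega>_sets sub by (simp add: sets_restrict_space_iff Int_absorb2)
qed

lemma emeasure_push:
  assumes m: "sets m = sets (path_borel G)" and A: "A \<in> sets (path_borel \<B>)"
  shows "emeasure (push m) A = green v0 v0 * emeasure m {y \<in> \<Omega>. \<pi> y \<in> A}"
proof -
  let ?R = "restrict_space (scale_measure (green v0 v0) m) \<Omega>"
  have sub: "\<Omega> \<subseteq> inf_paths G" using sets.sets_into_space[OF \<Omega>_sets] by simp
  have sp: "space m = inf_paths G" using sets_eq_imp_space_eq[OF m] by simp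
  have "sets ?R = sets (restrict_space (path_borel G) \<Omega>)"
    by (intro sets_restrict_space_cong) (simp add: m)
  then have meas: "\<pi> \<in> ?R \<rightarrow>\<^sub>M path_borel \<B>"
    using measurable_bratteli_path measurable_cong_sets by blast
  have "emeasure (push m) A = emeasure ?R (\<pi> -` A \<inter> space ?R)"
    unfolding push_def by (rule emeasure_distr[OF meas A])
  also have "\<pi> -` A \<inter> space ?R = {y \<in> \<Omega>. \<pi> y \<in> A}"
    using sub by (auto simp: space_restrict_space space_scale_measure sp)
  also have "emeasure ?R {y \<in> \<Omega>. \<pi> y \<in> A} = emeasure (scale_measure (green v0 v0) m) {y \<in> \<Omega>. \<pi> y \<in> A}"
    using \<Omega>_sets sub by (intro emeasure_restrict_space) (auto simp: space_scale_measure sp m Int_absorb2)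
  finally show ?thesis by simp
qed

lemma emeasure_push_vertex:
  assumes m: "sets m = sets (path_borel G)" and w: "w \<in> D n"
  shows "emeasure (push m) (cyl \<B> (n, w) []) = green v0 v0 * emeasure m (exit_paths G (D n) w)"
  using emeasure_push[OF m cyl_in_sets] bratteli_preimage_vertex[of n w] w by simp

lemma emeasure_exit_paths_finite:
  assumes m: "conformal G \<phi> m" and w: "w \<in> D n"
  shows "emeasure m (exit_paths G (D n) w) < top"
proof -
  have "emeasure m (exit_paths G (D n) w) \<le> emeasure m (cyl G w [])"
    using m by (intro emeasure_mono exit_paths_subset) (auto simp: conformal_def)
  also have "\<dots> < top" using m w D_verts by (intro conformal_finite) auto
  finally show ?thesis .
qed

text \<open>
  The last exit decomposition for all paths, since almost all of them wander.
\<close>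
lemma emeasure_vertex:
  assumes m: "conformal G \<phi> m" and v: "v \<in> D n"
  shows "emeasure m (cyl G v []) = (\<Sum>w\<in>D n. green v w * emeasure m (exit_paths G (D n) w))"
proof -
  have sets: "sets m = sets (path_borel G)" using m by (simp add: conformal_def)
  have space: "inf_paths G \<in> sets m" using sets.top[of "path_borel G"] by (simp add: sets)
  have "emeasure m (cyl G v [] \<inter> wan G \<inter> inf_paths G) =
      (\<Sum>w\<in>D n. green v w * emeasure m (exit_paths G (D n) w \<inter> inf_paths G))"
  proof (rule emeasure_last_exit[OF m D_finite D_verts v space])
    fix \<mu> w y assume "awalk v \<mu> w" "y \<in> wan G" "tail G (y 0) = w"
    then show "\<mu> \<frown> y \<in> inf_paths G \<longleftrightarrow> y \<in> inf_paths G"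
      using conc_inf_path[of v \<mu> w y] by (simp add: wan_def)
  qed
  moreover have "exit_paths G (D n) w \<inter> inf_paths G = exit_paths G (D n) w" for w
    by (auto simp: exit_paths_def wan_def)
  moreover have "emeasure m (cyl G v [] \<inter> wan G \<inter> inf_paths G) = emeasure m (cyl G v [])"
  proof (rule emeasure_eq_AE)
    have "AE y in m. y \<notin> inf_paths G - wan G" using null_non_wandering[OF m] by (rule AE_not_in)
    then show "AE y in m. y \<in> cyl G v [] \<inter> wan G \<inter> inf_paths G \<longleftrightarrow> y \<in> cyl G v []"
      by (rule AE_mp) (auto simp: cyl_def intro!: AE_I2)
  qed (auto simp: sets space[unfolded sets] wan_sets)
  ultimately show ?thesis by simp
qed

lemma emeasure_push_conc:
  assumes m: "conformal G \<phi> m" and a: "a \<in> arcs \<B>"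
    and C: "C \<in> sets (path_borel \<B>)" "C \<subseteq> cyl \<B> (head \<B> a) []"
  shows "emeasure (push m) ((\<frown>) [a] ` C) = walk_weight F\<^sub>\<beta> [a] * emeasure (push m) C"
proof -
  have sets: "sets m = sets (path_borel G)" using m by (simp add: conformal_def)
  obtain n v w where nvw: "a = ((n, v), (Suc n, w))" "w \<in> exit_verts G (D (Suc n))"
    using a by (rule bratteli_arcE)
  have wD: "w \<in> D (Suc n)" using nvw exit_verts_subset by blast
  let ?P = "{z \<in> \<Omega>. \<pi> z \<in> C}"
  have Csub: "C \<subseteq> cyl \<B> (Suc n, w) []" using C(2) nvw by simp
  then have "?P \<subseteq> {z \<in> \<Omega>. \<pi> z \<in> cyl \<B> (Suc n, w) []}" by blast
  then have Pe: "?P \<subseteq> exit_paths G (D (Suc n)) w"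
    unfolding bratteli_preimage_vertex using wD by simp
  have aC: "(\<frown>) [a] ` C \<in> sets (path_borel \<B>)"
    by (rule B.conc_image_sets[OF B.arc_implies_awalk[OF a] C])
  have "emeasure m (\<Union>t\<in>{w}. \<Union>\<mu>\<in>link_paths G (D n) v t. (\<frown>) \<mu> ` ?P) =
      (\<Sum>t\<in>{w}. weight \<phi> (link_paths G (D n) v t) * emeasure m ?P)"
  proof (rule emeasure_decomposition[OF m, where v = v])
    show "?P \<in> sets m" using \<Omega>_preimage_sets[OF C(1)] by (simp add: sets)
    show "?P \<subseteq> cyl G t []" if "t \<in> {w}" for t
      using Pe exit_paths_subset that by blast
    show "\<sigma> = []" if "\<sigma> \<frown> y \<in> ?P" "y \<in> ?P" for \<sigma> y
      using exit_paths_unique[OF wD] Pe that by blast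
  qed (auto simp: link_paths_def)
  then have "emeasure m {y \<in> \<Omega>. \<pi> y \<in> (\<frown>) [a] ` C} = walk_weight F\<^sub>\<beta> [a] * emeasure m ?P"
    using bratteli_path_preimage_conc[of n v w C] a nvw Csub weight_link[of n v w] by simp
  then show ?thesis
    unfolding emeasure_push[OF sets aC] emeasure_push[OF sets C(1)] by (simp add: ac_simps)
qed

lemma conformal_push:
  assumes m: "conformal G \<phi> m" and norm: "emeasure m (cyl G v0 []) = 1"
  shows "conformal \<B> F\<^sub>\<beta> (push m)" and "emeasure (push m) (cyl \<B> (0, v0) []) = 1"
proof -
  have sets: "sets m = sets (path_borel G)" using m by (simp add: conformal_def)
  have "v0 \<in> D 0" by (simp add: D_0)
  from emeasure_vertex[OF m this] emeasure_push_vertex[OF sets this]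
  show one: "emeasure (push m) (cyl \<B> (0, v0) []) = 1" using norm by (simp add: D_0)
  show "conformal \<B> F\<^sub>\<beta> (push m)"
  proof (rule B.conformalI_cylinders)
    have "emeasure (push m) (cyl \<B> (0, v0) []) \<le> emeasure (push m) (inf_paths \<B>)"
      using sets.top[of "push m"] sets_eq_imp_space_eq[OF sets_push, of m]
      by (intro emeasure_mono cyl_subset) simp
    then show "emeasure (push m) (inf_paths \<B>) \<noteq> 0" using one by auto
    fix x assume "x \<in> verts \<B>"
    then obtain n w where x: "x = (n, w)" "w \<in> D n"
      using exit_verts_subset by (cases x) (auto simp: bratteli_verts)
    show "emeasure (push m) (cyl \<B> x []) < \<infinity>"
      unfolding x(1) emeasure_push_vertex[OF sets x(2)]
      using emeasure_exit_paths_finite[OF m x(2)] green_v0 by (simp add: ennreal_mult_less_top)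
  next
    fix a \<nu> x assume a: "a \<in> arcs \<B>" "B.awalk (head \<B> a) \<nu> x"
    have "cyl \<B> (tail \<B> a) (a # \<nu>) = (\<frown>) [a] ` cyl \<B> (head \<B> a) \<nu>"
      using B.cyl_conc_cyl[OF B.arc_implies_awalk[OF a(1)] a(2)] by simp
    moreover have "cyl \<B> (head \<B> a) \<nu> \<subseteq> cyl \<B> (head \<B> a) []" by (auto simp: cyl_def)
    ultimately show "emeasure (push m) (cyl \<B> (tail \<B> a) (a # \<nu>)) =
        walk_weight F\<^sub>\<beta> [a] * emeasure (push m) (cyl \<B> (head \<B> a) \<nu>)"
      using emeasure_push_conc[OF m a(1) cyl_in_sets] by simp
  qed simp
qed

lemma push_null:
  assumes E: "E \<in> ends G" and sets: "sets m = sets (path_borel G)"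
  shows "emeasure (push m) (inf_paths \<B> - \<pi> ` E) = green v0 v0 * emeasure m (\<Omega> - E)"
proof -
  have "{y \<in> \<Omega>. \<pi> y \<in> inf_paths \<B> - \<pi> ` E} = \<Omega> - E"
    using bratteli_image_iff[OF E] bratteli_path_in_paths by auto
  then show ?thesis using emeasure_push[OF sets bratteli_image_sets[OF E]] by simp
qed

text \<open>
  By \<open>emeasure_vertex\<close> the masses of the vertices of the Bratteli diagram determine those of the
  vertices of the graph.
\<close>
lemma push_inj:
  assumes m: "conformal G \<phi> m" "conformal G \<phi> m'" and eq: "push m = push m'"
  shows "m = m'"
proof (rule conformal_eqI[OF m])
  have sets: "sets m = sets (path_borel G)" "sets m' = sets (path_borel G)"
    using m by (simp_all add: conformal_def)
  fix v assume "v \<in> verts G"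
  then obtain n where v: "v \<in> D n" using D_Union by auto
  have "emeasure m (exit_paths G (D n) w) = emeasure m' (exit_paths G (D n) w)" if "w \<in> D n" for w
    using emeasure_push_vertex[OF sets(1) that] emeasure_push_vertex[OF sets(2) that] eq green_v0
    by (simp add: ennreal_mult_cancel_left)
  then show "emeasure m (cyl G v []) = emeasure m' (cyl G v [])"
    unfolding emeasure_vertex[OF m(1) v] emeasure_vertex[OF m(2) v] by simp
qed

section \<open>The harmonic function of a measure on the Bratteli diagram\<close>

lemma bratteli_cyl_empty: "w \<notin> exit_verts G (D n) \<Longrightarrow> cyl \<B> (n, w) [] = {}"
proof (rule equals0I)
  fix p assume w: "w \<notin> exit_verts G (D n)" and "p \<in> cyl \<B> (n, w) []"
  then have "p \<in> inf_paths \<B>" "fst (p 0) = (n, w)" by (simp_all add: cyl_def)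
  then have "(n, w) \<in> verts \<B>" using B.inf_path_tail[of p 0] by simp
  then show False using w by (simp add: bratteli_verts)
qed

text \<open>
  The sum may run over all of \<open>D (Suc n)\<close>: if \<open>w\<close> is an exit vertex and there is a link path from \<open>u\<close>
  to \<open>w\<close>, then \<open>u\<close> is an exit vertex too, and otherwise the term is 0.
\<close>
lemma bratteli_harmonic:
  assumes m': "conformal \<B> F\<^sub>\<beta> m'" and u: "u \<in> D n"
  shows "emeasure m' (cyl \<B> (n, u) []) =
    (\<Sum>w\<in>D (Suc n). weight \<phi> (link_paths G (D n) u w) * emeasure m' (cyl \<B> (Suc n, w) []))"
proof -
  let ?g = "\<lambda>w. ((n, u), (Suc n, w))"
  let ?W = "{w \<in> D (Suc n). ?g w \<in> arcs \<B>}"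
  have "out_arcs \<B> (n, u) = ?g ` ?W"
  proof (intro set_eqI iffI)
    fix a assume "a \<in> out_arcs \<B> (n, u)"
    then have a: "a \<in> arcs \<B>" "fst a = (n, u)" by simp_all
    obtain w where "a = ?g w" "w \<in> exit_verts G (D (Suc n))"
      using a by (auto elim!: bratteli_arcE)
    then show "a \<in> ?g ` ?W" using a(1) exit_verts_subset by blast
  qed auto
  then have "emeasure m' (cyl \<B> (n, u) []) =
      (\<Sum>w\<in>?W. walk_weight F\<^sub>\<beta> [?g w] * emeasure m' (cyl \<B> (Suc n, w) []))"
    using B.conformal_harmonic[OF m' bratteli_row_finite, of "(n, u)"]
    by (simp add: sum.reindex inj_on_def)
  also have "\<dots> = (\<Sum>w\<in>?W. weight \<phi> (link_paths G (D n) u w) * emeasure m' (cyl \<B> (Suc n, w) []))"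
    by (intro sum.cong refl) (simp add: weight_link)
  also have "\<dots> = (\<Sum>w\<in>D (Suc n). weight \<phi> (link_paths G (D n) u w) * emeasure m' (cyl \<B> (Suc n, w) []))"
  proof (rule sum.mono_neutral_left)
    show "\<forall>w\<in>D (Suc n) - ?W. weight \<phi> (link_paths G (D n) u w) * emeasure m' (cyl \<B> (Suc n, w) []) = 0"
    proof
      fix w assume w: "w \<in> D (Suc n) - ?W"
      show "weight \<phi> (link_paths G (D n) u w) * emeasure m' (cyl \<B> (Suc n, w) []) = 0"
      proof (cases "w \<in> exit_verts G (D (Suc n)) \<and> link_paths G (D n) u w \<noteq> {}")
        case True
        then obtain z \<mu> where "z \<in> exit_paths G (D (Suc n)) w" "\<mu> \<in> link_paths G (D n) u w"
          by (auto simp: exit_verts_def)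
        then have "u \<in> exit_verts G (D n)"
          using link_conc_exit_path u by (intro exit_vertsI)
        then show ?thesis using True w by (simp add: bratteli_arcs)
      next
        case False
        then show ?thesis using bratteli_cyl_empty[of w "Suc n"] by auto
      qed
    qed
  qed (use D_finite in auto)
  finally show ?thesis .
qed

text \<open>
  If \<open>m' = push m\<close>, this is \<open>green v0 v0\<close> times the mass of \<open>Z(v)\<close> under \<open>m\<close> for all \<open>n\<close> with
  \<open>v \<in> D n\<close>, by \<open>emeasure_vertex\<close>.  The lemmas below show for an arbitrary conformal measure \<open>m'\<close> on
  the Bratteli diagram that it has the properties of such a mass.
\<close>
definition potential :: "(nat \<Rightarrow> (nat \<times> 'v) \<times> (nat \<times> 'v)) measure \<Rightarrow> nat \<Rightarrow> 'v \<Rightarrow> ennreal" where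
  "potential m' n v = (\<Sum>w\<in>D n. green v w * emeasure m' (cyl \<B> (n, w) []))"

lemma bratteli_cyl_old: "w \<in> D n \<Longrightarrow> cyl \<B> (Suc n, w) [] = {}"
  using exit_vert_new by (intro bratteli_cyl_empty) (auto simp: exit_verts_def)

text \<open>
  A vertex \<open>w\<close> on level \<open>n + 1\<close> with non-zero mass lies outside \<open>D n\<close>, so the walks from \<open>v\<close> to \<open>w\<close> can
  be cut at the last visit to \<open>D n\<close>; the link paths that remain combine with the masses on level
  \<open>n + 1\<close> to those on level \<open>n\<close>.
\<close>
lemma potential_Suc:
  assumes m': "conformal \<B> F\<^sub>\<beta> m'" and v: "v \<in> D n"
  shows "potential m' (Suc n) v = potential m' n v"
proof -
  let ?p = "\<lambda>n w. emeasure m' (cyl \<B> (n, w) [])"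
  have "green v w * ?p (Suc n) w =
      (\<Sum>u\<in>D n. green v u * (weight \<phi> (link_paths G (D n) u w) * ?p (Suc n) w))" for w
  proof (cases "w \<in> D n")
    case True
    then show ?thesis by (simp add: bratteli_cyl_old)
  next
    case False
    show ?thesis
      unfolding green_last_exit[OF D_finite D_verts v False]
      by (simp add: sum_distrib_right mult.assoc)
  qed
  then have "potential m' (Suc n) v =
      (\<Sum>w\<in>D (Suc n). \<Sum>u\<in>D n. green v u * (weight \<phi> (link_paths G (D n) u w) * ?p (Suc n) w))"
    by (simp add: potential_def)
  also have "\<dots> = (\<Sum>u\<in>D n. green v u *
      (\<Sum>w\<in>D (Suc n). weight \<phi> (link_paths G (D n) u w) * ?p (Suc n) w))"
    by (subst sum.swap) (simp add: sum_distrib_left)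
  also have "\<dots> = potential m' n v"
    unfolding potential_def using bratteli_harmonic[OF m'] by (intro sum.cong) auto
  finally show ?thesis .
qed

lemma potential_eq:
  assumes m': "conformal \<B> F\<^sub>\<beta> m'" and v: "v \<in> D n" and le: "n \<le> k"
  shows "potential m' k v = potential m' n v"
  using le
proof (induction k rule: dec_induct)
  case (step k)
  then have "v \<in> D k" using v D_mono by blast
  then show ?case using potential_Suc[OF m'] step by simp
qed simp

lemma bratteli_vertex_finite:
  assumes m': "conformal \<B> F\<^sub>\<beta> m'"
  shows "emeasure m' (cyl \<B> (n, w) []) < top"
proof (cases "w \<in> exit_verts G (D n)")
  case True
  then show ?thesis using m' by (auto simp: conformal_def bratteli_verts)
qed (simp add: bratteli_cyl_empty)

lemma potential_finite:
  assumes "conformal \<B> F\<^sub>\<beta> m'" "v \<in> verts G"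
  shows "potential m' n v < top"
proof -
  have "green v w * emeasure m' (cyl \<B> (n, w) []) < top" if "w \<in> D n" for w
    using bratteli_vertex_finite[OF assms(1)] green_finite[OF assms(2)] subsetD[OF D_verts that]
    by (simp add: ennreal_mult_less_top)
  then show ?thesis unfolding potential_def by (simp add: D_finite)
qed

text \<open>
  Harmonicity is read off one level higher, where \<open>v\<close> is not an exit vertex and the trivial walk at
  \<open>v\<close> therefore does not count.
\<close>
lemma potential_step:
  assumes v: "v \<in> D n"
  shows "potential m' (Suc n) v = (\<Sum>a\<in>out_arcs G v. walk_weight \<phi> [a] * potential m' (Suc n) (head G a))"
proof -
  let ?p = "\<lambda>w. emeasure m' (cyl \<B> (Suc n, w) [])"
  have "green v w * ?p w = (\<Sum>a\<in>out_arcs G v. walk_weight \<phi> [a] * (green (head G a) w * ?p w))" for w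
  proof (cases "v = w")
    case True
    then show ?thesis using bratteli_cyl_old[of w n] v by simp
  next
    case False
    show ?thesis unfolding green_step[OF False] by (simp add: sum_distrib_right mult.assoc)
  qed
  then have "potential m' (Suc n) v =
      (\<Sum>w\<in>D (Suc n). \<Sum>a\<in>out_arcs G v. walk_weight \<phi> [a] * (green (head G a) w * ?p w))"
    by (simp add: potential_def)
  also have "\<dots> = (\<Sum>a\<in>out_arcs G v. walk_weight \<phi> [a] * potential m' (Suc n) (head G a))"
    unfolding potential_def by (subst sum.swap) (simp add: sum_distrib_left)
  finally show ?thesis .
qed

lemma potential_first_return:
  assumes m': "conformal \<B> F\<^sub>\<beta> m'" and w: "w \<in> D n"
  shows "potential m' n w = emeasure m' (cyl \<B> (n, w) []) +
    (\<Sum>z\<in>D n. weight \<phi> (first_returns (D n) w z) * potential m' n z)"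
proof -
  let ?p = "\<lambda>w. emeasure m' (cyl \<B> (n, w) [])" and ?r = "\<lambda>z. weight \<phi> (first_returns (D n) w z)"
  have wv: "w \<in> verts G" using w D_verts by blast
  have "potential m' n w = (\<Sum>u\<in>D n. (if w = u then ?p u else 0) + (\<Sum>z\<in>D n. ?r z * (green z u * ?p u)))"
    unfolding potential_def
  proof (rule sum.cong[OF refl])
    fix u assume u: "u \<in> D n"
    show "green w u * ?p u = (if w = u then ?p u else 0) + (\<Sum>z\<in>D n. ?r z * (green z u * ?p u))"
      unfolding green_first_return[OF D_finite wv u]
      by (simp add: distrib_right sum_distrib_right mult.assoc)
  qed
  also have "\<dots> = ?p w + (\<Sum>u\<in>D n. \<Sum>z\<in>D n. ?r z * (green z u * ?p u))"
    using w by (simp add: sum.distrib sum.delta D_finite)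
  also have "(\<Sum>u\<in>D n. \<Sum>z\<in>D n. ?r z * (green z u * ?p u)) = (\<Sum>z\<in>D n. ?r z * potential m' n z)"
    unfolding potential_def by (subst sum.swap) (simp add: sum_distrib_left)
  finally show ?thesis .
qed

lemma ennreal_mult_divide_self: "c \<noteq> 0 \<Longrightarrow> c \<noteq> top \<Longrightarrow> c * (x / c) = (x :: ennreal)"
  by (simp add: ennreal_times_divide mult.commute[of c] ennreal_mult_divide_eq)

text \<open>
  The potential of \<open>m'\<close>, divided by \<open>green v0 v0\<close>, is harmonic and thus belongs to a conformal measure
  \<open>m\<close>.  The first return decompositions of \<open>m\<close> and of the potential have the same finite sum over
  returning paths; subtracting it shows that \<open>push m\<close> and \<open>m'\<close> agree on all vertices.
\<close>
lemma push_surj: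
  assumes m': "conformal \<B> F\<^sub>\<beta> m'" and norm: "emeasure m' (cyl \<B> (0, v0) []) = 1"
  shows "\<exists>m. conformal G \<phi> m \<and> emeasure m (cyl G v0 []) = 1 \<and> push m = m'"
proof -
  let ?c = "green v0 v0"
  \<comment> \<open>The choice of the level is immaterial by \<open>potential_eq\<close>.\<close>
  define \<psi> where "\<psi> v = potential m' (LEAST n. v \<in> D n) v / ?c" for v
  have \<psi>: "\<psi> v = potential m' n v / ?c" if "v \<in> D n" for v n
    unfolding \<psi>_def using potential_eq[OF m' LeastI[of "\<lambda>n. v \<in> D n"] Least_le[of "\<lambda>n. v \<in> D n"]] that by simp
  have c\<psi>: "?c * \<psi> v = potential m' n v" if "v \<in> D n" for v n
    unfolding \<psi>[OF that] by (rule ennreal_mult_divide_self[OF green_v0(1,2)])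
  have level: "\<exists>n. v \<in> D n" if "v \<in> verts G" for v using that D_Union by auto
  have "\<psi> v0 = potential m' 0 v0 / ?c" by (rule \<psi>) (simp add: D_0)
  then have one: "\<psi> v0 = 1"
    using norm green_v0 by (simp add: potential_def D_0 ennreal_divide_self)
  have "\<exists>m. conformal G \<phi> m \<and> (\<forall>v\<in>verts G. emeasure m (cyl G v []) = \<psi> v)"
  proof (rule ex_conformal_of_harmonic[OF finite_out_arcs _ _ v0_vert])
    show "\<psi> v0 \<noteq> 0" using one by simp
    show "\<psi> v < \<infinity>" if v: "v \<in> verts G" for v
    proof -
      obtain n where "v \<in> D n" using level[OF v] by blast
      then show ?thesis
        using \<psi> potential_finite[OF m' v, of n] green_v0(1)
        by (auto simp: ennreal_divide_eq_top_iff simp flip: less_top)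
    qed
    fix v assume v: "v \<in> verts G"
    obtain n where n: "v \<in> D n" using level[OF v] by blast
    then have "\<psi> v = potential m' (Suc n) v / ?c" using \<psi>[of v "Suc n"] D_mono[of n "Suc n"] by auto
    also have "\<dots> = (\<Sum>a\<in>out_arcs G v. walk_weight \<phi> [a] * (potential m' (Suc n) (head G a) / ?c))"
      unfolding potential_step[OF n] by (simp add: divide_ennreal_def sum_distrib_right mult.assoc)
    also have "\<dots> = (\<Sum>a\<in>out_arcs G v. walk_weight \<phi> [a] * \<psi> (head G a))"
      using D_step n by (intro sum.cong refl) (auto simp: \<psi>[of _ "Suc n"])
    finally show "\<psi> v = (\<Sum>a\<in>out_arcs G v. walk_weight \<phi> [a] * \<psi> (head G a))" .
  qed
  then obtain m where m: "conformal G \<phi> m" and mv: "\<And>v. v \<in> verts G \<Longrightarrow> emeasure m (cyl G v []) = \<psi> v"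
    by blast
  have sets: "sets m = sets (path_borel G)" using m by (simp add: conformal_def)
  have m0: "emeasure m (cyl G v0 []) = 1" using mv[OF v0_vert] one by simp
  have "push m = m'"
  proof (rule B.conformal_eqI[OF conformal_push(1)[OF m m0] m'])
    fix x assume "x \<in> verts \<B>"
    then obtain n w where x: "x = (n, w)" "w \<in> D n"
      using exit_verts_subset by (cases x) (auto simp: bratteli_verts)
    let ?r = "\<lambda>z. weight \<phi> (first_returns (D n) w z)"
    let ?S = "\<Sum>z\<in>D n. ?r z * potential m' n z"
    have vD: "z \<in> verts G" if "z \<in> D n" for z using that D_verts by blast
    have "?c * \<psi> w = ?c * (emeasure m (exit_paths G (D n) w) + (\<Sum>z\<in>D n. ?r z * \<psi> z))"
      using emeasure_first_return[OF m D_finite D_verts x(2)] mv vD x(2) by simp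
    also have "\<dots> = ?c * emeasure m (exit_paths G (D n) w) + (\<Sum>z\<in>D n. ?r z * (?c * \<psi> z))"
      by (simp add: distrib_left sum_distrib_left mult.left_commute)
    also have "(\<Sum>z\<in>D n. ?r z * (?c * \<psi> z)) = ?S"
      using c\<psi> by (intro sum.cong) auto
    finally have 1: "?c * \<psi> w = ?c * emeasure m (exit_paths G (D n) w) + ?S" .
    have "?c * \<psi> w = emeasure m' (cyl \<B> (n, w) []) + ?S"
      using c\<psi>[OF x(2)] potential_first_return[OF m' x(2)] by (rule trans)
    with 1 have "?c * emeasure m (exit_paths G (D n) w) + ?S = emeasure m' (cyl \<B> (n, w) []) + ?S"
      by (rule subst)
    then have eq: "?S + ?c * emeasure m (exit_paths G (D n) w) = ?S + emeasure m' (cyl \<B> (n, w) [])"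
      unfolding add.commute[of ?S] .
    have "?r z * potential m' n z < top" if "z \<in> D n" for z
      using potential_finite[OF m' vD[OF that]] green_finite[OF vD[OF x(2)] vD[OF that]]
        le_less_trans[OF first_returns_le_green] by (simp add: ennreal_mult_less_top)
    then have "?S < top" by (simp add: D_finite)
    then have "?S \<noteq> \<infinity>" unfolding infinity_ennreal_def by (rule less_imp_neq)
    with eq have "?c * emeasure m (exit_paths G (D n) w) = emeasure m' (cyl \<B> (n, w) [])"
      unfolding ennreal_add_left_cancel by blast
    then show "emeasure (push m) (cyl \<B> x []) = emeasure m' (cyl \<B> x [])"
      unfolding x(1) emeasure_push_vertex[OF sets x(2)] .
  qed
  with m m0 show ?thesis by blast
qed

text \<open>
  Both conditions mean that \<open>\<Omega> - E\<close> is a null set: for \<open>push m\<close> because \<open>E\<close> is a union of fibres of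
  \<open>\<pi>\<close>, and for \<open>m\<close> by cutting paths at their last visit to some \<open>D n\<close>, which does not change
  membership in \<open>E\<close>.
\<close>
lemma concentrated_iff:
  assumes E: "E \<in> ends G" and m: "conformal G \<phi> m"
  shows "inf_paths G - E \<in> null_sets m \<longleftrightarrow> inf_paths \<B> - \<pi> ` E \<in> null_sets (push m)"
proof -
  have sets: "sets m = sets (path_borel G)" using m by (simp add: conformal_def)
  have Ec: "inf_paths G - E \<in> sets m"
    using sets.compl_sets[OF ends_sets[OF E]] by (simp add: sets)
  have sub: "\<Omega> \<subseteq> inf_paths G" using sets.sets_into_space[OF \<Omega>_sets] by simp
  have \<Omega>E: "\<Omega> - E \<in> sets m" using \<Omega>_sets ends_sets[OF E] by (simp add: sets)
  have "emeasure m (inf_paths G - E) = 0" if null: "emeasure m (\<Omega> - E) = 0"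
  proof -
    have "cyl G v [] \<inter> wan G \<inter> (inf_paths G - E) \<in> null_sets m" if v: "v \<in> verts G" for v
    proof -
      obtain n where n: "v \<in> D n" using v D_Union by auto
      have "emeasure m (cyl G v [] \<inter> wan G \<inter> (inf_paths G - E)) =
          (\<Sum>w\<in>D n. green v w * emeasure m (exit_paths G (D n) w \<inter> (inf_paths G - E)))"
      proof (rule emeasure_last_exit[OF m D_finite D_verts n Ec])
        fix \<mu> w y assume *: "awalk v \<mu> w" "y \<in> wan G" "tail G (y 0) = w"
        have yp: "y \<in> inf_paths G" using *(2) by (simp add: wan_def)
        then show "\<mu> \<frown> y \<in> inf_paths G - E \<longleftrightarrow> y \<in> inf_paths G - E"
          using conc_inf_path[OF *(1) yp *(3)] yp ends_tail_invariant[OF E *] by simp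
      qed
      also have "\<dots> = 0"
      proof (rule sum.neutral, rule ballI)
        fix w assume w: "w \<in> D n"
        have "emeasure m (exit_paths G (D n) w \<inter> (inf_paths G - E)) \<le> emeasure m (\<Omega> - E)"
          using \<Omega>I[OF _ w] by (intro emeasure_mono \<Omega>E) blast
        then show "green v w * emeasure m (exit_paths G (D n) w \<inter> (inf_paths G - E)) = 0"
          using null by simp
      qed
      finally show ?thesis using Ec wan_sets by (auto simp: null_sets_def sets)
    qed
    then have "(\<Union>v\<in>verts G. cyl G v [] \<inter> wan G \<inter> (inf_paths G - E)) \<in> null_sets m"
      using countable_verts by (intro null_sets_UN') auto
    then have "(\<Union>v\<in>verts G. cyl G v [] \<inter> wan G \<inter> (inf_paths G - E)) \<union> (inf_paths G - wan G) \<in> null_sets m"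
      using null_non_wandering[OF m] by (rule null_sets.Un)
    moreover have "inf_paths G - E \<subseteq>
        (\<Union>v\<in>verts G. cyl G v [] \<inter> wan G \<inter> (inf_paths G - E)) \<union> (inf_paths G - wan G)"
      using inf_path_tail by (auto simp: cyl_def)
    ultimately have "inf_paths G - E \<in> null_sets m" by (rule null_sets_subset[OF _ Ec])
    then show ?thesis by (simp add: null_sets_def)
  qed
  moreover have "emeasure m (\<Omega> - E) \<le> emeasure m (inf_paths G - E)"
    using sub by (intro emeasure_mono Ec) auto
  ultimately have "emeasure m (inf_paths G - E) = 0 \<longleftrightarrow> emeasure m (\<Omega> - E) = 0" by auto
  then show ?thesis
    using Ec bratteli_image_sets[OF E] green_v0 push_null[OF E sets] by (auto simp: null_sets_def)
qed

section \<open>Continuity in both directions\<close>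

lemma enn2real_walk_weight: "enn2real (walk_weight \<psi> \<mu>) = exp (- sum_list (map \<psi> \<mu>))"
  by (simp add: walk_weight_def)

text \<open>
  Subtracting the returning paths in \<open>emeasure_first_return\<close> requires real numbers.
\<close>
lemma measure_exit_paths:
  assumes m: "conformal G \<phi> m" and w: "w \<in> D n"
  shows "measure m (exit_paths G (D n) w) = measure m (cyl G w []) -
    (\<Sum>z\<in>D n. enn2real (weight \<phi> (first_returns (D n) w z)) * measure m (cyl G z []))"
proof -
  have vD: "z \<in> verts G" if "z \<in> D n" for z using that D_verts by blast
  have fin: "weight \<phi> (first_returns (D n) w z) * emeasure m (cyl G z []) < top" if "z \<in> D n" for z
    using conformal_finite[OF m vD[OF that]] green_finite[OF vD[OF w] vD[OF that]]
      le_less_trans[OF first_returns_le_green] by (simp add: ennreal_mult_less_top)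
  then have "enn2real (\<Sum>z\<in>D n. weight \<phi> (first_returns (D n) w z) * emeasure m (cyl G z [])) =
      (\<Sum>z\<in>D n. enn2real (weight \<phi> (first_returns (D n) w z)) * measure m (cyl G z []))"
    by (subst enn2real_sum) (auto simp: enn2real_mult measure_def intro!: sum.cong)
  moreover have "measure m (cyl G w []) = enn2real (emeasure m (exit_paths G (D n) w)) +
      enn2real (\<Sum>z\<in>D n. weight \<phi> (first_returns (D n) w z) * emeasure m (cyl G z []))"
    unfolding measure_def emeasure_first_return[OF m D_finite D_verts w]
    using emeasure_exit_paths_finite[OF m w] fin by (intro enn2real_plus) (simp_all add: D_finite)
  ultimately show ?thesis by (simp add: measure_def)
qed

lemma measure_push_cyl:
  assumes m: "conformal G \<phi> m" "emeasure m (cyl G v0 []) = 1" and aw: "B.awalk x \<nu> (n, w)"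
  shows "measure (push m) (cyl \<B> x \<nu>) = exp (- sum_list (map F\<^sub>\<beta> \<nu>)) *
    (enn2real (green v0 v0) * (measure m (cyl G w []) -
      (\<Sum>z\<in>D n. enn2real (weight \<phi> (first_returns (D n) w z)) * measure m (cyl G z []))))"
proof -
  have sets: "sets m = sets (path_borel G)" using m by (simp add: conformal_def)
  have "(n, w) \<in> verts \<B>" using B.awalk_last_in_verts[OF aw] .
  then have w: "w \<in> D n" using exit_verts_subset by (auto simp: bratteli_verts)
  show ?thesis
    unfolding measure_exit_paths[OF m(1) w, symmetric]
    unfolding measure_def B.emeasure_cyl[OF conformal_push(1)[OF m] aw] emeasure_push_vertex[OF sets w]
    by (simp add: enn2real_mult enn2real_walk_weight)
qed

lemma measure_cyl_push:
  assumes m: "conformal G \<phi> m" and aw: "awalk v \<mu> w" and w: "w \<in> D n"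
  shows "measure m (cyl G v \<mu>) = exp (- sum_list (map \<phi> \<mu>)) *
    (\<Sum>u\<in>D n. enn2real (green w u) / enn2real (green v0 v0) * measure (push m) (cyl \<B> (n, u) []))"
proof -
  have sets: "sets m = sets (path_borel G)" using m by (simp add: conformal_def)
  have c: "enn2real (green v0 v0) \<noteq> 0" using green_v0 by (simp add: enn2real_eq_0_iff)
  have fin: "green w u * emeasure m (exit_paths G (D n) u) < top" if "u \<in> D n" for u
    using emeasure_exit_paths_finite[OF m that] green_finite D_verts that w
    by (auto simp: ennreal_mult_less_top)
  have "measure m (cyl G w []) = (\<Sum>u\<in>D n. enn2real (green w u * emeasure m (exit_paths G (D n) u)))"
    unfolding measure_def emeasure_vertex[OF m w] using fin by (subst enn2real_sum) (simp_all add: comp_def)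
  also have "\<dots> = (\<Sum>u\<in>D n. enn2real (green w u) / enn2real (green v0 v0) * measure (push m) (cyl \<B> (n, u) []))"
    using c by (intro sum.cong refl) (simp add: measure_def emeasure_push_vertex[OF sets] enn2real_mult)
  finally show ?thesis
    unfolding measure_def emeasure_cyl[OF m aw] by (simp add: enn2real_mult enn2real_walk_weight)
qed

lemma bratteli_verts_nonempty:
  assumes E: "E \<in> ends G"
  shows "verts \<B> \<noteq> {}"
proof -
  obtain y where y: "y \<in> wan G" using E by (rule ends_eq)
  then have "tail G (y 0) \<in> verts G" using inf_path_tail by (simp add: wan_def)
  then obtain n where "tail G (y 0) \<in> D n" using D_Union by auto
  then obtain j where "tail G (y j) \<in> D n" "suffix j y \<in> exit_paths G (D n) (tail G (y j))"
    using last_at_visit[OF y] by metis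
  then have "(n, tail G (y j)) \<in> verts \<B>" using exit_vertsI by (simp add: bratteli_verts)
  then show ?thesis by blast
qed

lemma push_mix_measure:
  assumes sets: "sets m = sets (path_borel G)" "sets n = sets (path_borel G)"
  shows "push (mix_measure t m n) = mix_measure t (push m) (push n)"
proof (rule measure_eqI)
  fix A assume "A \<in> sets (push (mix_measure t m n))"
  then have A: "A \<in> sets (path_borel \<B>)" by simp
  have "{y \<in> \<Omega>. \<pi> y \<in> A} \<in> sets m" using \<Omega>_preimage_sets[OF A] sets by simp
  then show "emeasure (push (mix_measure t m n)) A = emeasure (mix_measure t (push m) (push n)) A"
    using A sets by (simp add: emeasure_push emeasure_mix_measure distrib_left mult.left_commute)
qed simp

text \<open>
  The formulas \<open>measure_push_cyl\<close> and \<open>measure_cyl_push\<close> express the mass of a cylinder on one side as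
  a fixed finite linear combination of masses of vertex cylinders on the other side.
\<close>
lemma push_homeomorphic:
  assumes E: "E \<in> ends G"
  defines "M \<equiv> conformal_on G \<phi> v0 E" and "M' \<equiv> conformal_on \<B> F\<^sub>\<beta> (0, v0) (\<pi> ` E)"
  shows "homeomorphic_map (cyl_topology G M) (cyl_topology \<B> M') push"
proof -
  have M: "conformal G \<phi> m" "emeasure m (cyl G v0 []) = 1" if "m \<in> M" for m
    using that by (simp_all add: M_def conformal_on_def)
  have push_M: "push m \<in> M'" if "m \<in> M" for m
    using conformal_push[OF M[OF that]] concentrated_iff[OF E M(1)[OF that]] that
    by (simp add: M_def M'_def conformal_on_def)
  have "\<exists>m. m \<in> M \<and> push m = m'" if m': "m' \<in> M'" for m'
  proof -
    have *: "conformal \<B> F\<^sub>\<beta> m'" "emeasure m' (cyl \<B> (0, v0) []) = 1"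
      "inf_paths \<B> - \<pi> ` E \<in> null_sets m'"
      using m' by (simp_all add: M'_def conformal_on_def)
    obtain m where "conformal G \<phi> m" "emeasure m (cyl G v0 []) = 1" "push m = m'"
      using push_surj[OF *(1,2)] by blast
    then show ?thesis
      using *(3) concentrated_iff[OF E] by (auto simp: M_def conformal_on_def)
  qed
  then obtain g where g: "\<And>m'. m' \<in> M' \<Longrightarrow> g m' \<in> M" "\<And>m'. m' \<in> M' \<Longrightarrow> push (g m') = m'" by metis
  have ne: "verts G \<noteq> {}" "verts \<B> \<noteq> {}" using v0_vert bratteli_verts_nonempty[OF E] by auto
  note top = topspace_cyl_topology[OF ne(1), of M] topspace_cyl_topology[OF ne(2), of M']
  have vertex: "continuous_map (cyl_topology G M) euclideanreal (\<lambda>m. measure m (cyl G w []))"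
    if "w \<in> verts G" for w
    using that by (intro continuous_map_cyl[OF ne(1), of w "[]" w]) (simp add: awalk_Nil_iff)
  have vertex': "continuous_map (cyl_topology \<B> M') euclideanreal (\<lambda>m. measure m (cyl \<B> x []))" for x
  proof (cases "x \<in> verts \<B>")
    case True
    then show ?thesis by (intro continuous_map_cyl[OF ne(2), of x "[]" x]) (simp add: B.awalk_Nil_iff)
  next
    case False
    then have "cyl \<B> x [] = {}" using bratteli_cyl_empty by (cases x) (simp add: bratteli_verts)
    then show ?thesis by simp
  qed
  have "continuous_map (cyl_topology G M) (cyl_topology \<B> M') push"
  proof (rule continuous_map_into_cyl_topology[OF ne(2)])
    fix x \<nu> x' assume "B.awalk x \<nu> x'"
    moreover obtain n w where x': "x' = (n, w)" by (cases x')
    ultimately have aw: "B.awalk x \<nu> (n, w)" by simp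
    have "w \<in> D n" using B.awalk_last_in_verts[OF aw] exit_verts_subset by (auto simp: bratteli_verts)
    then have w: "w \<in> verts G" using D_verts by blast
    have "continuous_map (cyl_topology G M) euclideanreal (\<lambda>m. exp (- sum_list (map F\<^sub>\<beta> \<nu>)) *
      (enn2real (green v0 v0) * (measure m (cyl G w []) -
        (\<Sum>z\<in>D n. enn2real (weight \<phi> (first_returns (D n) w z)) * measure m (cyl G z [])))))"
      by (intro continuous_map_real_mult_left continuous_map_diff continuous_map_sum vertex w D_finite
          subsetD[OF D_verts])
    then show "continuous_map (cyl_topology G M) euclideanreal (\<lambda>m. measure (push m) (cyl \<B> x \<nu>))"
      by (rule continuous_map_eq) (use top measure_push_cyl[OF M aw] in simp)
  qed (use push_M top in simp)
  moreover have "continuous_map (cyl_topology \<B> M') (cyl_topology G M) g"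
  proof (rule continuous_map_into_cyl_topology[OF ne(1)])
    fix v \<mu> w assume aw: "awalk v \<mu> w"
    obtain n where w: "w \<in> D n" using awalk_last_in_verts[OF aw] D_Union by auto
    have "continuous_map (cyl_topology \<B> M') euclideanreal (\<lambda>m'. exp (- sum_list (map \<phi> \<mu>)) *
      (\<Sum>u\<in>D n. enn2real (green w u) / enn2real (green v0 v0) * measure m' (cyl \<B> (n, u) [])))"
      by (intro continuous_map_real_mult_left continuous_map_sum vertex' D_finite)
    then show "continuous_map (cyl_topology \<B> M') euclideanreal (\<lambda>m'. measure (g m') (cyl G v \<mu>))"
      by (rule continuous_map_eq) (use top measure_cyl_push[OF M(1)[OF g(1)] aw w] g(2) in simp)
  qed (use g top in simp)
  moreover have "g (push m) = m" if "m \<in> M" for m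
    using push_inj[OF M(1)[OF g(1)[OF push_M[OF that]]] M(1)[OF that]] g(2)[OF push_M[OF that]] by simp
  ultimately have "homeomorphic_maps (cyl_topology G M) (cyl_topology \<B> M') push g"
    unfolding homeomorphic_maps_def top using g(2) by blast
  then show ?thesis unfolding homeomorphic_map_maps by blast
qed

end

theorem proposition8p24:
  fixes G :: "('v, 'e) pre_digraph" and F :: "'e \<Rightarrow> real" and \<beta> :: real
    and v0 :: 'v and D :: "nat \<Rightarrow> 'v set" and E :: "(nat \<Rightarrow> 'e) set"
  assumes "wf_digraph G" and "countable (verts G)" and "countable (arcs G)"
    and "infinite (verts G)" and "row_finite G"
    and "v0 \<in> verts G"
    and "\<forall>v\<in>verts G. summable (\<lambda>n. adj_pow G F \<beta> n v0 v) \<and> 0 < (\<Sum>n. adj_pow G F \<beta> n v0 v)"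
    and "exhaustion G v0 D"
    and "E \<in> ends G"
  defines "M \<equiv> conformal_on G (\<lambda>a. \<beta> * F a) v0 E"
    and "M' \<equiv> conformal_on (bratteli G D) (bratteli_potential G F \<beta> D) (0, v0)
                (bratteli_path G D ` E)"
  shows "\<exists>\<Phi>. homeomorphic_map (cyl_topology G M) (cyl_topology (bratteli G D) M') \<Phi> \<and>
             affine_on M \<Phi>"
proof -
  interpret countable_digraph G
    using assms(1-3) by (simp add: countable_digraph_def countable_digraph_axioms_def)
  interpret transient_digraph G "\<lambda>a. \<beta> * F a"
    by (rule transient_digraph_of_summable[OF assms(5-7)])
  interpret exhausted_digraph G \<beta> F v0 D
    by unfold_locales (rule assms(8))
  have "sets m = sets (path_borel G)" if "m \<in> M" for m
    using that by (simp add: M_def conformal_on_def conformal_def)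
  then have "affine_on M push"
    unfolding affine_on_def using push_mix_measure by blast
  moreover have "homeomorphic_map (cyl_topology G M) (cyl_topology (bratteli G D) M') push"
    unfolding M_def M'_def by (rule push_homeomorphic[OF assms(9)])
  ultimately show ?thesis by blast
qed

end
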